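(* Let $K$ be a global function field with constant field $\mathbb{F}_q$. If $S\subseteq\mathcal{P}$ is a set of prime divisors of $K$ having a natural density $\delta(S)$, then $$-\lim_{n\to\infty}\sum_{\substack{1\le \deg D\le n\\ D\in \mathfrak{D}(K,S)}}\frac{\mu(D)}{|D|}=\delta(S).$$
   Context: $p$ is a prime, $q$ a power of $p$, and $K$ is a finite extension of $\mathbb{F}_p(x)$ whose full constant field is $\mathbb{F}_q$. A prime divisor $P$ of $K$ is a place of $K$ (a discrete valuation ring $R_P\supset\mathbb{F}_q$ with fraction field $K$ and maximal ideal $P$); its norm is $|P|=\#(R_P/P)=q^{\deg P}$, defining $\deg P$. $\mathcal{P}$ is the set of all prime divisors. A divisor is a finite formal sum $D=\sum_P a_PP$ with $a_P\in\mathbb{Z}$; it is effective if all $a_P\ge0$; $P\mid D$ means $a_P\neq0$; $\deg D=\sum a_P\deg P$ and $|D|=q^{\deg D}$. For effective $D$, the Möbius function is $\mu(0)=1$, $\mu(D)=(-1)^k$ if $D=P_1+\dots+P_k$ with distinct primes $P_i$, and $\mu(D)=0$ if some coefficient exceeds $1$. For effective $D\neq0$, $d_-(D)=\min\{\deg P:P\mid D\}$; $D$ is distinguishable if $D\ne0$ and exactly one prime factor $P_{\min}(D)$ of $D$ has degree $d_-(D)$. For $S\subseteq\mathcal{P}$, $\mathfrak{D}(K,S)$ is the set of effective distinguishable divisors $D$ with $P_{\min}(D)\in S$. With $\pi_{K,S}(n)=\#\{P\in S:\deg P=n\}$ and $\pi_K(n)=\pi_{K,\mathcal{P}}(n)$,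 $S$ has natural density $\delta(S)$ if $\lim_{n\to\infty}\pi_{K,S}(n)/\pi_K(n)=\delta(S)$ exists. *)

theory Defs
  imports Complex_Main "HOL-Algebra.Algebraic_Closure_Type" "HOL-Algebra.Generated_Fields"
    "HOL-Library.Poly_Mapping"
begin

text \<open>The function field is a type \<open>'a\<close> of class \<open>field\<close>; \<open>fld\<close> is that type as a ring in the
  sense of \<open>HOL-Algebra\<close>.\<close>

abbreviation fld :: "'a::field ring"
  where "fld \<equiv> ring_of_type_algebra"

definition prime_subfield :: "'a::field set"
  where "prime_subfield = generate_field fld {}"

definition constant_field :: "'a::field set"
  where "constant_field = {a. ring.algebraic fld prime_subfield a}"

definition global_function_field :: "nat \<Rightarrow> nat \<Rightarrow> 'a::field itself \<Rightarrow> bool"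
  where "global_function_field p q K \<longleftrightarrow>
    Factorial_Ring.prime p \<and> CHAR('a) = p \<and> (\<exists>r>0. q = p ^ r) \<and>
    (\<exists>x::'a. ring.transcendental fld prime_subfield x \<and>
       ring.finite_dimension fld (generate_field fld {x}) (UNIV :: 'a set)) \<and>
    card (constant_field :: 'a set) = q"

definition discrete_valuation_ring :: "('b, 'c) ring_scheme \<Rightarrow> bool"
  where "discrete_valuation_ring R \<longleftrightarrow>
    principal_domain R \<and> \<not> field R \<and> (\<exists>!M. maximalideal M R)"

text \<open>A prime divisor \<open>P\<close> is represented by the underlying set of its valuation ring \<open>R\<^sub>P\<close>; the
  maximal ideal of that ring is \<open>pd_ideal\<close>.\<close>

definition pd_ring :: "'a::field set \<Rightarrow> 'a ring"
  where "pd_ring P = fld\<lparr>carrier := P\<rparr>"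

definition prime_divisors :: "'a::field set set"
  where "prime_divisors = {P. subring P fld \<and> constant_field \<subseteq> P \<and>
    discrete_valuation_ring (pd_ring P) \<and>
    (\<forall>z. \<exists>a\<in>P. \<exists>b\<in>P. b \<noteq> 0 \<and> z = a / b)}"

definition pd_ideal :: "'a::field set \<Rightarrow> 'a set"
  where "pd_ideal P = (THE M. maximalideal M (pd_ring P))"

definition pd_norm :: "'a::field set \<Rightarrow> nat"
  where "pd_norm P = card (carrier (pd_ring P Quot pd_ideal P))"

definition pd_degree :: "nat \<Rightarrow> 'a::field set \<Rightarrow> nat"
  where "pd_degree q P = (THE n. pd_norm P = q ^ n)"

text \<open>A divisor is a finitely supported integer-valued function on the prime divisors; its support
  \<open>keys D\<close> is the set of primes dividing it.\<close>

type_synonym 'a divisor = "'a set \<Rightarrow>\<^sub>0 int"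

definition divisors :: "'a::field divisor set"
  where "divisors = {D. Poly_Mapping.keys D \<subseteq> prime_divisors}"

definition effective :: "'a::field divisor \<Rightarrow> bool"
  where "effective D \<longleftrightarrow> (\<forall>P. Poly_Mapping.lookup D P \<ge> 0)"

definition div_degree :: "nat \<Rightarrow> 'a::field divisor \<Rightarrow> int"
  where "div_degree q D = (\<Sum>P\<in>Poly_Mapping.keys D. Poly_Mapping.lookup D P * int (pd_degree q P))"

definition div_norm :: "nat \<Rightarrow> 'a::field divisor \<Rightarrow> real"
  where "div_norm q D = real q powi div_degree q D"

text \<open>Meaningful for effective divisors only.\<close>

definition div_moebius :: "'a::field divisor \<Rightarrow> int"
  where "div_moebius D = (if \<exists>P. Poly_Mapping.lookup D P > 1 then 0 else (-1) ^ card (Poly_Mapping.keys D))"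

definition min_degree :: "nat \<Rightarrow> 'a::field divisor \<Rightarrow> nat"
  where "min_degree q D = Min (pd_degree q ` Poly_Mapping.keys D)"

definition distinguishable :: "nat \<Rightarrow> 'a::field divisor \<Rightarrow> bool"
  where "distinguishable q D \<longleftrightarrow>
    D \<noteq> 0 \<and> (\<exists>!P. P \<in> Poly_Mapping.keys D \<and> pd_degree q P = min_degree q D)"

definition P_min :: "nat \<Rightarrow> 'a::field divisor \<Rightarrow> 'a set"
  where "P_min q D = (THE P. P \<in> Poly_Mapping.keys D \<and> pd_degree q P = min_degree q D)"

definition distinguishable_divisors :: "nat \<Rightarrow> 'a::field set set \<Rightarrow> 'a divisor set"
  where "distinguishable_divisors q S =
    {D \<in> divisors. effective D \<and> distinguishable q D \<and> P_min q D \<in> S}"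

definition prime_count :: "nat \<Rightarrow> 'a::field set set \<Rightarrow> nat \<Rightarrow> nat"
  where "prime_count q S n = card {P \<in> S. pd_degree q P = n}"

definition has_natural_density :: "nat \<Rightarrow> 'a::field set set \<Rightarrow> real \<Rightarrow> bool"
  where "has_natural_density q S \<delta> \<longleftrightarrow>
    (\<lambda>n. real (prime_count q S n) / real (prime_count q (prime_divisors :: 'a set set) n))
      \<longlonglongrightarrow> \<delta>"

end

theory Submission
  imports Defs "HOL-Complex_Analysis.Complex_Analysis"
begin

text \<open>
  Write \<open>Z\<close> for the zeta series counting effective divisors and \<open>Z\<^sub>m\<close> for its Euler product over primes
  of degree at most \<open>m\<close>. A squarefree distinguishable divisor is a prime \<open>P\<close> plus a squarefree
  divisor with all prime degrees exceeding \<open>deg P = m\<close>, so the generating series of \<open>-\<mu>(D)\<close> over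
  \<open>\<DD>(K,S)\<close> is \<open>(\<Sum>\<^sub>m \<pi>\<^sub>S(m) X\<^sup>m Z\<^sub>m) / Z\<close>. The numerator counts effective divisors weighted by
  their top-degree primes in \<open>S\<close>; as almost all divisors have exactly one prime of top degree, its
  \<open>n\<close>-th coefficient is asymptotically \<open>\<delta>\<close> times that of \<open>Z\<close>. Since \<open>(1 - qX) Z\<close> has no zero with
  \<open>|X| \<le> 1/q\<close>, dividing by \<open>Z\<close> and summing coefficients gives the limit \<open>\<delta>\<close>.

  The analytic input is that the number of effective divisors of degree \<open>n\<close> is \<open>\<alpha>q\<^sup>n - \<beta>\<close> for large
  \<open>n\<close> divisible by the least positive divisor degree \<open>d\<close>, which is Riemann's theorem. All dimensions are
  replaced by cardinalities: if the sums \<open>\<Sum>\<^sub>i z\<^sup>i u\<^sub>i\<close> with digits in a finite set \<open>U\<close> are pairwise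
  distinct, counting them bounds \<open>U\<close>. The equality \<open>d = 1\<close> is never needed: if \<open>d > 1\<close>, everything is
  expressed in terms of \<open>X\<^sup>d\<close>.
\<close>

text \<open>Partial sums of a series are coefficients of its product with
  \<open>1 / (1 - X)\<close>. In the variable \<open>u = (q X) ^ d\<close> the sums in question are
  therefore coefficients of the numerator divided by \<open>(1 - u) Z\<close>: a convergent sequence
  convolved with the coefficients of \<open>1 / ((1 - u) Z)\<close>. The latter are absolutely
  summable once \<open>(1 - u) Z\<close>, analytic for \<open>|u| < q ^ d\<close> by Riemann's
  theorem, has no zero with \<open>|u| \<le> 1\<close>, because compactness then gives a larger
  zero-free disc. Their sum \<open>1 / \<alpha>\<close> cancels the \<open>\<alpha>\<close> of the
  numerator.

  Inside the disc \<open>Z\<close> is an exponential. On the circle the inequality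
  \<open>3 + 4 cos t + cos 2t \<ge> 0\<close> excludes all zeros except at \<open>u = -1\<close>,
  whose square falls on the pole; there the coefficients of \<open>Z(u) Z(-u)\<close> are compared
  with those of \<open>Z\<close>. The same summability gives \<open>O(q ^ m / m)\<close> primes of
  degree \<open>m\<close>, so divisors with several primes of top degree \<open>m\<close> have a
  share of \<open>O(1 / m ^ 2)\<close>, which vanishes in the limit for each fixed
  \<open>m\<close>.\<close>

lemma power_bound_imp_le:
  fixes a b D :: nat
  assumes "\<And>m. a ^ m \<le> D * b ^ m"
  shows "a \<le> b"
proof (rule ccontr)
  assume "\<not> a \<le> b"
  then have ab: "b < a" by simp
  show False
  proof (cases "b = 0")
    case True
    then show False using assms[of 1] ab by simp
  next
    case False
    then have "real a / real b > 1" using ab by simp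
    then obtain m where "real D < (real a / real b) ^ m"
      using real_arch_pow by blast
    then have "real D * real b ^ m < real a ^ m"
      using False by (simp add: power_divide field_simps)
    then have "D * b ^ m < a ^ m"
      by (metis of_nat_less_iff of_nat_mult of_nat_power)
    then show False using assms[of m] by simp
  qed
qed

subsection \<open>Digit expansions\<close>

definition digit_sum :: "'a::field \<Rightarrow> nat \<Rightarrow> (nat \<Rightarrow> 'a) \<Rightarrow> 'a"
  where "digit_sum z m f = (\<Sum>i<m. z ^ i * f i)"

text \<open>For a nonzero finite \<open>k\<close>-space \<open>U\<close> this amounts to a
  \<open>k\<close>-basis of \<open>U\<close> being linearly independent over the polynomials in
  \<open>z\<close>. It is the counting substitute for independence over the field generated by
  \<open>z\<close>.\<close>

definition digit_free :: "'a::field \<Rightarrow> 'a set \<Rightarrow> bool"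
  where "digit_free z U \<longleftrightarrow> (\<forall>m. inj_on (digit_sum z m) ({..<m} \<rightarrow>\<^sub>E U))"

lemma digit_sum_0 [simp]: "digit_sum z 0 f = 0"
  by (simp add: digit_sum_def)

lemma digit_sum_Suc: "digit_sum z (Suc m) f = f 0 + z * digit_sum z m (\<lambda>i. f (Suc i))"
  unfolding digit_sum_def
  by (simp add: sum.lessThan_Suc_shift sum_distrib_left mult.assoc del: sum.lessThan_Suc)

lemma card_digit_sums:
  assumes "finite U" "inj_on (digit_sum z m) ({..<m} \<rightarrow>\<^sub>E U)"
  shows "card (digit_sum z m ` ({..<m} \<rightarrow>\<^sub>E U)) = card U ^ m"
  using assms by (simp add: card_image card_PiE)

definition add_subgroup :: "'a::ab_group_add set \<Rightarrow> bool"
  where "add_subgroup H \<longleftrightarrow> 0 \<in> H \<and> (\<forall>x\<in>H. \<forall>y\<in>H. x - y \<in> H)"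

lemma add_subgroupD:
  assumes "add_subgroup H"
  shows "0 \<in> H" "x \<in> H \<Longrightarrow> y \<in> H \<Longrightarrow> x - y \<in> H" "x \<in> H \<Longrightarrow> - x \<in> H"
    "x \<in> H \<Longrightarrow> y \<in> H \<Longrightarrow> x + y \<in> H"
proof -
  show *: "0 \<in> H" "x \<in> H \<Longrightarrow> y \<in> H \<Longrightarrow> x - y \<in> H" for x y
    using assms unfolding add_subgroup_def by auto
  show **: "x \<in> H \<Longrightarrow> - x \<in> H" for x using *(2)[of 0 x] *(1) by simp
  show "x \<in> H \<Longrightarrow> y \<in> H \<Longrightarrow> x + y \<in> H" using *(2)[of x "- y"] **[of y] by simp
qed

lemma add_subgroup_sum:
  assumes "add_subgroup H" "\<And>i. i \<in> I \<Longrightarrow> f i \<in> H"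
  shows "sum f I \<in> H"
  using assms(2)
  by (induction I rule: infinite_finite_induct) (auto intro: add_subgroupD[OF assms(1)])

lemma digit_sum_mem:
  assumes "add_subgroup H" "\<And>y. y \<in> H \<Longrightarrow> z * y \<in> H" "\<And>i. i < m \<Longrightarrow> f i \<in> H"
  shows "digit_sum z m f \<in> H"
  using assms(3)
  by (induction m arbitrary: f) (auto simp: digit_sum_Suc intro!: add_subgroupD(1,4)[OF assms(1)] assms(2))

text \<open>Modulo \<open>z * H\<close> only the digit at 0 survives, so the two leading digits
  agree; cancel them, divide by \<open>z\<close> and recurse. Congruence modulo
  \<open>z ^ m * H\<close> in place of equality makes the lemma serve truncated expansions at a
  place as well.\<close>

lemma digit_sum_inj:
  assumes H: "add_subgroup H" "\<And>y. y \<in> H \<Longrightarrow> z * y \<in> H"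
    and U: "U \<subseteq> H" "\<And>u v. u \<in> U \<Longrightarrow> v \<in> U \<Longrightarrow> u - v \<in> (*) z ` H \<Longrightarrow> u = v"
    and fg: "\<And>i. i < m \<Longrightarrow> f i \<in> U" "\<And>i. i < m \<Longrightarrow> g i \<in> U"
    and eq: "digit_sum z m f - digit_sum z m g \<in> (\<lambda>y. z ^ m * y) ` H"
    and z: "z \<noteq> 0"
    and i: "i < m"
  shows "f i = g i"
  using fg eq i
proof (induction m arbitrary: f g i)
  case 0
  then show ?case by simp
next
  case (Suc m)
  define f' where "f' = (\<lambda>i. f (Suc i))"
  define g' where "g' = (\<lambda>i. g (Suc i))"
  obtain y where y: "y \<in> H" "digit_sum z (Suc m) f - digit_sum z (Suc m) g = z ^ Suc m * y"
    using Suc.prems(3) by auto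
  have e: "f 0 - g 0 = z * (z ^ m * y - (digit_sum z m f' - digit_sum z m g'))"
    using y(2) by (simp add: digit_sum_Suc f'_def g'_def algebra_simps)
  have zH: "z ^ j * y \<in> H" for j
    using y(1) by (induction j) (auto simp: mult.assoc intro: H(2))
  have dH: "digit_sum z m f' \<in> H" "digit_sum z m g' \<in> H"
    using Suc.prems(1,2) U(1) by (auto intro!: digit_sum_mem H simp: f'_def g'_def)
  have "f 0 - g 0 \<in> (*) z ` H"
    unfolding e by (intro imageI add_subgroupD(2)[OF H(1)] zH dH)
  then have 0: "f 0 = g 0" using U(2) Suc.prems(1,2) by blast
  with e z have e': "digit_sum z m f' - digit_sum z m g' = z ^ m * y" by simp
  have "i > 0 \<Longrightarrow> f' (i - 1) = g' (i - 1)"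
    using Suc.prems by (intro Suc.IH) (auto simp: f'_def g'_def e'[unfolded f'_def g'_def] y(1))
  then show ?case using 0 by (cases i) (auto simp: f'_def g'_def)
qed

lemma digit_freeI:
  assumes H: "add_subgroup H" "\<And>y. y \<in> H \<Longrightarrow> z * y \<in> H"
    and U: "U \<subseteq> H" "\<And>u v. u \<in> U \<Longrightarrow> v \<in> U \<Longrightarrow> u - v \<in> (*) z ` H \<Longrightarrow> u = v"
    and z: "z \<noteq> 0"
  shows "digit_free z U"
  unfolding digit_free_def
proof (intro allI inj_onI)
  fix m f g
  assume f: "f \<in> {..<m} \<rightarrow>\<^sub>E U" and g: "g \<in> {..<m} \<rightarrow>\<^sub>E U"
    and eq: "digit_sum z m f = digit_sum z m g"
  have "f i = g i" if "i < m" for i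
    using f g eq add_subgroupD(1)[OF H(1)] that
    by (intro digit_sum_inj[OF H U _ _ _ z, of m f g i]) (auto simp: PiE_iff image_iff)
  then show "f = g" using f g by (intro PiE_ext[of f _ _ g]) auto
qed

definition subring_set :: "'a::comm_ring_1 set \<Rightarrow> bool"
  where "subring_set R \<longleftrightarrow> 1 \<in> R \<and> (\<forall>a\<in>R. \<forall>b\<in>R. a - b \<in> R \<and> a * b \<in> R)"

lemma subring_setD:
  assumes "subring_set R"
  shows "1 \<in> R" "0 \<in> R" "add_subgroup R" "a \<in> R \<Longrightarrow> b \<in> R \<Longrightarrow> a - b \<in> R"
    "a \<in> R \<Longrightarrow> b \<in> R \<Longrightarrow> a * b \<in> R" "a \<in> R \<Longrightarrow> b \<in> R \<Longrightarrow> a + b \<in> R" "a \<in> R \<Longrightarrow> - a \<in> R"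
    "a \<in> R \<Longrightarrow> a ^ n \<in> R"
proof -
  show 1: "1 \<in> R" "a \<in> R \<Longrightarrow> b \<in> R \<Longrightarrow> a - b \<in> R" "a \<in> R \<Longrightarrow> b \<in> R \<Longrightarrow> a * b \<in> R" for a b
    using assms by (auto simp: subring_set_def)
  show 0: "0 \<in> R" using 1(2)[OF 1(1) 1(1)] by simp
  show 2: "add_subgroup R" using 0 1 by (auto simp: add_subgroup_def)
  show "a \<in> R \<Longrightarrow> b \<in> R \<Longrightarrow> a + b \<in> R" "a \<in> R \<Longrightarrow> - a \<in> R"
    using add_subgroupD[OF 2] by auto
  show "a \<in> R \<Longrightarrow> a ^ n \<in> R" by (induction n) (auto simp: 1)
qed

definition polys_over :: "'a::comm_ring_1 set \<Rightarrow> 'a poly set"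
  where "polys_over R = {f. \<forall>i. coeff f i \<in> R}"

context
  fixes R :: "'a::comm_ring_1 set"
  assumes R: "subring_set R"
begin

lemma polys_over_0: "0 \<in> polys_over R"
  by (simp add: polys_over_def subring_setD[OF R])

lemma polys_over_monom: "c \<in> R \<Longrightarrow> monom c n \<in> polys_over R"
  by (auto simp: polys_over_def subring_setD[OF R])

lemma polys_over_const: "c \<in> R \<Longrightarrow> [:c:] \<in> polys_over R"
  using polys_over_monom[of c 0] by (simp add: monom_0)

lemma polys_over_1: "1 \<in> polys_over R"
  using polys_over_const[OF subring_setD(1)[OF R]] by (simp add: one_pCons)

lemma polys_over_X: "[:0, 1:] \<in> polys_over R"
  using polys_over_monom[OF subring_setD(1)[OF R], of 1] by (simp add: monom_altdef)

lemma polys_over_diff: "f \<in> polys_over R \<Longrightarrow> g \<in> polys_over R \<Longrightarrow> f - g \<in> polys_over R"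
  by (auto simp: polys_over_def subring_setD[OF R])

lemma polys_over_add: "f \<in> polys_over R \<Longrightarrow> g \<in> polys_over R \<Longrightarrow> f + g \<in> polys_over R"
  by (auto simp: polys_over_def subring_setD[OF R])

lemma polys_over_sum: "(\<And>i. i \<in> I \<Longrightarrow> f i \<in> polys_over R) \<Longrightarrow> sum f I \<in> polys_over R"
  by (induction I rule: infinite_finite_induct) (auto simp: polys_over_0 polys_over_add)

lemma polys_over_mult: "f \<in> polys_over R \<Longrightarrow> g \<in> polys_over R \<Longrightarrow> f * g \<in> polys_over R"
  by (auto simp: polys_over_def coeff_mult intro!: add_subgroup_sum subring_setD[OF R])

lemma poly_mem_subring: "f \<in> polys_over R \<Longrightarrow> z \<in> R \<Longrightarrow> poly f z \<in> R"
  by (auto simp: poly_altdef polys_over_def intro!: add_subgroup_sum subring_setD[OF R])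

end

subsection \<open>Finite fields of constants\<close>

locale finite_subfield =
  fixes k :: "'a::field set"
  assumes finite_k: "finite k"
    and k_1: "1 \<in> k"
    and k_diff: "a \<in> k \<Longrightarrow> b \<in> k \<Longrightarrow> a - b \<in> k"
    and k_mult: "a \<in> k \<Longrightarrow> b \<in> k \<Longrightarrow> a * b \<in> k"
    and k_inverse: "a \<in> k \<Longrightarrow> inverse a \<in> k"
begin

lemma k_0: "0 \<in> k" using k_diff[OF k_1 k_1] by simp
lemma card_k_ge_2: "2 \<le> card k"
proof -
  have "card {0, 1 :: 'a} \<le> card k" by (rule card_mono) (auto simp: finite_k k_0 k_1)
  then show ?thesis by simp
qed

abbreviation kpoly :: "'a poly set" where "kpoly \<equiv> polys_over k"

lemma k_subring: "subring_set k"
  unfolding subring_set_def using k_1 k_diff k_mult by auto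

lemmas kpoly_0 = polys_over_0[OF k_subring]
lemmas kpoly_1 = polys_over_1[OF k_subring]
lemmas kpoly_add = polys_over_add[OF k_subring]
lemmas kpoly_mult = polys_over_mult[OF k_subring]

definition kpoly_le :: "nat \<Rightarrow> 'a poly set" where "kpoly_le d = {f \<in> kpoly. degree f \<le> d}"

lemma card_kpoly_le: "finite (kpoly_le d) \<and> card (kpoly_le d) \<le> card k ^ Suc d"
proof -
  let ?g = "\<lambda>c. \<Sum>i\<le>d. monom (c i) i"
  have sub: "kpoly_le d \<subseteq> ?g ` ({..d} \<rightarrow>\<^sub>E k)"
  proof
    fix f assume f: "f \<in> kpoly_le d"
    let ?c = "restrict (coeff f) {..d}"
    have "?g ?c = (\<Sum>i\<le>d. monom (coeff f i) i)" by (intro sum.cong) auto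
    also have "\<dots> = f" using f by (intro poly_as_sum_of_monoms') (auto simp: kpoly_le_def)
    finally show "f \<in> ?g ` ({..d} \<rightarrow>\<^sub>E k)"
      using f by (intro image_eqI[of _ _ ?c]) (auto simp: kpoly_le_def polys_over_def)
  qed
  have fin: "finite ({..d} \<rightarrow>\<^sub>E k)" by (intro finite_PiE) (auto simp: finite_k)
  have "card (kpoly_le d) \<le> card (?g ` ({..d} \<rightarrow>\<^sub>E k))"
    by (rule card_mono[OF _ sub]) (simp add: fin)
  also have "\<dots> \<le> card ({..d} \<rightarrow>\<^sub>E k)" by (rule card_image_le[OF fin])
  also have "\<dots> = card k ^ Suc d" by (simp add: card_PiE)
  finally show ?thesis using finite_subset[OF sub] fin by auto
qed

end

text \<open>\<open>spanning\<close> is finite dimension over the field generated by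
  \<open>x\<close>, with denominators cleared. \<open>root_in_k\<close> expresses that
  \<open>k\<close> is the full constant field: an element algebraic over a finite field has two
  equal powers. Under it, \<open>x_notin_k\<close> makes \<open>x\<close> transcendental.\<close>

locale function_field = finite_subfield k for k :: "'a::field set" +
  fixes x :: 'a and W :: "'a set"
  assumes finite_W: "finite W"
    and spanning: "\<exists>h f. h \<in> kpoly \<and> poly h x \<noteq> 0 \<and> (\<forall>w\<in>W. f w \<in> kpoly)
        \<and> poly h x * y = (\<Sum>w\<in>W. poly (f w) x * w)"
    and root_in_k: "m < l \<Longrightarrow> y ^ m = y ^ l \<Longrightarrow> y \<in> k"
    and x_notin_k: "x \<notin> k"
begin

text \<open>A box of bounded height in the module spanned by \<open>W\<close> over the polynomials
  in \<open>x\<close>. Its size is at most exponential in \<open>d\<close>, with a base depending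
  only on \<open>k\<close> and \<open>W\<close>.\<close>

definition hbox :: "nat \<Rightarrow> 'a set"
  where "hbox d = (\<lambda>f. \<Sum>w\<in>W. poly (f w) x * w) ` (W \<rightarrow>\<^sub>E kpoly_le d)"

lemma boxI:
  assumes "\<And>w. w \<in> W \<Longrightarrow> f w \<in> kpoly_le d" "y = (\<Sum>w\<in>W. poly (f w) x * w)"
  shows "y \<in> hbox d"
  unfolding hbox_def using assms by (intro image_eqI[of _ _ "restrict f W"]) auto

lemma boxE:
  assumes "y \<in> hbox d"
  obtains f where "\<And>w. w \<in> W \<Longrightarrow> f w \<in> kpoly_le d" "y = (\<Sum>w\<in>W. poly (f w) x * w)"
  using assms unfolding hbox_def by auto

lemma finite_box: "finite (hbox d)"
  unfolding hbox_def using finite_W card_kpoly_le by (auto intro!: finite_imageI finite_PiE)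

lemma card_box: "card (hbox d) \<le> (card k ^ card W) ^ Suc d"
proof -
  have "card (hbox d) \<le> card (W \<rightarrow>\<^sub>E kpoly_le d)"
    unfolding hbox_def using finite_W card_kpoly_le by (auto intro!: card_image_le finite_PiE)
  also have "\<dots> = card (kpoly_le d) ^ card W" by (simp add: card_PiE finite_W)
  also have "\<dots> \<le> (card k ^ Suc d) ^ card W" using card_kpoly_le by (intro power_mono) auto
  also have "\<dots> = (card k ^ card W) ^ Suc d" by (simp only: power_mult[symmetric] mult.commute)
  finally show ?thesis .
qed

lemma box_mono: "d \<le> e \<Longrightarrow> hbox d \<subseteq> hbox e"
  by (auto elim!: boxE intro!: boxI simp: kpoly_le_def)

lemma box_add: "y \<in> hbox d \<Longrightarrow> y' \<in> hbox d \<Longrightarrow> y + y' \<in> hbox d"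
proof (elim boxE)
  fix f g assume *: "\<And>w. w \<in> W \<Longrightarrow> f w \<in> kpoly_le d" "y = (\<Sum>w\<in>W. poly (f w) x * w)"
    "\<And>w. w \<in> W \<Longrightarrow> g w \<in> kpoly_le d" "y' = (\<Sum>w\<in>W. poly (g w) x * w)"
  show "y + y' \<in> hbox d"
    by (rule boxI[of "\<lambda>w. f w + g w"])
      (use * in \<open>auto simp: kpoly_le_def kpoly_add degree_add_le sum.distrib algebra_simps\<close>)
qed

lemma box_0: "0 \<in> hbox d"
  by (rule boxI[of "\<lambda>_. 0"]) (auto simp: kpoly_le_def kpoly_0)

lemma box_sum: "(\<And>i. i \<in> I \<Longrightarrow> f i \<in> hbox d) \<Longrightarrow> sum f I \<in> hbox d"
  by (induction I rule: infinite_finite_induct) (auto simp: box_0 box_add)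

lemma box_mult:
  assumes "g \<in> kpoly_le e" "y \<in> hbox d"
  shows "poly g x * y \<in> hbox (d + e)"
proof -
  obtain f where f: "\<And>w. w \<in> W \<Longrightarrow> f w \<in> kpoly_le d" "y = (\<Sum>w\<in>W. poly (f w) x * w)"
    using assms(2) by (auto elim: boxE)
  have "degree (g * f w) \<le> d + e" if "w \<in> W" for w
    using degree_mult_le[of g "f w"] f(1)[OF that] assms(1) by (auto simp: kpoly_le_def)
  then show ?thesis using f assms
    by (intro boxI[of "\<lambda>w. g * f w"]) (auto simp: kpoly_le_def kpoly_mult sum_distrib_left mult.assoc)
qed

lemma ex_box: "\<exists>h\<in>kpoly. \<exists>d. poly h x \<noteq> 0 \<and> poly h x * y \<in> hbox d"
proof -
  obtain h f where h: "h \<in> kpoly" "poly h x \<noteq> 0" and f: "\<forall>w\<in>W. f w \<in> kpoly"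
    "poly h x * y = (\<Sum>w\<in>W. poly (f w) x * w)"
    using spanning[of y] by blast
  have "poly h x * y \<in> hbox (Max (insert 0 ((\<lambda>w. degree (f w)) ` W)))"
    using f finite_W by (intro boxI[of f]) (auto simp: kpoly_le_def)
  then show ?thesis using h by blast
qed

lemma ex_box_finite:
  assumes "finite Y"
  shows "\<exists>h\<in>kpoly. \<exists>d. poly h x \<noteq> 0 \<and> (\<forall>y\<in>Y. poly h x * y \<in> hbox d)"
  using assms
proof (induction Y rule: finite_induct)
  case empty
  then show ?case using kpoly_1 by (intro bexI[of _ 1]) auto
next
  case (insert y Y)
  obtain h d where h: "h \<in> kpoly" "poly h x \<noteq> 0" "\<And>y. y \<in> Y \<Longrightarrow> poly h x * y \<in> hbox d"
    using insert.IH by blast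
  obtain h' d' where h': "h' \<in> kpoly" "poly h' x \<noteq> 0" "poly h' x * y \<in> hbox d'"
    using ex_box[of y] by blast
  define e where "e = d + d' + degree h + degree h'"
  have "poly (h' * h) x * y' \<in> hbox e" if "y' \<in> insert y Y" for y'
  proof (cases "y' \<in> Y")
    case True
    have "poly h' x * (poly h x * y') \<in> hbox (d + degree h')"
      using h'(1) h(3)[OF True] by (intro box_mult) (auto simp: kpoly_le_def)
    then show ?thesis using box_mono[of "d + degree h'" e] by (auto simp: e_def mult.assoc)
  next
    case False
    then have [simp]: "y' = y" using that by simp
    have "poly h x * (poly h' x * y) \<in> hbox (d' + degree h)"
      using h(1) h'(3) by (intro box_mult) (auto simp: kpoly_le_def)
    then show ?thesis using box_mono[of "d' + degree h" e] by (auto simp: e_def mult_ac)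
  qed
  then show ?case using h h' by (intro bexI[of _ "h' * h"] exI[of _ e]) (auto simp: kpoly_mult)
qed

text \<open>Multiplication by \<open>z\<close> raises the degree bound of \<open>hbox\<close> by a constant \<open>C\<close> up to a fixed denominator, so the
  number of digit sums of length \<open>m\<close> grows at most like the \<open>m\<close>-th power of a constant.\<close>

lemma digit_free_bounded: fixes z :: 'a shows "\<exists>E. \<forall>U. finite U \<longrightarrow> digit_free z U \<longrightarrow> card U \<le> E"
proof -
  obtain h d where h: "h \<in> kpoly" "poly h x \<noteq> 0"
    and hd: "\<And>w. w \<in> W \<Longrightarrow> poly h x * (z * w) \<in> hbox d"
    using ex_box_finite[of "(*) z ` W"] finite_W by auto
  define C where "C = d + degree h"
  define A where "A = card k ^ card W"
  \<comment> \<open>Each multiplication by \<open>z\<close> costs one more denominator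
    \<open>h\<close>. The constant \<open>C\<close> is chosen so that multiplying by
    \<open>h * z\<close> and by \<open>h\<close> alone enlarge the box equally, and both summands of
    a Horner step can be added.\<close>
  have hz: "poly h x * z * y \<in> hbox (e + C)" if y: "y \<in> hbox e" for y e
  proof -
    obtain f where f: "\<And>w. w \<in> W \<Longrightarrow> f w \<in> kpoly_le e" "y = (\<Sum>w\<in>W. poly (f w) x * w)"
      using y by (auto elim: boxE)
    have "poly h x * z * y = (\<Sum>w\<in>W. poly (f w) x * (poly h x * (z * w)))"
      unfolding f(2) sum_distrib_left by (intro sum.cong) auto
    also have "\<dots> \<in> hbox (d + e)" using f(1) hd by (intro box_sum box_mult)
    finally show ?thesis using box_mono[of "d + e" "e + C"] by (auto simp: C_def)
  qed
  have hh: "poly h x * y \<in> hbox (e + C)" if "y \<in> hbox e" for y e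
    using box_mult[of h "degree h" y e] box_mono[of "e + degree h" "e + C"] that h
    by (auto simp: C_def kpoly_le_def)
  have "card U \<le> A ^ C" if U: "finite U" "digit_free z U" for U
  proof -
    obtain g e where g: "g \<in> kpoly" "poly g x \<noteq> 0" "\<And>u. u \<in> U \<Longrightarrow> poly g x * u \<in> hbox e"
      using ex_box_finite[OF U(1)] by blast
    \<comment> \<open>After \<open>m\<close> Horner steps the common denominator is
      \<open>h ^ m * g\<close>, where \<open>g\<close> clears the digits themselves; the box has
      grown linearly in \<open>m\<close>.\<close>
    have mem: "poly h x ^ m * poly g x * digit_sum z m f \<in> hbox (e + m * C)"
      if "\<And>i. i < m \<Longrightarrow> f i \<in> U" for m f
      using that
    proof (induction m arbitrary: f)
      case 0
      then show ?case by (simp add: box_0)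
    next
      case (Suc m)
      have 1: "poly h x ^ j * (poly g x * f 0) \<in> hbox (e + j * C)" for j
      proof (induction j)
        case 0
        then show ?case using g(3) Suc.prems[of 0] by simp
      next
        case (Suc j)
        then show ?case using hh[OF Suc.IH] by (simp add: mult_ac add_ac)
      qed
      have 2: "poly h x * z * (poly h x ^ m * poly g x * digit_sum z m (\<lambda>i. f (Suc i))) \<in> hbox (e + m * C + C)"
        using Suc.prems by (intro hz Suc.IH) auto
      then have 3: "poly h x * z * (poly h x ^ m * poly g x * digit_sum z m (\<lambda>i. f (Suc i))) \<in> hbox (e + Suc m * C)"
        by (simp add: add_ac)
      show ?case using box_add[OF 1[of "Suc m"] 3] by (simp add: digit_sum_Suc algebra_simps)
    qed
    \<comment> \<open>Only the constant factor depends on \<open>U\<close>, through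
      \<open>e\<close>. As \<open>m\<close> grows it becomes immaterial, and the bases
      compare.\<close>
    have "card U ^ m \<le> A ^ Suc e * (A ^ C) ^ m" for m
    proof -
      let ?D = "digit_sum z m ` ({..<m} \<rightarrow>\<^sub>E U)"
      have "card U ^ m = card ?D" using U by (simp add: card_digit_sums digit_free_def)
      also have "\<dots> = card ((*) (poly h x ^ m * poly g x) ` ?D)"
        using h(2) g(2) by (subst card_image[of _ ?D]) (auto simp: inj_on_def)
      also have "\<dots> \<le> card (hbox (e + m * C))"
        using mem by (intro card_mono finite_box) (auto simp: PiE_iff)
      also have "\<dots> \<le> A ^ Suc (e + m * C)" using card_box by (simp add: A_def)
      also have "\<dots> = A ^ Suc e * (A ^ C) ^ m" 
        by (simp add: power_add power_mult[symmetric] mult.commute)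
      finally show ?thesis .
    qed
    then show ?thesis by (rule power_bound_imp_le)
  qed
  then show ?thesis by blast
qed

end

subsection \<open>Discrete valuation rings of a field\<close>

text \<open>\<open>decomp\<close> carries the discreteness; \<open>t_inv\<close> makes the exponent
  unique and keeps \<open>P\<close> from being the whole field.\<close>

locale dvr =
  fixes P :: "'a::field set" and t :: 'a
  assumes P_subring: "subring_set P"
    and t_in: "t \<in> P" and t_nz: "t \<noteq> 0" and t_inv: "inverse t \<notin> P"
    and decomp: "z \<noteq> 0 \<Longrightarrow> \<exists>n::int. \<exists>u. u \<in> P \<and> u \<noteq> 0 \<and> inverse u \<in> P \<and> z = t powi n * u"
begin

definition unit :: "'a \<Rightarrow> bool" where "unit u \<longleftrightarrow> u \<in> P \<and> u \<noteq> 0 \<and> inverse u \<in> P"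

definition val :: "'a \<Rightarrow> int" where "val z = (THE n. \<exists>u. unit u \<and> z = t powi n * u)"

lemmas P_ring = subring_setD[OF P_subring]

lemma unit_mult: "unit u \<Longrightarrow> unit v \<Longrightarrow> unit (u * v)"
  by (auto simp: unit_def P_ring)

lemma unit_1: "unit 1" by (auto simp: unit_def P_ring)

lemma powi_mem: "n \<ge> 0 \<Longrightarrow> t powi n \<in> P"
  by (auto simp: power_int_def P_ring t_in)

text \<open>Otherwise multiplication by \<open>inverse u\<close> and by
  \<open>t powi (- n - 1)\<close>, which lies in \<open>P\<close> as \<open>n\<close> is negative,
  would put \<open>inverse t\<close> into \<open>P\<close>. Uniqueness of the exponent of
  \<open>t\<close> follows.\<close>

lemma not_powi_unit_mem:
  assumes "unit u" "n < 0"
  shows "t powi n * u \<notin> P"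
proof
  assume a: "t powi n * u \<in> P"
  have "(t powi n * u) * t powi (- n - 1) * inverse u \<in> P"
    using a assms by (intro P_ring(5)[OF P_ring(5)[OF a powi_mem]]) (auto simp: unit_def)
  also have "(t powi n * u) * t powi (- n - 1) * inverse u = t powi n * t powi (- n - 1)"
    using assms by (simp add: unit_def)
  also have "\<dots> = t powi (- 1)" using t_nz by (simp flip: power_int_add)
  finally show False using t_inv by (simp add: power_int_minus)
qed

lemma val_eqI:
  assumes "unit u" "z = t powi n * u"
  shows "val z = n"
proof -
  have "m \<le> n" if "unit u" "unit v" "t powi n * u = t powi m * v" for m n u v
  proof (rule ccontr)
    assume "\<not> m \<le> n"
    then have "t powi (n - m) * u \<notin> P" using that by (intro not_powi_unit_mem) auto
    moreover have "t powi (n - m) * u = v"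
      using that(3) t_nz by (simp add: power_int_diff field_simps)
    ultimately show False using that by (simp add: unit_def)
  qed
  then show ?thesis unfolding val_def using assms by (intro the_equality) (metis order.antisym)+
qed

lemma val_decomp:
  assumes "z \<noteq> 0"
  obtains u where "unit u" "z = t powi val z * u"
  using decomp[OF assms] val_eqI unfolding unit_def by metis

lemma val_t: "val t = 1" by (rule val_eqI[OF unit_1]) simp
lemma val_1: "val 1 = 0" by (rule val_eqI[OF unit_1]) simp

lemma val_mult:
  assumes "z \<noteq> 0" "w \<noteq> 0"
  shows "val (z * w) = val z + val w"
proof -
  obtain u v where u: "unit u" "z = t powi val z * u" and v: "unit v" "w = t powi val w * v"
    using assms val_decomp by metis
  have "z * w = (t powi val z * u) * (t powi val w * v)" using u(2) v(2) by argo
  also have "\<dots> = t powi (val z + val w) * (u * v)" using t_nz by (simp add: power_int_add)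
  finally show ?thesis using unit_mult[OF u(1) v(1)] by (rule val_eqI[rotated])
qed

lemma val_inverse:
  assumes "z \<noteq> 0"
  shows "val (inverse z) = - val z"
  using val_mult[OF assms, of "inverse z"] assms val_1 by simp

lemma val_divide: "z \<noteq> 0 \<Longrightarrow> w \<noteq> 0 \<Longrightarrow> val (z / w) = val z - val w"
  using val_mult[of z "inverse w"] val_inverse[of w] by (simp add: divide_inverse)

lemma val_power: "z \<noteq> 0 \<Longrightarrow> val (z ^ n) = int n * val z"
  by (induction n) (auto simp: val_mult val_1 algebra_simps)

lemma val_powi: "val (t powi n) = n"
  by (rule val_eqI[OF unit_1]) simp

lemma mem_iff_val:
  assumes "z \<noteq> 0"
  shows "z \<in> P \<longleftrightarrow> val z \<ge> 0"
proof -
  obtain u where u: "unit u" "z = t powi val z * u" using val_decomp[OF assms] .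
  show ?thesis
  proof (cases "val z \<ge> 0")
    case True
    then have "t powi val z * u \<in> P" using u(1) by (intro P_ring(5) powi_mem) (auto simp: unit_def)
    then show ?thesis using True u(2) by simp
  next
    case False
    then show ?thesis using not_powi_unit_mem[OF u(1), of "val z"] u(2) by simp
  qed
qed

text \<open>The disjunct \<open>z = 0\<close> stands for infinite valuation: \<open>val 0\<close> is
  an unspecified integer.\<close>

definition vge :: "int \<Rightarrow> 'a \<Rightarrow> bool" where "vge n z \<longleftrightarrow> z = 0 \<or> n \<le> val z"

lemma mem_iff_vge: "z \<in> P \<longleftrightarrow> vge 0 z"
  using mem_iff_val P_ring by (cases "z = 0") (auto simp: vge_def)

lemma vge_0 [simp]: "vge n 0" by (simp add: vge_def)

lemma vge_mono: "vge n z \<Longrightarrow> m \<le> n \<Longrightarrow> vge m z"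
  by (auto simp: vge_def)

lemma vge_mult: "vge n z \<Longrightarrow> vge m w \<Longrightarrow> vge (n + m) (z * w)"
  by (cases "z = 0"; cases "w = 0") (auto simp: vge_def val_mult)

lemma vge_iff_mem: "vge n z \<longleftrightarrow> z * t powi (- n) \<in> P"
  using t_nz by (cases "z = 0") (auto simp: vge_def mem_iff_val val_mult val_powi P_ring)

lemma vge_diff: "vge n z \<Longrightarrow> vge n w \<Longrightarrow> vge n (z - w)"
  by (auto simp: vge_iff_mem left_diff_distrib P_ring)

lemma vge_add: "vge n z \<Longrightarrow> vge n w \<Longrightarrow> vge n (z + w)"
  by (auto simp: vge_iff_mem distrib_right P_ring)

lemma vge_uminus: "vge n z \<Longrightarrow> vge n (- z)"
  using vge_diff[of n 0 z] by simp

lemma vge_sum: "(\<And>i. i \<in> I \<Longrightarrow> vge n (f i)) \<Longrightarrow> vge n (sum f I)"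
  by (induction I rule: infinite_finite_induct) (auto simp: vge_add)

lemma val_uminus: "val (- z) = val z"
  using vge_uminus[of "val z" z] vge_uminus[of "val (- z)" "- z"]
  by (cases "z = 0") (auto simp: vge_def)

text \<open>The ultrametric equality: if \<open>z + w\<close> had larger valuation than
  \<open>z\<close>, so would \<open>z = (z + w) - w\<close>.\<close>

lemma val_add_less:
  assumes "z \<noteq> 0" "vge (val z + 1) w"
  shows "z + w \<noteq> 0 \<and> val (z + w) = val z"
proof -
  have nz: "z + w \<noteq> 0"
  proof
    assume "z + w = 0"
    then have "w = - z" by (simp add: eq_neg_iff_add_eq_0 add.commute)
    then show False using assms by (auto simp: vge_def val_uminus)
  qed
  have 1: "vge (val z) (z + w)"
    using assms(2) by (intro vge_add) (auto simp: vge_def)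
  have "\<not> vge (val z + 1) (z + w)"
    using vge_diff[of "val z + 1" "z + w" w] assms by (auto simp: vge_def)
  then show ?thesis using 1 nz by (auto simp: vge_def)
qed

lemma vge_subgroup: "add_subgroup {z. vge n z}"
  by (auto simp: add_subgroup_def vge_diff)

end

lemma subring_set_adjoin:
  assumes "subring_set R"
  shows "subring_set ((\<lambda>f. poly f z) ` polys_over R)" (is "subring_set ?S")
    and "R \<subseteq> (\<lambda>f. poly f z) ` polys_over R" and "z \<in> (\<lambda>f. poly f z) ` polys_over R"
proof -
  have "1 \<in> ?S" by (rule image_eqI[of _ _ 1]) (auto simp: polys_over_1[OF assms])
  moreover have "poly f z - poly g z \<in> ?S \<and> poly f z * poly g z \<in> ?S"
    if "f \<in> polys_over R" "g \<in> polys_over R" for f g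
    using polys_over_diff[OF assms that] polys_over_mult[OF assms that]
    by (metis image_eqI poly_diff poly_mult)
  ultimately show "subring_set ?S" by (auto simp: subring_set_def)
  show "R \<subseteq> ?S"
  proof
    fix a assume "a \<in> R"
    then show "a \<in> ?S" by (intro image_eqI[of _ _ "[:a:]"]) (auto simp: polys_over_const[OF assms])
  qed
  show "z \<in> ?S" by (rule image_eqI[of _ _ "[:0, 1:]"]) (auto simp: polys_over_X[OF assms])
qed

text \<open>Clearing the denominator reverses the list of coefficients. This trades relations in
  \<open>inverse z\<close> for relations in \<open>z\<close>.\<close>

lemma reversed_poly:
  fixes g :: "'a::field poly"
  assumes R: "subring_set R" and g: "g \<in> polys_over R" "degree g \<le> N" and z: "z \<noteq> 0"
  shows "\<exists>r\<in>polys_over R. degree r \<le> N \<and> z ^ N * poly g (inverse z) = poly r z"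
proof (intro bexI conjI)
  let ?r = "\<Sum>j\<le>N. monom (coeff g (N - j)) j"
  show "?r \<in> polys_over R"
    using g by (intro polys_over_sum polys_over_monom R) (auto simp: polys_over_def)
  show "degree ?r \<le> N"
    by (intro degree_sum_le) (auto intro: order.trans[OF degree_monom_le])
  have "z ^ N * poly g (inverse z) = (\<Sum>i\<le>N. z ^ N * (coeff g i * inverse z ^ i))"
    unfolding sum_distrib_left[symmetric] poly_altdef using g(2)
    by (intro arg_cong2[of _ _ _ _ "(*)"] sum.mono_neutral_left) (auto simp: coeff_eq_0)
  also have "\<dots> = (\<Sum>i\<le>N. coeff g i * z ^ (N - i))"
    using z by (intro sum.cong) (auto simp: power_diff power_inverse field_simps)
  also have "\<dots> = (\<Sum>j\<le>N. coeff g (N - j) * z ^ j)"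
    by (intro sum.reindex_bij_witness[of _ "\<lambda>j. N - j" "\<lambda>i. N - i"]) auto
  also have "\<dots> = poly ?r z" by (simp add: poly_sum poly_monom)
  finally show "z ^ N * poly g (inverse z) = poly ?r z" .
qed

subsection \<open>Existence of places\<close>

text \<open>Chevalley's argument, with the condition of omitting \<open>inverse w\<close> in the
  role of a proper ideal that must survive. If neither \<open>z\<close> nor \<open>inverse z\<close>
  were in \<open>R\<close>, then \<open>inverse w\<close> would be a polynomial over
  \<open>R\<close> in each of them, and the degrees of two such expressions can be lowered
  forever.\<close>

lemma maximal_subring_is_valuation_ring:
  fixes R :: "'a::field set"
  assumes R: "subring_set R" and w: "w \<in> R" "inverse w \<notin> R"
    and maxi: "\<And>R'. subring_set R' \<Longrightarrow> R \<subseteq> R' \<Longrightarrow> inverse w \<notin> R' \<Longrightarrow> R' = R"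
  shows "z \<in> R \<or> inverse z \<in> R"
proof -
  note RD = subring_setD[OF R]
  have w0: "w \<noteq> 0" using w by auto
  \<comment> \<open>Adjoining an outside element to \<open>R\<close> must break the only condition
    that can fail, so it produces \<open>inverse w\<close>.\<close>
  have adj: "\<exists>f\<in>polys_over R. poly f z = inverse w" if "z \<notin> R" for z
  proof (rule ccontr)
    assume "\<not> ?thesis"
    then have "inverse w \<notin> (\<lambda>f. poly f z) ` polys_over R" by fastforce
    then have "(\<lambda>f. poly f z) ` polys_over R = R"
      using subring_set_adjoin[OF R] by (intro maxi) auto
    then show False using subring_set_adjoin(3)[OF R, of z] that by simp
  qed
  \<comment> \<open>Powers of \<open>1 - w * a\<close> again have the form \<open>1 - w * b\<close>.
    If the inverse were missing from \<open>R\<close>, clearing denominators in its expression for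
    \<open>inverse w\<close> would give \<open>(1 - w * b) / w\<close> in \<open>R\<close>, hence
    \<open>inverse w\<close> in \<open>R\<close>.\<close>
  have unit: "1 - w * a \<noteq> 0 \<and> inverse (1 - w * a) \<in> R" if a: "a \<in> R" for a
  proof
    show nz: "1 - w * a \<noteq> 0"
    proof
      assume "1 - w * a = 0"
      then have "w * a = 1" by simp
      then have "inverse w = a" using inverse_unique by blast
      then show False using a w by simp
    qed
    show "inverse (1 - w * a) \<in> R"
    proof (rule ccontr)
      assume "inverse (1 - w * a) \<notin> R"
      then obtain f where f: "f \<in> polys_over R" "poly f (inverse (1 - w * a)) = inverse w"
        using adj by blast
      obtain r where r: "r \<in> polys_over R"
        "(1 - w * a) ^ degree f * poly f (inverse (1 - w * a)) = poly r (1 - w * a)"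
        using reversed_poly[OF R f(1) order.refl nz] by blast
      have 1: "(1 - w * a) ^ n \<in> (\<lambda>b. 1 - w * b) ` R" for n
      proof (induction n)
        case 0
        then show ?case using RD by (intro image_eqI[of _ _ 0]) auto
      next
        case (Suc n)
        then obtain b where b: "b \<in> R" "(1 - w * a) ^ n = 1 - w * b" by auto
        have "(1 - w * a) ^ Suc n = 1 - w * (a + b - w * a * b)"
          unfolding power_Suc b(2) by (simp add: algebra_simps)
        then show ?case using a b w RD by (intro image_eqI[of _ _ "a + b - w * a * b"]) auto
      qed
      obtain b where b: "b \<in> R" "(1 - w * a) ^ degree f = 1 - w * b" using 1 by fast
      have "poly r (1 - w * a) \<in> R" using a w RD by (intro poly_mem_subring R r) auto
      then have "(1 - w * b) * inverse w \<in> R" using r(2) f(2) b(2) by simp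
      then have "inverse w - b \<in> R" using w0 by (simp add: field_simps)
      then have "inverse w - b + b \<in> R" using b RD by blast
      then show False using w by simp
    qed
  qed
  define D where "D = (\<lambda>z n. \<exists>f\<in>polys_over R. degree f \<le> n \<and> poly f z = inverse w)"
  have D0: "\<not> D z 0" for z
  proof
    assume "D z 0"
    then obtain f where "f \<in> polys_over R" "degree f = 0" "poly f z = inverse w" by (auto simp: D_def)
    moreover from this have "coeff f 0 = inverse w" by (simp add: poly_altdef)
    ultimately have "inverse w \<in> R" by (metis (mono_tags) mem_Collect_eq polys_over_def)
    then show False using w by simp
  qed
  \<comment> \<open>The constant term \<open>b\<close> of the relation in \<open>inverse z\<close>
    is absorbed by the unit \<open>1 - w * b\<close>, leaving an expression of 1 by negative powers
    of \<open>z\<close> only. Multiplied by the top term of the relation in \<open>z\<close>, it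
    rewrites that term in lower degree.\<close>
  have step: "D z n" if n: "D z (Suc n)" and m: "D (inverse z) m" "m \<le> Suc n" and z: "z \<noteq> 0" for z n m
  proof -
    obtain f where f: "f \<in> polys_over R" "degree f \<le> Suc n" "poly f z = inverse w"
      using n by (auto simp: D_def)
    obtain g where g: "g \<in> polys_over R" "degree g \<le> m" "poly g (inverse z) = inverse w"
      using m by (auto simp: D_def)
    obtain b g' where gg: "g = pCons b g'" by (cases g) auto
    have b: "b \<in> R" and g': "g' \<in> polys_over R"
      using g(1) unfolding polys_over_def gg by (auto simp: coeff_pCons split: nat.splits) 
    have dg': "degree g' \<le> n" using g(2) m(2) by (auto simp: gg split: if_splits)
    define s where "s = inverse (1 - w * b)"
    have s: "s \<in> R" "1 - w * b \<noteq> 0" using unit[OF b] by (auto simp: s_def)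
    have one: "1 = w * s * inverse z * poly g' (inverse z)"
    proof -
      have "b + inverse z * poly g' (inverse z) = inverse w" using g(3) by (simp add: gg)
      then have "w * (b + inverse z * poly g' (inverse z)) = 1" using w0 by simp
      then have "1 - w * b = w * (inverse z * poly g' (inverse z))" by (simp add: algebra_simps)
      then have "s * (1 - w * b) = s * (w * (inverse z * poly g' (inverse z)))" by simp
      moreover have "s * (1 - w * b) = 1" using s(2) by (simp add: s_def)
      ultimately show ?thesis by (simp only: mult_ac)
    qed
    obtain r where r: "r \<in> polys_over R" "degree r \<le> n" "z ^ n * poly g' (inverse z) = poly r z"
      using reversed_poly[OF R g' dg' z] by blast
    define a where "a = coeff f (Suc n)"
    define f0 where "f0 = f - monom a (Suc n)"
    have aR: "a \<in> R" using f by (auto simp: a_def polys_over_def)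
    have f0: "f0 \<in> polys_over R" unfolding f0_def
      using f aR by (intro polys_over_diff polys_over_monom R)
    have df0: "degree f0 \<le> n"
    proof (rule degree_le, intro allI impI)
      fix i assume "n < i"
      then show "coeff f0 i = 0" using f(2)
        by (cases "i = Suc n") (auto simp: f0_def a_def coeff_eq_0)
    qed
    have "a * z ^ Suc n = a * z ^ Suc n * (w * s * inverse z * poly g' (inverse z))"
      using one by simp
    also have "\<dots> = (a * w * s) * (z ^ n * poly g' (inverse z))" using z by (simp add: field_simps)
    also have "\<dots> = poly (smult (a * w * s) r) z" using r by simp
    finally have top: "a * z ^ Suc n = poly (smult (a * w * s) r) z" .
    have "poly (f0 + smult (a * w * s) r) z = inverse w"
      unfolding poly_add f0_def poly_diff poly_monom top using f(3) by simp
    moreover have "f0 + smult (a * w * s) r \<in> polys_over R"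
      using f0 r(1) aR w s RD
      by (intro polys_over_add R) (auto simp: polys_over_def)
    moreover have "degree (f0 + smult (a * w * s) r) \<le> n"
      using df0 r(2) by (intro degree_add_le) (auto intro: order.trans[OF degree_smult_le])
    ultimately show ?thesis unfolding D_def by blast
  qed
  \<comment> \<open>Infinite descent on \<open>n + m\<close>: the larger of the two degrees can
    always be lowered, and degree 0 is impossible since \<open>inverse w\<close> is not in
    \<open>R\<close>.\<close>
  have no: "\<not> D z n \<or> \<not> D (inverse z) m" if "z \<noteq> 0" for z n m
    using that
  proof (induction "n + m" arbitrary: z n m rule: less_induct)
    case less
    show ?case
    proof (rule ccontr)
      assume "\<not> ?thesis"
      then have D: "D z n" "D (inverse z) m" by auto
      have pos: "n > 0" "m > 0" using D D0 by (auto intro!: Nat.gr0I)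
      show False
      proof (cases "m \<le> n")
        case True
        then have "D z (n - 1)" using step[of z "n - 1" m] D pos less.prems by simp
        then show False using less.hyps[of "n - 1" m z] D pos less.prems by simp
      next
        case False
        then have "D (inverse z) (m - 1)" using step[of "inverse z" "m - 1" n] D pos less.prems by simp
        then show False using less.hyps[of n "m - 1" z] D pos less.prems by simp
      qed
    qed
  qed
  show ?thesis
  proof (rule ccontr)
    assume "\<not> ?thesis"
    then have z: "z \<notin> R" "inverse z \<notin> R" by auto
    then have "z \<noteq> 0" using RD by auto
    then show False using no adj[OF z(1)] adj[OF z(2)] unfolding D_def by blast
  qed
qed

context function_field
begin

text \<open>Multiplication by \<open>y\<close> preserves the finite set of values at
  \<open>y\<close> of polynomials of degree at most \<open>d\<close>, so the powers of
  \<open>y\<close> repeat and \<open>root_in_k\<close> applies.\<close>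

lemma integral_over_k:
  assumes r: "r \<in> kpoly" "degree r \<le> d" and y: "y ^ Suc d = poly r y"
  shows "y \<in> k"
proof -
  let ?V = "(\<lambda>g. poly g y) ` kpoly_le d"
  have mult: "y * v \<in> ?V" if "v \<in> ?V" for v
  proof -
    obtain g where g: "g \<in> kpoly" "degree g \<le> d" "v = poly g y"
      using \<open>v \<in> ?V\<close> by (auto simp: kpoly_le_def)
    define c where "c = coeff g d"
    define g0 where "g0 = pCons 0 g - monom c (Suc d)"
    have c: "c \<in> k" using g by (simp add: c_def polys_over_def)
    have "pCons 0 g \<in> kpoly" using g k_0 by (auto simp: polys_over_def coeff_pCons split: nat.splits)
    then have g0: "g0 \<in> kpoly" unfolding g0_def
      using c by (intro polys_over_diff polys_over_monom k_subring)
    have dg0: "degree g0 \<le> d"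
    proof (rule degree_le, intro allI impI)
      fix i assume "d < i"
      then show "coeff g0 i = 0" using g(2)
        by (cases "i = Suc d") (auto simp: g0_def c_def coeff_pCons coeff_eq_0 split: nat.splits)
    qed
    have "y * v = poly g0 y + c * y ^ Suc d" by (simp add: g0_def g(3) poly_monom)
    also have "\<dots> = poly (g0 + smult c r) y" by (simp add: y del: power_Suc)
    finally show ?thesis using g0 dg0 r c
      by (intro image_eqI[of _ _ "g0 + smult c r"])
         (auto simp: kpoly_le_def intro!: degree_add_le kpoly_add order.trans[OF degree_smult_le],
          auto simp: polys_over_def k_mult)
  qed
  have "y ^ n \<in> ?V" for n
  proof (induction n)
    case 0
    then show ?case by (rule image_eqI[of _ _ 1]) (auto simp: kpoly_le_def kpoly_1)
  qed (use mult in auto)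
  then have "range (\<lambda>n. y ^ n) \<subseteq> ?V" by auto
  moreover have "finite ?V" using card_kpoly_le by blast
  ultimately have "\<not> inj (\<lambda>n::nat. y ^ n)"
    using finite_subset finite_imageD infinite_UNIV_nat by blast
  then obtain m l where "m \<noteq> l" "y ^ m = y ^ l" unfolding inj_def by blast
  then show ?thesis using root_in_k[of m l y] root_in_k[of l m y] by (cases "m < l") auto
qed

text \<open>An expression of \<open>y\<close> as a polynomial in \<open>inverse y\<close> would make
  \<open>y\<close> integral over \<open>k\<close>. This provides the first ring in the application
  of Zorn's lemma.\<close>

lemma inverse_notin_adjoin:
  assumes y: "y \<notin> k"
  shows "y \<notin> (\<lambda>f. poly f (inverse y)) ` kpoly"
proof
  assume "y \<in> (\<lambda>f. poly f (inverse y)) ` kpoly"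
  then obtain f where f: "f \<in> kpoly" "poly f (inverse y) = y" by auto
  have y0: "y \<noteq> 0" using y k_0 by auto
  obtain r where r: "r \<in> kpoly" "degree r \<le> degree f" "y ^ degree f * poly f (inverse y) = poly r y"
    using reversed_poly[OF k_subring f(1) order.refl y0] by blast
  then have "y ^ Suc (degree f) = poly r y" using f by (simp add: mult.commute)
  then show False using integral_over_k r y by blast
qed

text \<open>In a chain \<open>c\<^sub>0, \<dots>, c\<^sub>n\<close> of non-units with each term in the maximal ideal times the next, the
  terms are distinct modulo \<open>c\<^sub>0 M\<close>; this bounds \<open>n\<close> and makes the valuation discrete.\<close>

lemma valuation_ring_is_dvr:
  assumes R: "subring_set R" and kR: "k \<subseteq> R"
    and val: "\<And>z. z \<in> R \<or> inverse z \<in> R"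
    and w: "w \<in> R" "inverse w \<notin> R"
  shows "\<exists>t. dvr R t"
proof -
  note RD = subring_setD[OF R]
  define M where "M = {a \<in> R. a = 0 \<or> inverse a \<notin> R}"
  have w0: "w \<noteq> 0" using w by auto
  have wM: "w \<in> M" using w by (simp add: M_def)
  have M_R: "a \<in> M \<Longrightarrow> a \<in> R" for a by (simp add: M_def)
  have M_mult: "a * b \<in> M" if "a \<in> M" "b \<in> R" for a b
  proof (cases "a * b = 0")
    case False
    have "inverse (a * b) \<notin> R"
    proof
      assume "inverse (a * b) \<in> R"
      then have "inverse (a * b) * b \<in> R" using RD that by blast
      then show False using that False by (auto simp: M_def field_simps)
    qed
    then show ?thesis using that RD by (auto simp: M_def)
  qed (auto simp: M_def RD)
  have M_1: "1 \<notin> M" by (simp add: M_def RD)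
  have M_diff: "a - b \<in> M" if "a \<in> M" "b \<in> M" for a b
  proof (cases "a = 0 \<or> b = 0")
    case True
    have "- b \<in> M" using M_mult[OF that(2), of "- 1"] RD by simp
    then show ?thesis using True that by auto
  next
    case False
    from val[of "a / b"] show ?thesis
    proof
      assume "a / b \<in> R"
      then have "b * (a / b - 1) \<in> M" using that RD by (intro M_mult) auto
      then show ?thesis using False by (simp add: right_diff_distrib)
    next
      assume "inverse (a / b) \<in> R"
      then have "a * (1 - b / a) \<in> M" using that RD by (intro M_mult) auto
      then show ?thesis using False by (simp add: right_diff_distrib)
    qed
  qed
  have M_grp: "add_subgroup M" using M_diff by (auto simp: add_subgroup_def M_def RD)
  define chain where "chain c n \<longleftrightarrow> c 0 \<noteq> 0 \<and> (\<forall>i\<le>n. c i \<in> M) \<and> (\<forall>i<n. c (Suc i) \<noteq> 0 \<and> c i / c (Suc i) \<in> M)"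
    for c and n :: nat
  \<comment> \<open>Digits are taken from the chain itself, with the maximal ideal \<open>M\<close>
    as the group \<open>H\<close>; \<open>digit_free_bounded\<close> then limits the length in terms
    of the head \<open>z\<close> alone.\<close>
  have bounded: "\<exists>E. \<forall>c n. chain c n \<and> c 0 = z \<longrightarrow> n \<le> E" for z
  proof -
    obtain E where E: "\<And>U. finite U \<Longrightarrow> digit_free z U \<Longrightarrow> card U \<le> E"
      using digit_free_bounded by blast
    have "n \<le> E" if c: "chain c n" "c 0 = z" for c n
    proof -
      have nz: "c i \<noteq> 0" if "i \<le> n" for i
        using c(1) that by (cases i) (auto simp: chain_def)
      have quot: "c i / c (i + Suc j) \<in> M" if "i + Suc j \<le> n" for i j
        using that
      proof (induction j)
        case 0
        then show ?case using c(1) by (simp add: chain_def)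
      next
        case (Suc j)
        have "c i / c (i + Suc j) * (c (i + Suc j) / c (Suc (i + Suc j))) \<in> M"
          using Suc c(1) M_R by (intro M_mult) (auto simp: chain_def)
        then show ?case using nz[of "i + Suc j"] Suc.prems by simp
      qed
      have quot': "c i / c j \<in> M" if "i < j" "j \<le> n" for i j
        using quot[of i "j - i - 1"] that by simp
      have key: "c i - c j \<notin> (*) z ` M" if "i < j" "j \<le> n" for i j
      proof
        assume "c i - c j \<in> (*) z ` M"
        then obtain a where a: "a \<in> M" "c i - c j = c 0 * a" using c(2) by auto
        then have "c i / c j - 1 = (c 0 / c j) * a"
          using nz[OF that(2)] by (simp add: field_simps)
        then have "1 = c i / c j - (c 0 / c j) * a" unfolding diff_eq_eq by (simp only: add_diff_cancel_left')
        also have "\<dots> \<in> M" using that a quot'[of i j] quot'[of 0 j] M_R by (intro M_diff M_mult) auto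
        finally show False using M_1 by simp
      qed
      have inj: "i = j" if ij: "i \<le> n" "j \<le> n" "c i - c j \<in> (*) z ` M" for i j
      proof (rule ccontr)
        assume "i \<noteq> j"
        moreover have "c j - c i \<in> (*) z ` M"
        proof -
          obtain a where "a \<in> M" "c i - c j = z * a" using ij by auto
          then show ?thesis using add_subgroupD(3)[OF M_grp]
            by (intro image_eqI[of _ _ "- a"]) (auto simp: algebra_simps)
        qed
        ultimately show False using key[of i j] key[of j i] that by (cases "i < j") auto
      qed
      have "digit_free z (c ` {..n})"
      proof (rule digit_freeI[OF M_grp])
        show "z * y \<in> M" if "y \<in> M" for y
          using that c M_R M_mult[of y z] by (auto simp: chain_def mult.commute)
        show "c ` {..n} \<subseteq> M" using c by (auto simp: chain_def)
        show "z \<noteq> 0" using c by (auto simp: chain_def)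
        show "u = v" if "u \<in> c ` {..n}" "v \<in> c ` {..n}" "u - v \<in> (*) z ` M" for u v
          using that inj by auto
      qed
      moreover have "inj_on c {..n}"
        using inj add_subgroupD(1)[OF M_grp] by (intro inj_onI) (metis atMost_iff diff_self image_eqI mult_zero_right)
      ultimately show ?thesis using E[of "c ` {..n}"] by (simp add: card_image)
    qed
    then show ?thesis by blast
  qed
  obtain E where E: "\<And>c n. chain c n \<Longrightarrow> c 0 = w \<Longrightarrow> n \<le> E" using bounded by blast
  \<comment> \<open>A longest chain from \<open>w\<close> ends in a uniformizer \<open>t\<close>: an
    \<open>a\<close> in \<open>M\<close> with \<open>a / t\<close> outside \<open>R\<close> could be
    appended.\<close>
  define n where "n = (GREATEST n. \<exists>c. chain c n \<and> c 0 = w)"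
  have ex0: "\<exists>c. chain c 0 \<and> c 0 = w"
    using wM w0 by (intro exI[of _ "\<lambda>_. w"]) (auto simp: chain_def)
  have "\<exists>c. chain c n \<and> c 0 = w"
    unfolding n_def by (rule GreatestI_nat[where P = "\<lambda>n. \<exists>c. chain c n \<and> c 0 = w" and b = E and k = 0]) (use E ex0 in auto)
  then obtain c where c: "chain c n" "c 0 = w" by blast
  have nmax: "m \<le> n" if "chain c' m" "c' 0 = w" for c' m
    unfolding n_def by (rule Greatest_le_nat[where b = E]) (use E that in auto)
  define t where "t = c n"
  have t: "t \<in> M" "t \<noteq> 0" using c(1) by (cases n; auto simp: chain_def t_def)+
  have M_t: "a / t \<in> R" if a: "a \<in> M" for a
  proof (rule ccontr)
    assume "a / t \<notin> R"
    then have "inverse (a / t) \<in> R" and a0: "a \<noteq> 0" using val[of "a / t"] RD by auto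
    then have "t / a \<in> M" using \<open>a / t \<notin> R\<close> by (simp add: M_def)
    then have "chain (c(Suc n := a)) (Suc n)"
      using c a a0 by (auto simp: chain_def t_def less_Suc_eq)
    then show False using nmax[of "c(Suc n := a)" "Suc n"] c(2) by simp
  qed
  \<comment> \<open>If no power of \<open>t\<close> turned \<open>z\<close> into a unit, every
    \<open>z / t ^ n\<close> would lie in \<open>M\<close>, and \<open>z\<close> would head
    arbitrarily long chains.\<close>
  have dec: "\<exists>n. z / t ^ n \<in> R \<and> inverse (z / t ^ n) \<in> R" if z: "z \<in> R" "z \<noteq> 0" for z
  proof (rule ccontr)
    assume no: "\<not> ?thesis"
    have all: "z / t ^ n \<in> R" for n
    proof (induction n)
      case (Suc n)
      then have "z / t ^ n \<in> M" using no by (auto simp: M_def)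
      from M_t[OF this] show ?case by (simp add: mult.commute)
    qed (use z in simp)
    have allM: "z / t ^ n \<in> M" for n
      using M_mult[OF t(1) all[of "Suc n"]] t(2) by simp
    have tM: "t ^ Suc i \<in> M" for i using M_mult[OF t(1), of "t ^ i"] RD M_R[OF t(1)] by simp
    obtain E where E: "\<And>c n. chain c n \<Longrightarrow> c 0 = z \<Longrightarrow> n \<le> E" using bounded by blast
    \<comment> \<open>The chain \<open>z, t ^ (E + 1), ..., t\<close> has length
      \<open>E + 1\<close>, one more than allowed; its first quotient is
      \<open>z / t ^ (E + 1)\<close>.\<close>
    define c where "c i = (if i = 0 then z else t ^ (Suc (Suc E) - i))" for i
    have "chain c (Suc E)"
      unfolding chain_def
    proof (intro conjI allI impI)
      show "c 0 \<noteq> 0" using z by (simp add: c_def)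
      show "c i \<in> M" if "i \<le> Suc E" for i
        using allM[of 0] tM[of "Suc E - i"] that by (auto simp: c_def Suc_diff_le)
      show "c (Suc i) \<noteq> 0" for i using t by (simp add: c_def)
      show "c i / c (Suc i) \<in> M" if "i < Suc E" for i
      proof (cases "i = 0")
        case True
        then show ?thesis using allM[of "Suc E"] by (simp add: c_def)
      next
        case False
        then have "Suc (Suc E) - i = Suc (Suc E - i)" using that by simp
        then show ?thesis using False t by (simp add: c_def)
      qed
    qed
    then show False using E[of c "Suc E"] by (simp add: c_def)
  qed
  have "dvr R t"
  proof
    show "subring_set R" by (rule R)
    show "t \<in> R" "t \<noteq> 0" "inverse t \<notin> R" using t by (auto simp: M_def)
    fix z :: 'a assume z: "z \<noteq> 0"
    show "\<exists>n::int. \<exists>u. u \<in> R \<and> u \<noteq> 0 \<and> inverse u \<in> R \<and> z = t powi n * u"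
    proof (cases "z \<in> R")
      case True
      then obtain n where n: "z / t ^ n \<in> R" "inverse (z / t ^ n) \<in> R" using dec z by blast
      then show ?thesis using z t by (intro exI[of _ "int n"] exI[of _ "z / t ^ n"]) auto
    next
      case False
      then have "inverse z \<in> R" using val by blast
      then obtain n where n: "inverse z / t ^ n \<in> R" "inverse (inverse z / t ^ n) \<in> R"
        using dec z by (metis inverse_zero_imp_zero)
      then show ?thesis using z t
        by (intro exI[of _ "- int n"] exI[of _ "inverse (inverse z / t ^ n)"])
           (auto simp: power_int_minus field_simps)
    qed
  qed
  then show ?thesis by blast
qed

text \<open>Zorn's lemma for the subrings that contain \<open>k\<close> and \<open>inverse y\<close>
  but omit \<open>y\<close>. A maximal one is a valuation ring in which \<open>inverse y\<close> is
  a non-unit.\<close>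

lemma ex_place_with_pole:
  assumes y: "y \<notin> k"
  shows "\<exists>P t. dvr P t \<and> k \<subseteq> P \<and> y \<notin> P"
proof -
  define w where "w = inverse y"
  define A where "A = {R. subring_set R \<and> k \<subseteq> R \<and> w \<in> R \<and> y \<notin> R}"
  have "(\<lambda>f. poly f w) ` kpoly \<in> A"
    using subring_set_adjoin[OF k_subring, of w] inverse_notin_adjoin[OF y] by (auto simp: w_def A_def)
  then have ne: "A \<noteq> {}" by blast
  have "\<exists>R\<in>A. \<forall>R'\<in>A. R \<subseteq> R' \<longrightarrow> R' = R"
  proof (rule subset_Zorn_nonempty[OF ne])
    fix C assume C: "C \<noteq> {}" "subset.chain A C"
    have CA: "\<And>R. R \<in> C \<Longrightarrow> R \<in> A" using C(2) by (auto simp: subset_chain_def)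
    have "a - b \<in> \<Union>C \<and> a * b \<in> \<Union>C" if ab: "a \<in> \<Union>C" "b \<in> \<Union>C" for a b
    proof -
      obtain R R' where R: "R \<in> C" "a \<in> R" "R' \<in> C" "b \<in> R'" using ab by blast
      then have "R \<subseteq> R' \<or> R' \<subseteq> R" using C(2) by (auto simp: subset_chain_def)
      then obtain R'' where "R'' \<in> C" "a \<in> R''" "b \<in> R''" using R by blast
      then show ?thesis using CA[of R''] subring_setD(4,5)[of R'' a b] unfolding A_def by blast
    qed
    moreover have "1 \<in> \<Union>C" using C(1) CA by (auto simp: subring_set_def A_def)
    moreover have "k \<subseteq> \<Union>C"
    proof -
      obtain R where "R \<in> C" using C(1) by blast
      then show ?thesis using CA[of R] by (auto simp: A_def)
    qed
    ultimately show "\<Union>C \<in> A" using C(1) CA by (auto simp: subring_set_def A_def)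
  qed
  then obtain R where R: "R \<in> A" "\<And>R'. R' \<in> A \<Longrightarrow> R \<subseteq> R' \<Longrightarrow> R' = R" by blast
  have wy: "inverse w = y" by (simp add: w_def)
  have "z \<in> R \<or> inverse z \<in> R" for z
    by (rule maximal_subring_is_valuation_ring[of R w]) (use R wy in \<open>auto simp: A_def\<close>)
  then have "\<exists>t. dvr R t"
    using R(1) wy by (intro valuation_ring_is_dvr[of R w]) (auto simp: A_def)
  then show ?thesis using R(1) unfolding A_def by blast
qed

end

section \<open>Complements of spaces over the constant field\<close>

context finite_subfield
begin

definition ksub :: "'a set \<Rightarrow> bool"
  where "ksub V \<longleftrightarrow> add_subgroup V \<and> (\<forall>c\<in>k. \<forall>v\<in>V. c * v \<in> V)"

text \<open>Choose \<open>U\<close> of largest possible size: a \<open>v\<close> outside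
  \<open>U + Y\<close> would allow the larger space spanned by \<open>U\<close> and
  \<open>v\<close>. The bound \<open>B\<close> makes the choice possible although \<open>V\<close>
  and \<open>Y\<close> may be infinite.\<close>

lemma ksub_complement:
  assumes V: "ksub V" and Y: "ksub Y"
    and bound: "\<And>U. ksub U \<Longrightarrow> finite U \<Longrightarrow> U \<subseteq> V \<Longrightarrow> U \<inter> Y = {0} \<Longrightarrow> card U \<le> B"
  shows "\<exists>U n. ksub U \<and> finite U \<and> U \<subseteq> V \<and> U \<inter> Y = {0} \<and> card U = card k ^ n \<and> (\<forall>v\<in>V. \<exists>u\<in>U. v - u \<in> Y)"
proof -
  define G where "G n \<longleftrightarrow> (\<exists>U. ksub U \<and> finite U \<and> U \<subseteq> V \<and> U \<inter> Y = {0} \<and> card U = card k ^ n)" for n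
  have grp: "add_subgroup V" "add_subgroup Y" using V Y by (auto simp: ksub_def)
  have G0: "G 0"
    unfolding G_def by (rule exI[of _ "{0}"]) (auto simp: ksub_def add_subgroup_def grp[THEN add_subgroupD(1)])
  have Gb: "n \<le> B" if "G n" for n
  proof -
    have "n < card k ^ n" using card_k_ge_2 by (intro power_gt_expt) auto
    then show ?thesis using that bound unfolding G_def by fastforce
  qed
  define n where "n = (GREATEST n. G n)"
  have n: "G n" unfolding n_def using GreatestI_nat[of G 0 B] G0 Gb by blast
  have nmax: "m \<le> n" if "G m" for m unfolding n_def using Greatest_le_nat[of G m B] that Gb by blast
  obtain U where U: "ksub U" "finite U" "U \<subseteq> V" "U \<inter> Y = {0}" "card U = card k ^ n"
    using n unfolding G_def by blast
  note UD = add_subgroupD[of U] and VD = add_subgroupD[OF grp(1)] and YD = add_subgroupD[OF grp(2)]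
  have Ug: "add_subgroup U" using U by (simp add: ksub_def)
  have "\<exists>u\<in>U. v - u \<in> Y" if v: "v \<in> V" for v
  proof (rule ccontr)
    assume no: "\<not> ?thesis"
    define f where "f = (\<lambda>(u, c). u + c * v)"
    \<comment> \<open>Scaling by \<open>inverse c\<close> would place \<open>v\<close> in
      \<open>U + Y\<close>. This one fact shows both that the sum of \<open>U\<close> and the line
      of \<open>v\<close> is direct and that it meets \<open>Y\<close> only in 0.\<close>
    have cz: "c = 0" if "c \<in> k" "u \<in> U" "u + c * v \<in> Y" for c u
    proof (rule ccontr)
      assume c: "c \<noteq> 0"
      have "inverse c * (u + c * v) \<in> Y" using that Y k_inverse by (auto simp: ksub_def)
      moreover have "inverse c * (u + c * v) = v - (- (inverse c * u))" using c by (simp add: algebra_simps)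
      moreover have "- (inverse c * u) \<in> U" using that U(1) k_inverse UD(3)[OF Ug] by (auto simp: ksub_def)
      ultimately show False using no by metis
    qed
    have inj: "inj_on f (U \<times> k)"
    proof (rule inj_onI, clarsimp simp: f_def)
      fix u c u' c' assume *: "u \<in> U" "c \<in> k" "u' \<in> U" "c' \<in> k" "u + c * v = u' + c' * v"
      have "(u - u') + (c - c') * v \<in> Y" using * YD(1) by (simp add: algebra_simps)
      then have "c - c' = 0" using * k_diff UD(2)[OF Ug] by (intro cz[of "c - c'" "u - u'"]) auto
      then show "u = u' \<and> c = c'" using * by simp
    qed
    have fG: "add_subgroup (f ` (U \<times> k))"
      unfolding add_subgroup_def
    proof (intro conjI ballI)
      show "0 \<in> f ` (U \<times> k)" using UD(1)[OF Ug] k_0 by (intro image_eqI[of _ _ "(0, 0)"]) (auto simp: f_def)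
      fix a b assume "a \<in> f ` (U \<times> k)" "b \<in> f ` (U \<times> k)"
      then obtain u c u' c' where *: "u \<in> U" "c \<in> k" "u' \<in> U" "c' \<in> k" "a = f (u, c)" "b = f (u', c')" by blast
      then show "a - b \<in> f ` (U \<times> k)" using UD(2)[OF Ug] k_diff
        by (intro image_eqI[of _ _ "(u - u', c - c')"]) (auto simp: f_def algebra_simps)
    qed
    have "ksub (f ` (U \<times> k))"
      unfolding ksub_def
    proof (intro conjI fG ballI)
      fix d a assume d: "d \<in> k" and "a \<in> f ` (U \<times> k)"
      then obtain u c where *: "u \<in> U" "c \<in> k" "a = f (u, c)" by blast
      then show "d * a \<in> f ` (U \<times> k)" using d U(1) k_mult
        by (intro image_eqI[of _ _ "(d * u, d * c)"]) (auto simp: f_def algebra_simps ksub_def)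
    qed
    moreover have "f ` (U \<times> k) \<subseteq> V"
      using U(3) v V VD(4) by (auto simp: f_def ksub_def subset_iff)
    moreover have "f ` (U \<times> k) \<inter> Y = {0}"
    proof -
      have "a = 0" if "a \<in> f ` (U \<times> k)" "a \<in> Y" for a
      proof -
        obtain u c where *: "u \<in> U" "c \<in> k" "a = u + c * v" using \<open>a \<in> f ` (U \<times> k)\<close> by (auto simp: f_def)
        then have "c = 0" using cz \<open>a \<in> Y\<close> by blast
        then show ?thesis using * \<open>a \<in> Y\<close> U(4) by auto
      qed
      then show ?thesis using add_subgroupD(1)[OF fG] YD(1) by blast
    qed
    moreover have "card (f ` (U \<times> k)) = card k ^ Suc n"
      using inj U by (simp add: card_image card_cartesian_product)
    ultimately have "G (Suc n)" unfolding G_def using U(2) finite_k by blast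
    then show False using nmax by force
  qed
  then show ?thesis using U by blast
qed

text \<open>The complement of the zero space in \<open>V\<close> is \<open>V\<close> itself.\<close>

lemma card_ksub:
  assumes "ksub V" "finite V"
  shows "\<exists>n. card V = card k ^ n"
proof -
  have "ksub {0}" by (auto simp: ksub_def add_subgroup_def)
  then have "\<exists>U n. ksub U \<and> finite U \<and> U \<subseteq> V \<and> U \<inter> {0} = {0} \<and> card U = card k ^ n \<and> (\<forall>v\<in>V. \<exists>u\<in>U. v - u \<in> {0})"
    by (rule ksub_complement[OF assms(1)]) (rule card_mono[OF assms(2)])
  then obtain U n where "U \<subseteq> V" "card U = card k ^ n" "\<forall>v\<in>V. \<exists>u\<in>U. v - u \<in> {0}"
    by (elim exE conjE)
  then show ?thesis by (metis right_minus_eq singletonD subset_antisym subset_iff)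
qed

end

context function_field
begin

subsection \<open>Places and residue fields\<close>

definition places :: "'a set set" where "places = {P. k \<subseteq> P \<and> (\<exists>t. dvr P t)}"
definition unif :: "'a set \<Rightarrow> 'a" where "unif P = (SOME t. dvr P t)"
abbreviation v :: "'a set \<Rightarrow> 'a \<Rightarrow> int" where "v P \<equiv> dvr.val P (unif P)"
abbreviation vge :: "'a set \<Rightarrow> int \<Rightarrow> 'a \<Rightarrow> bool" where "vge P \<equiv> dvr.vge P (unif P)"

lemma dvr_place: "P \<in> places \<Longrightarrow> dvr P (unif P)"
  unfolding places_def unif_def by (auto intro: someI)

lemmas v_mult = dvr.val_mult[OF dvr_place]
lemmas v_inverse = dvr.val_inverse[OF dvr_place]
lemmas v_divide = dvr.val_divide[OF dvr_place]
lemmas v_power = dvr.val_power[OF dvr_place]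
lemmas v_add_less = dvr.val_add_less[OF dvr_place]
lemmas vge_def' = dvr.vge_def[OF dvr_place]
lemmas vge_0 = dvr.vge_0[OF dvr_place]
lemmas vge_add = dvr.vge_add[OF dvr_place]
lemmas vge_diff = dvr.vge_diff[OF dvr_place]
lemmas vge_mult = dvr.vge_mult[OF dvr_place]
lemmas vge_sum = dvr.vge_sum[OF dvr_place]
lemmas vge_mono = dvr.vge_mono[OF dvr_place]
lemmas vge_uminus = dvr.vge_uminus[OF dvr_place]
lemmas place_mem_iff = dvr.mem_iff_vge[OF dvr_place]
lemmas place_ring = dvr.P_ring[OF dvr_place]
lemmas v_unif = dvr.val_t[OF dvr_place]
lemmas unif_nz = dvr.t_nz[OF dvr_place]

lemma k_in_place: "P \<in> places \<Longrightarrow> c \<in> k \<Longrightarrow> c \<in> P"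
  by (auto simp: places_def)

lemma v_const:
  assumes "P \<in> places" "c \<in> k" "c \<noteq> 0"
  shows "v P c = 0"
proof -
  have "c \<in> P" "inverse c \<in> P" using assms k_in_place k_inverse by auto
  then have "v P c \<ge> 0" "v P (inverse c) \<ge> 0"
    using assms by (auto simp: place_mem_iff vge_def')
  then show ?thesis using v_inverse[OF assms(1,3)] by simp
qed

lemma vge_const_mult: "P \<in> places \<Longrightarrow> c \<in> k \<Longrightarrow> vge P n z \<Longrightarrow> vge P n (c * z)"
  using vge_mult[of P 0 c n z] place_mem_iff k_in_place by auto

lemma ex_pole: "y \<notin> k \<Longrightarrow> \<exists>P\<in>places. y \<notin> P"
  using ex_place_with_pole[of y] by (auto simp: places_def)

text \<open>A discrete valuation ring is a maximal proper subring: if \<open>y\<close> in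
  \<open>Q\<close> has a pole at \<open>P\<close>, any element divided by a high power of
  \<open>y\<close> lies in \<open>P\<close>, so \<open>Q\<close> would be the whole field.\<close>

lemma place_subset_eq:
  assumes PQ: "P \<in> places" "Q \<in> places" "P \<subseteq> Q"
  shows "P = Q"
proof (rule ccontr)
  assume "P \<noteq> Q"
  then obtain y where y: "y \<in> Q" "y \<notin> P" using PQ by blast
  then have y0: "y \<noteq> 0" using place_ring(2)[OF PQ(1)] by auto
  have vy: "v P y < 0" using y y0 by (auto simp: place_mem_iff[OF PQ(1)] vge_def'[OF PQ(1)])
  have "z \<in> Q" for z
  proof (cases "z = 0")
    case False
    define n where "n = nat \<bar>v P z\<bar>"
    have "v P (z / y ^ n) = v P z - int n * v P y"
      using False y0 PQ(1) by (simp add: v_divide v_power)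
    also have "\<dots> \<ge> 0"
    proof -
      have "int n * 1 \<le> int n * (- v P y)" using vy by (intro mult_left_mono) auto
      then show ?thesis by (simp add: n_def)
    qed
    finally have "z / y ^ n \<in> P" using False y0 by (simp add: place_mem_iff[OF PQ(1)] vge_def'[OF PQ(1)])
    then have "z / y ^ n * y ^ n \<in> Q" using y PQ(3) by (intro place_ring(5,8)[OF PQ(2)]) auto
    then show ?thesis using y0 by simp
  qed (use place_ring(2)[OF PQ(2)] in auto)
  then show False using dvr.t_inv[OF dvr_place[OF PQ(2)]] by blast
qed

text \<open>\<open>U\<close> is a linear system of representatives for the residue field, so the
  exponent \<open>n\<close> is the degree of \<open>P\<close>.\<close>

definition is_reps :: "'a set \<Rightarrow> 'a set \<Rightarrow> nat \<Rightarrow> bool"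
  where "is_reps P U n \<longleftrightarrow> ksub U \<and> finite U \<and> U \<subseteq> P \<and> (\<forall>u\<in>U. vge P 1 u \<longrightarrow> u = 0) \<and>
    card U = card k ^ n \<and> (\<forall>y\<in>P. \<exists>u\<in>U. vge P 1 (y - u))"

text \<open>A subspace of \<open>P\<close> meeting the maximal ideal trivially is digit-free in base
  \<open>unif P\<close>, hence of bounded size. This is where finiteness of the residue field comes
  from.\<close>

lemma ex_reps:
  assumes P: "P \<in> places"
  shows "\<exists>U n. is_reps P U n"
proof -
  let ?M = "{y. vge P 1 y}"
  obtain E where E: "\<And>U. finite U \<Longrightarrow> digit_free (unif P) U \<Longrightarrow> card U \<le> E"
    using digit_free_bounded by blast
  have tP: "unif P \<in> P" using dvr.t_in[OF dvr_place[OF P]] .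
  have "ksub P" using place_ring[OF P] k_in_place[OF P] by (auto simp: ksub_def)
  moreover have "ksub ?M"
    using vge_const_mult[OF P] dvr.vge_subgroup[OF dvr_place[OF P]] by (auto simp: ksub_def)
  moreover have "card U \<le> E" if U: "ksub U" "finite U" "U \<subseteq> P" "U \<inter> ?M = {0}" for U
  proof (rule E[OF U(2)], rule digit_freeI[of P])
    show "add_subgroup P" using place_ring[OF P] by blast
    show "unif P * y \<in> P" if "y \<in> P" for y using that tP place_ring[OF P] by blast
    show "unif P \<noteq> 0" using unif_nz[OF P] .
    fix u w assume uw: "u \<in> U" "w \<in> U" "u - w \<in> (*) (unif P) ` P"
    then obtain y where y: "y \<in> P" "u - w = unif P * y" by blast
    have "vge P (1 + 0) (unif P * y)"
      using y v_unif[OF P] by (intro vge_mult[OF P]) (auto simp: place_mem_iff[OF P] vge_def'[OF P])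
    then have "vge P 1 (u - w)" by (simp add: y(2))
    moreover have "u - w \<in> U" using uw U(1) add_subgroupD(2)[of U u w] unfolding ksub_def by blast
    ultimately have "u - w = 0" using U(4) by blast
    then show "u = w" by simp
  qed (use U in auto)
  ultimately have "\<exists>U n. ksub U \<and> finite U \<and> U \<subseteq> P \<and> U \<inter> ?M = {0} \<and> card U = card k ^ n \<and> (\<forall>y\<in>P. \<exists>u\<in>U. y - u \<in> ?M)"
    by (rule ksub_complement)
  then show ?thesis unfolding is_reps_def by (elim exE) (intro exI conjI; auto)
qed

definition reps :: "'a set \<Rightarrow> 'a set" where "reps P = (SOME U. \<exists>n. is_reps P U n)"
definition pdeg :: "'a set \<Rightarrow> nat" where "pdeg P = (SOME n. is_reps P (reps P) n)"

lemma is_reps: "P \<in> places \<Longrightarrow> is_reps P (reps P) (pdeg P)"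
proof -
  assume "P \<in> places"
  then have "\<exists>n. is_reps P (reps P) n" unfolding reps_def using ex_reps[of P] by (auto intro: someI2)
  then show ?thesis unfolding pdeg_def by (rule someI_ex)
qed

lemma repsD:
  assumes "P \<in> places"
  shows "finite (reps P)" "reps P \<subseteq> P" "card (reps P) = card k ^ pdeg P"
    "y \<in> P \<Longrightarrow> \<exists>u\<in>reps P. vge P 1 (y - u)"
    "u \<in> reps P \<Longrightarrow> w \<in> reps P \<Longrightarrow> vge P 1 (u - w) \<Longrightarrow> u = w"
proof -
  note * = is_reps[OF assms, unfolded is_reps_def]
  show "finite (reps P)" "reps P \<subseteq> P" "card (reps P) = card k ^ pdeg P"
    "y \<in> P \<Longrightarrow> \<exists>u\<in>reps P. vge P 1 (y - u)" using * by auto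
  assume a: "u \<in> reps P" "w \<in> reps P" "vge P 1 (u - w)"
  have "add_subgroup (reps P)" using * by (simp add: ksub_def)
  then have "u - w \<in> reps P" using a by (auto dest: add_subgroupD)
  then have "u - w = 0" using * a by blast
  then show "u = w" by simp
qed

lemma pdeg_pos: "P \<in> places \<Longrightarrow> pdeg P > 0"
proof (rule Nat.gr0I)
  assume P: "P \<in> places" and 0: "pdeg P = 0"
  then obtain u where u: "reps P = {u}" using repsD(3)[OF P] by (auto simp: card_1_singleton_iff)
  have "vge P 1 (1 - u)" "vge P 1 (0 - u)"
    using repsD(4)[OF P, of 1] repsD(4)[OF P, of 0] u place_ring[OF P] by auto
  then have "vge P 1 ((1 - u) - (0 - u))" by (rule vge_diff[OF P])
  then show False using v_const[OF P k_1] by (simp add: vge_def'[OF P])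
qed

text \<open>Truncated expansions in the uniformizer; being distinct modulo its \<open>e\<close>-th
  power, they provide the residues used at a zero of order \<open>e\<close>.\<close>

lemma card_digit_reps:
  fixes e :: nat
  assumes P: "P \<in> places"
  defines "D \<equiv> digit_sum (unif P) e ` ({..<e} \<rightarrow>\<^sub>E reps P)"
  shows "finite D" "D \<subseteq> P" "card D = card k ^ (pdeg P * e)"
    "a \<in> D \<Longrightarrow> b \<in> D \<Longrightarrow> vge P (int e) (a - b) \<Longrightarrow> a = b"
proof -
  let ?t = "unif P"
  have tP: "?t \<in> P" using dvr.t_in[OF dvr_place[OF P]] .
  note R = repsD[OF P] and ring = place_ring[OF P]
  have inj: "f = g" if fg: "f \<in> {..<e} \<rightarrow>\<^sub>E reps P" "g \<in> {..<e} \<rightarrow>\<^sub>E reps P"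
    "vge P (int e) (digit_sum ?t e f - digit_sum ?t e g)" for f g
  proof -
    have "digit_sum ?t e f - digit_sum ?t e g \<in> (\<lambda>y. ?t ^ e * y) ` P"
    proof (rule image_eqI)
      let ?d = "digit_sum ?t e f - digit_sum ?t e g"
      show "?d = ?t ^ e * (?d / ?t ^ e)" using unif_nz[OF P] by simp
      show "?d / ?t ^ e \<in> P"
        using fg(3) unif_nz[OF P]
        by (cases "?d = 0") (auto simp: ring place_mem_iff[OF P] vge_def'[OF P] v_divide[OF P] v_power[OF P] v_unif[OF P])
    qed
    have "f i = g i" if "i < e" for i
    proof (rule digit_sum_inj[of P ?t "reps P" e f g i])
      fix u w assume uw: "u \<in> reps P" "w \<in> reps P" "u - w \<in> (*) ?t ` P"
      then obtain y where y: "y \<in> P" "u - w = ?t * y" by blast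
      have "vge P (1 + 0) (?t * y)"
        using y v_unif[OF P] by (intro vge_mult[OF P]) (auto simp: place_mem_iff[OF P] vge_def'[OF P])
      then show "u = w" using R(5) uw y by simp
    qed (use fg that R(2) tP ring unif_nz[OF P] \<open>_ \<in> (\<lambda>y. ?t ^ e * y) ` P\<close> in \<open>auto simp: PiE_iff\<close>)
    then show ?thesis using fg by (intro PiE_ext[of f _ _ g]) auto
  qed
  show "finite D" unfolding D_def using R by (intro finite_imageI finite_PiE) auto
  show "D \<subseteq> P" unfolding D_def using R(2) tP ring by (auto intro!: digit_sum_mem simp: PiE_iff)
  show "card D = card k ^ (pdeg P * e)"
    unfolding D_def using R inj vge_0[OF P]
    by (subst card_digit_sums) (auto intro!: inj_onI simp: power_mult)
  show "a \<in> D \<Longrightarrow> b \<in> D \<Longrightarrow> vge P (int e) (a - b) \<Longrightarrow> a = b"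
    unfolding D_def using inj by blast
qed

subsection \<open>Weak approximation\<close>

lemma separate_two:
  assumes "P \<in> places" "Q \<in> places" "P \<noteq> Q"
  shows "\<exists>u. u \<noteq> 0 \<and> v P u > 0 \<and> v Q u < 0"
proof -
  obtain a b where ab: "a \<in> P" "a \<notin> Q" "b \<in> Q" "b \<notin> P"
    using place_subset_eq assms by blast
  then have nz: "a \<noteq> 0" "b \<noteq> 0" using place_ring(2) assms by auto
  then have "v P a \<ge> 0" "v P b < 0" "v Q a < 0" "v Q b \<ge> 0"
    using ab assms by (auto simp: place_mem_iff vge_def')
  then show ?thesis using nz assms by (intro exI[of _ "a / b"]) (auto simp: v_divide)
qed

text \<open>If the function \<open>y\<close> found so far has no pole at the new place
  \<open>Q\<close>, a high power of a \<open>z\<close> separating \<open>P\<close> from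
  \<open>Q\<close> is added to it.\<close>

lemma separate:
  assumes P: "P \<in> places" and T: "finite T" "T \<subseteq> places" "P \<notin> T"
  shows "\<exists>u. u \<noteq> 0 \<and> v P u > 0 \<and> (\<forall>Q\<in>T. v Q u < 0)"
  using T
proof (induction T rule: finite_induct)
  case empty
  then show ?case using unif_nz[OF P] v_unif[OF P] by (intro exI[of _ "unif P"]) auto
next
  case (insert Q T)
  obtain y where y: "y \<noteq> 0" "v P y > 0" "\<And>R. R \<in> T \<Longrightarrow> v R y < 0" using insert by auto
  have Q: "Q \<in> places" "P \<noteq> Q" using insert by auto
  obtain z where z: "z \<noteq> 0" "v P z > 0" "v Q z < 0" using separate_two[OF P Q] by blast
  show ?case
  proof (cases "v Q y < 0")
    case True
    then show ?thesis using y by blast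
  next
    case False
    \<comment> \<open>With \<open>r\<close> above all \<open>\<bar>v R y\<bar>\<close>, the
      valuations of \<open>y\<close> and \<open>z ^ r\<close> cannot tie on \<open>T\<close>: a tie
      would need \<open>v R z = 0\<close>, but \<open>v R y < 0\<close>. So no poles cancel.\<close>
    define r where "r = Suc (Max (insert 0 ((\<lambda>R. nat \<bar>v R y\<bar>) ` T)))"
    have r: "nat \<bar>v R y\<bar> < r" if "R \<in> T" for R
      unfolding r_def using insert.hyps(1) that by (auto simp: less_Suc_eq_le intro!: Max_ge)
    have zr: "z ^ r \<noteq> 0" using z by simp
    have vzr: "v R (z ^ r) = int r * v R z" if "R \<in> places" for R using v_power[OF that z(1)] .
    have neg: "y + z ^ r \<noteq> 0 \<and> v R (y + z ^ r) < 0" if R: "R \<in> places" "v R y \<noteq> int r * v R z" "v R y < 0 \<or> int r * v R z < 0" for R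
    proof (cases "v R y < int r * v R z")
      case True
      then have "vge R (v R y + 1) (z ^ r)" using vzr[OF R(1)] by (simp add: vge_def'[OF R(1)])
      then show ?thesis using v_add_less[OF R(1) y(1)] R True by auto
    next
      case False
      then have "vge R (v R (z ^ r) + 1) y" using vzr[OF R(1)] R(2) by (simp add: vge_def'[OF R(1)])
      then show ?thesis using v_add_less[OF R(1) zr] R False vzr[OF R(1)] by (auto simp: add.commute)
    qed
    have 1: "y + z ^ r \<noteq> 0 \<and> v R (y + z ^ r) < 0" if R: "R \<in> insert Q T" for R
    proof (cases "R = Q")
      case True
      have "int r * v Q z < 0" using z by (intro mult_pos_neg) (auto simp: r_def)
      then show ?thesis using False Q True by (intro neg) auto
    next
      case ne: False
      then have RT: "R \<in> T" using R by simp
      have "v R y \<noteq> int r * v R z"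
      proof
        assume eq: "v R y = int r * v R z"
        then have "v R z \<noteq> 0" using y(3)[OF RT] by auto
        then have "int r * 1 \<le> int r * \<bar>v R z\<bar>" by (intro mult_left_mono) auto
        then have "int r \<le> \<bar>v R y\<bar>" by (simp add: eq abs_mult)
        then show False using r[OF RT] by linarith
      qed
      then show ?thesis using y(3)[OF RT] RT insert.prems by (intro neg) auto
    qed
    have "vge P 1 (z ^ r)"
    proof -
      have "int r * v P z \<ge> 1 * 1" using z by (intro mult_mono) (auto simp: r_def)
      then show ?thesis using vzr[OF P] by (simp add: vge_def'[OF P])
    qed
    then have "vge P 1 (y + z ^ r)" using y by (intro vge_add[OF P]) (auto simp: vge_def'[OF P])
    moreover have nz: "y + z ^ r \<noteq> 0" using 1[of Q] by simp
    ultimately have "v P (y + z ^ r) > 0" by (simp add: vge_def'[OF P])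
    moreover have "\<forall>R\<in>insert Q T. v R (y + z ^ r) < 0" using 1 by (intro ballI) (rule conjunct2)
    ultimately show ?thesis using nz by (intro exI[of _ "y + z ^ r"] conjI)
  qed
qed

text \<open>For \<open>u\<close> with a zero at \<open>P\<close> and poles on \<open>T\<close>, the
  function \<open>1 / (1 + u ^ m)\<close> is close to 1 at \<open>P\<close> and to 0 on
  \<open>T\<close>.\<close>

lemma approx_one:
  assumes P: "P \<in> places" and T: "finite T" "T \<subseteq> places" "P \<notin> T"
  shows "\<exists>w. vge P (int n) (w - 1) \<and> (\<forall>Q\<in>T. vge Q (int n) w)"
proof -
  obtain u where u: "u \<noteq> 0" "v P u > 0" "\<And>Q. Q \<in> T \<Longrightarrow> v Q u < 0" using separate[OF assms] by blast
  define m where "m = Suc n"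
  have um: "u ^ m \<noteq> 0" using u by simp
  have big: "int n < int m * a" if "a > 0" for a
  proof -
    have "int m * 1 \<le> int m * a" using that by (intro mult_left_mono) auto
    moreover have "int m = int n + 1" by (simp add: m_def)
    ultimately show ?thesis by linarith
  qed
  have vm: "v R (u ^ m) = int m * v R u" if "R \<in> places" for R using v_power[OF that u(1)] .
  have v1: "v P 1 = 0" using v_const[OF P k_1] by simp
  have "vge P (v P 1 + 1) (u ^ m)" using vm[OF P] big[OF u(2)] v1 by (simp add: vge_def'[OF P])
  then have 1: "1 + u ^ m \<noteq> 0" "v P (1 + u ^ m) = 0" using v_add_less[OF P, of 1] v1 by auto
  have "inverse (1 + u ^ m) - 1 = - (u ^ m / (1 + u ^ m))" using 1 by (simp add: field_simps)
  moreover have "vge P (int n) (u ^ m / (1 + u ^ m))"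
    using 1 um vm[OF P] big[OF u(2)] by (simp add: vge_def'[OF P] v_divide[OF P])
  ultimately have A: "vge P (int n) (inverse (1 + u ^ m) - 1)" using vge_uminus[OF P] by metis
  have B: "vge Q (int n) (inverse (1 + u ^ m))" if "Q \<in> T" for Q
  proof -
    have Q: "Q \<in> places" using that T by auto
    have neg: "int n < - (int m * v Q u)" using big[of "- v Q u"] u(3)[OF that] by simp
    have "vge Q (v Q (u ^ m) + 1) 1" using neg vm[OF Q] v_const[OF Q k_1] by (simp add: vge_def'[OF Q])
    then have "v Q (1 + u ^ m) = v Q (u ^ m)" using v_add_less[OF Q um] by (metis add.commute)
    then show ?thesis using 1 neg vm[OF Q] by (simp add: vge_def'[OF Q] v_inverse[OF Q])
  qed
  show ?thesis using A B by blast
qed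

lemma weak_approximation:
  assumes T: "finite T" "T \<subseteq> places"
  shows "\<exists>z. \<forall>Q\<in>T. vge Q (e Q) (z - y Q)"
proof -
  \<comment> \<open>The precision has to outweigh the target \<open>e Q\<close> and the poles of all
    \<open>y R\<close> at \<open>Q\<close>. Where \<open>y R = 0\<close> the unspecified
    \<open>v Q 0\<close> merely enlarges \<open>n\<close>.\<close>
  define n where "n = Max (insert 0 ((\<lambda>(Q, R). nat (\<bar>e Q\<bar> + \<bar>v Q (y R)\<bar>)) ` (T \<times> T)))"
  have n: "nat (\<bar>e Q\<bar> + \<bar>v Q (y R)\<bar>) \<le> n" if "Q \<in> T" "R \<in> T" for Q R
    unfolding n_def using T that by (intro Max_ge) (auto intro!: rev_image_eqI[of "(Q, R)"])
  have "\<exists>w. vge P (int n) (w - 1) \<and> (\<forall>Q\<in>T - {P}. vge Q (int n) w)" if "P \<in> T" for P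
    using approx_one[of P "T - {P}" n] T that by auto
  then obtain w where w: "\<And>P. P \<in> T \<Longrightarrow> vge P (int n) (w P - 1)"
    "\<And>P Q. P \<in> T \<Longrightarrow> Q \<in> T \<Longrightarrow> Q \<noteq> P \<Longrightarrow> vge Q (int n) (w P)" by (metis Diff_iff singletonD)
  have "vge Q (e Q) ((\<Sum>P\<in>T. w P * y P) - y Q)" if Q: "Q \<in> T" for Q
  proof -
    have Qp: "Q \<in> places" using Q T by auto
    have "(\<Sum>P\<in>T. w P * y P) - y Q = (\<Sum>P\<in>T. (if P = Q then w P - 1 else w P) * y P)"
    proof -
      have "(\<Sum>P\<in>T. (if P = Q then w P - 1 else w P) * y P) = (\<Sum>P\<in>T. w P * y P - (if P = Q then y P else 0))"
        by (intro sum.cong) (auto simp: algebra_simps)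
      also have "\<dots> = (\<Sum>P\<in>T. w P * y P) - y Q" using Q T by (simp add: sum_subtractf)
      finally show ?thesis by simp
    qed
    also have "vge Q (e Q) \<dots>"
    proof (rule vge_sum[OF Qp])
      fix P assume P: "P \<in> T"
      have "vge Q (int n) (if P = Q then w P - 1 else w P)" using w P Q by auto
      moreover have "vge Q (v Q (y P)) (y P)" by (simp add: vge_def'[OF Qp])
      ultimately have "vge Q (int n + v Q (y P)) ((if P = Q then w P - 1 else w P) * y P)"
        by (rule vge_mult[OF Qp])
      then show "vge Q (e Q) ((if P = Q then w P - 1 else w P) * y P)"
        using n[OF Q P] by (elim vge_mono[OF Qp]) linarith
    qed
    finally show ?thesis .
  qed
  then show ?thesis by blast
qed

text \<open>By weak approximation, every choice of expansions modulo \<open>z\<close> at the places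
  of \<open>T\<close> is realised by a function regular on \<open>T\<close>. Two such functions
  congruent modulo \<open>z * H\<close>, with \<open>H\<close> the functions regular on
  \<open>T\<close>, have the same expansion at each place. This is the inequality between the degree
  of the zeros and the degree of the field extension, in terms of cardinalities.\<close>

lemma digit_free_of_zeros:
  assumes T: "finite T" "T \<subseteq> places" and z: "z \<noteq> 0" "\<And>Q. Q \<in> T \<Longrightarrow> v Q z \<ge> 0"
  shows "\<exists>U. finite U \<and> digit_free z U \<and> card U = card k ^ (\<Sum>Q\<in>T. pdeg Q * nat (v Q z))"
proof -
  define D where "D Q = digit_sum (unif Q) (nat (v Q z)) ` ({..<nat (v Q z)} \<rightarrow>\<^sub>E reps Q)" for Q
  have D: "finite (D Q)" "D Q \<subseteq> Q" "card (D Q) = card k ^ (pdeg Q * nat (v Q z))"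
    "\<And>a b. a \<in> D Q \<Longrightarrow> b \<in> D Q \<Longrightarrow> vge Q (v Q z) (a - b) \<Longrightarrow> a = b" if "Q \<in> T" for Q
    using card_digit_reps[where P = Q and e = "nat (v Q z)"] T(2) z(2)[OF that] that by (auto simp: D_def)
  have "\<exists>y. \<forall>Q\<in>T. vge Q (v Q z) (y - f Q)" for f using weak_approximation[OF T, of "\<lambda>Q. v Q z" f] .
  then obtain a where a: "\<And>f Q. Q \<in> T \<Longrightarrow> vge Q (v Q z) (a f - f Q)" by metis
  define H where "H = {y. \<forall>Q\<in>T. y \<in> Q}"
  let ?F = "PiE T D"
  have key: "f = g" if fg: "f \<in> ?F" "g \<in> ?F" "a f - a g \<in> (*) z ` H" for f g
  proof (rule PiE_ext[OF fg(1,2)])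
    fix Q assume Q: "Q \<in> T"
    then have Qp: "Q \<in> places" using T by auto
    obtain h where h: "h \<in> H" "a f - a g = z * h" using fg(3) by blast
    have "vge Q (v Q z + 0) (z * h)"
      using h Q by (intro vge_mult[OF Qp]) (auto simp: H_def place_mem_iff[OF Qp] vge_def'[OF Qp])
    then have 1: "vge Q (v Q z) (a f - a g)" using h by simp
    have "vge Q (v Q z) ((a f - a g) - (a f - f Q) + (a g - g Q))"
      by (rule vge_add[OF Qp vge_diff[OF Qp 1 a[OF Q]] a[OF Q]])
    then have "vge Q (v Q z) (f Q - g Q)" by (simp add: algebra_simps)
    then show "f Q = g Q" using D(4)[OF Q] fg Q by (auto simp: PiE_iff)
  qed
  have zQ: "z \<in> Q" if "Q \<in> T" for Q
    using that T(2) z(2)[OF that] by (auto simp: place_mem_iff vge_def' subset_iff)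
  have H1: "add_subgroup H"
    using T(2) place_ring(2,4) unfolding H_def add_subgroup_def by fast
  have H2: "z * y \<in> H" if "y \<in> H" for y
    using that T(2) zQ place_ring(5) unfolding H_def by fast
  note H = H1 H2
  have "a f \<in> H" if f: "f \<in> ?F" for f
    unfolding H_def
  proof safe
    fix Q assume Q: "Q \<in> T"
    then have Qp: "Q \<in> places" using T by auto
    have "a f - f Q \<in> Q" using vge_mono[OF Qp a[OF Q, of f] z(2)[OF Q]] by (simp add: place_mem_iff[OF Qp])
    moreover have "f Q \<in> Q" using f D(2)[OF Q] Q by (auto simp: PiE_iff)
    ultimately have "a f - f Q + f Q \<in> Q" using place_ring(6)[OF Qp] by blast
    then show "a f \<in> Q" by simp
  qed
  then have "digit_free z (a ` ?F)"
    using key z by (intro digit_freeI[OF H]) auto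
  moreover have "finite (a ` ?F)" using T D by (intro finite_imageI finite_PiE) auto
  moreover have "card (a ` ?F) = card k ^ (\<Sum>Q\<in>T. pdeg Q * nat (v Q z))"
  proof -
    have "inj_on a ?F"
      using key add_subgroupD(1)[OF H(1)] by (intro inj_onI) (metis diff_self image_eqI mult_zero_right)
    then have "card (a ` ?F) = (\<Prod>Q\<in>T. card (D Q))" using T by (simp add: card_image card_PiE)
    also have "\<dots> = (\<Prod>Q\<in>T. card k ^ (pdeg Q * nat (v Q z)))" using D by simp
    finally show ?thesis by (simp add: power_sum)
  qed
  ultimately show ?thesis by blast
qed

text \<open>Already \<open>E\<close> zeros would yield a digit-free set of at least
  \<open>card k ^ E > E\<close> elements.\<close>

lemma finite_zeros:
  assumes z: "z \<noteq> 0"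
  shows "finite {P \<in> places. v P z > 0}"
proof (rule ccontr)
  assume inf: "infinite {P \<in> places. v P z > 0}"
  obtain E where E: "\<And>U. finite U \<Longrightarrow> digit_free z U \<Longrightarrow> card U \<le> E"
    using digit_free_bounded by blast
  obtain T where T: "finite T" "card T = E" "T \<subseteq> {P \<in> places. v P z > 0}"
    using infinite_arbitrarily_large[OF inf] by blast
  obtain U where U: "finite U" "digit_free z U" "card U = card k ^ (\<Sum>Q\<in>T. pdeg Q * nat (v Q z))"
    using digit_free_of_zeros[of T z] T z by fastforce
  have "E = (\<Sum>Q\<in>T. 1)" using T by simp
  also have "\<dots> \<le> (\<Sum>Q\<in>T. pdeg Q * nat (v Q z))"
    using T(3) pdeg_pos by (intro sum_mono) (auto simp: Suc_le_eq)
  also have "\<dots> < card k ^ \<dots>" using card_k_ge_2 by (intro power_gt_expt) auto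
  finally show False using E[OF U(1,2)] U(3) by simp
qed

lemma finite_support:
  assumes z: "z \<noteq> 0"
  shows "finite {P \<in> places. v P z \<noteq> 0}"
proof -
  have "{P \<in> places. v P z \<noteq> 0} = {P \<in> places. v P z > 0} \<union> {P \<in> places. v P (inverse z) > 0}"
    using v_inverse z by auto
  then show ?thesis using finite_zeros[of z] finite_zeros[of "inverse z"] z by simp
qed

text \<open>If \<open>x\<close> is regular at a place of degree \<open>n\<close>, two of its first
  \<open>card k ^ n + 1\<close> powers coincide in the residue field, so the place is a zero of one
  of finitely many nonzero functions \<open>x ^ i - x ^ j\<close>. The remaining places are poles of
  \<open>x\<close>.\<close>

lemma finite_places_of_degree: "finite {P \<in> places. pdeg P = n}"
proof -
  let ?I = "{(i, j). i < j \<and> j \<le> card k ^ n}"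
  have x0: "x \<noteq> 0" using x_notin_k k_0 by auto
  have "{P \<in> places. pdeg P = n} \<subseteq> {P \<in> places. v P (inverse x) > 0} \<union>
      (\<Union>(i, j)\<in>?I. {P \<in> places. v P (x ^ i - x ^ j) > 0})"
  proof safe
    fix P assume P: "P \<in> places" "n = pdeg P" and
      no: "P \<notin> (\<Union>(i, j)\<in>{(i, j). i < j \<and> j \<le> card k ^ pdeg P}. {P \<in> places. v P (x ^ i - x ^ j) > 0})"
    show "v P (inverse x) > 0"
    proof (rule ccontr)
      assume "\<not> ?thesis"
      then have xP: "x \<in> P" using x0 P by (simp add: place_mem_iff vge_def' v_inverse)
      have "\<exists>u\<in>reps P. vge P 1 (x ^ i - u)" for i
        using repsD(4)[OF P(1)] place_ring(8)[OF P(1) xP] by blast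
      then obtain f where f: "\<And>i. f i \<in> reps P" "\<And>i. vge P 1 (x ^ i - f i)" by metis
      have "\<not> inj_on f {..card k ^ pdeg P}"
      proof
        assume "inj_on f {..card k ^ pdeg P}"
        then have "card {..card k ^ pdeg P} \<le> card (reps P)"
          using f repsD[OF P(1)] by (intro card_inj_on_le[of f]) auto
        then show False using repsD(3)[OF P(1)] by simp
      qed
      then obtain i j where ij: "i < j" "j \<le> card k ^ pdeg P" "f i = f j"
        unfolding inj_on_def by (metis atMost_iff linorder_neqE_nat)
      have "vge P 1 ((x ^ i - f i) - (x ^ j - f j))" by (rule vge_diff[OF P(1) f(2) f(2)])
      then have "vge P 1 (x ^ i - x ^ j)" using ij by simp
      moreover have "x ^ i - x ^ j \<noteq> 0" using root_in_k[OF ij(1), of x] x_notin_k by auto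
      ultimately have "v P (x ^ i - x ^ j) > 0" using P by (simp add: vge_def')
      then show False using no ij P by blast
    qed
  qed
  moreover have "finite ?I" by (rule finite_subset[of _ "{..card k ^ n} \<times> {..card k ^ n}"]) auto
  moreover have "finite {P \<in> places. v P (x ^ i - x ^ j) > 0}" if "i < j" for i j
    using finite_zeros[of "x ^ i - x ^ j"] root_in_k[OF that, of x] x_notin_k by auto
  ultimately show ?thesis
    using finite_zeros[of "inverse x"] x0 by (elim finite_subset) auto
qed

end

lemma card_le_fibers:
  fixes A A' :: "'a::ab_group_add set"
  assumes "finite A'" "finite U" "\<And>a. a \<in> A \<Longrightarrow> f a \<in> U"
    "\<And>a b. a \<in> A \<Longrightarrow> b \<in> A \<Longrightarrow> f a = f b \<Longrightarrow> a - b \<in> A'"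
  shows "finite A \<and> card A \<le> card A' * card U"
proof -
  have fib: "finite {a \<in> A. f a = u} \<and> card {a \<in> A. f a = u} \<le> card A'" for u
  proof (cases "{a \<in> A. f a = u} = {}")
    case True
    then show ?thesis unfolding True by simp
  next
    case False
    then obtain b where b: "b \<in> A" "f b = u" by blast
    have sub: "(\<lambda>a. a - b) ` {a \<in> A. f a = u} \<subseteq> A'" using assms(4) b by auto
    have inj: "inj_on (\<lambda>a. a - b) {a \<in> A. f a = u}" by (auto simp: inj_on_def)
    show ?thesis
      using card_inj_on_le[OF inj sub assms(1)] finite_imageD[OF finite_subset[OF sub assms(1)] inj] by simp
  qed
  have A: "A = (\<Union>u\<in>U. {a \<in> A. f a = u})" using assms(3) by auto
  have "card (\<Union>u\<in>U. {a \<in> A. f a = u}) \<le> (\<Sum>u\<in>U. card {a \<in> A. f a = u})"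
    by (rule card_UN_le[OF assms(2)])
  also have "\<dots> \<le> (\<Sum>u\<in>U. card A')" using fib by (intro sum_mono) auto
  finally have "card A \<le> card A' * card U" using A by (simp add: mult.commute)
  moreover have "finite (\<Union>u\<in>U. {a \<in> A. f a = u})" using assms(2) fib by blast
  ultimately show ?thesis using A by simp
qed

lemma int_subgroup_mult:
  fixes S :: "int set"
  assumes S: "add_subgroup S" and d: "d \<in> S"
  shows "m * d \<in> S"
proof -
  have nat_mult: "int m * d \<in> S" for m
    by (induction m) (auto simp: algebra_simps intro!: add_subgroupD[OF S] d)
  show ?thesis
    using nat_mult[of "nat m"] add_subgroupD(3)[OF S nat_mult[of "nat (- m)"]] by (cases "m \<ge> 0") auto
qed

lemma int_subgroup_generator:
  fixes S :: "int set"
  assumes S: "add_subgroup S" and d: "int d \<in> S" "d > 0"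
    and least: "\<And>e::nat. int e \<in> S \<Longrightarrow> e > 0 \<Longrightarrow> d \<le> e" and i: "i \<in> S"
  shows "int d dvd i"
proof -
  have mult: "m * int d \<in> S" for m by (rule int_subgroup_mult[OF S d(1)])
  have "i mod int d = i - (i div int d) * int d" by (simp add: minus_div_mult_eq_mod)
  also have "\<dots> \<in> S" by (intro add_subgroupD(2)[OF S] i mult)
  finally have "i mod int d \<in> S" .
  moreover have "0 \<le> i mod int d" "i mod int d < int d" using d by auto
  ultimately have "i mod int d = 0" using least[of "nat (i mod int d)"] by (cases "i mod int d = 0") auto
  then show ?thesis by auto
qed

abbreviation mult_at :: "('b \<Rightarrow>\<^sub>0 int) \<Rightarrow> 'b \<Rightarrow> int" where "mult_at \<equiv> Poly_Mapping.lookup"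

context function_field
begin

subsection \<open>Divisors and Riemann's theorem\<close>

definition Divs :: "'a divisor set" where "Divs = {D. Poly_Mapping.keys D \<subseteq> places}"
definition ddeg :: "'a divisor \<Rightarrow> int"
  where "ddeg D = (\<Sum>P\<in>Poly_Mapping.keys D. mult_at D P * int (pdeg P))"
definition dle :: "'a divisor \<Rightarrow> 'a divisor \<Rightarrow> bool" where "dle D D' \<longleftrightarrow> (\<forall>P. mult_at D P \<le> mult_at D' P)"
definition pos_part :: "'a divisor \<Rightarrow> 'a divisor" where "pos_part D = Poly_Mapping.map (max 0) D"

lemma lookup_pos_part: "mult_at (pos_part D) P = max 0 (mult_at D P)"
  by (simp add: pos_part_def map.rep_eq when_def)

lemma DivsI: "(\<And>P. mult_at D P \<noteq> 0 \<Longrightarrow> P \<in> places) \<Longrightarrow> D \<in> Divs"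
  by (auto simp: Divs_def in_keys_iff)

lemma DivsD: "D \<in> Divs \<Longrightarrow> mult_at D P \<noteq> 0 \<Longrightarrow> P \<in> places"
  by (auto simp: Divs_def in_keys_iff)

lemma Divs_closed:
  shows "0 \<in> Divs" "D \<in> Divs \<Longrightarrow> D' \<in> Divs \<Longrightarrow> D + D' \<in> Divs" "D \<in> Divs \<Longrightarrow> D' \<in> Divs \<Longrightarrow> D - D' \<in> Divs"
    "D \<in> Divs \<Longrightarrow> - D \<in> Divs" "D \<in> Divs \<Longrightarrow> pos_part D \<in> Divs" "P \<in> places \<Longrightarrow> Poly_Mapping.single P n \<in> Divs"
  by (rule DivsI; auto simp: lookup_add lookup_minus lookup_pos_part lookup_single when_def max_def
        dest!: DivsD split: if_splits; fail)+

lemma ddeg_superset: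
  assumes "finite F" "Poly_Mapping.keys D \<subseteq> F"
  shows "ddeg D = (\<Sum>P\<in>F. mult_at D P * int (pdeg P))"
  unfolding ddeg_def using assms by (intro sum.mono_neutral_left) (auto simp: in_keys_iff)

lemma ddeg_0 [simp]: "ddeg 0 = 0" by (simp add: ddeg_def)

lemma ddeg_add: "ddeg (D + D') = ddeg D + ddeg D'"
proof -
  let ?F = "Poly_Mapping.keys D \<union> Poly_Mapping.keys D'"
  have "ddeg (D + D') = (\<Sum>P\<in>?F. mult_at (D + D') P * int (pdeg P))"
    by (intro ddeg_superset) (use keys_add[of D D'] in auto)
  also have "\<dots> = ddeg D + ddeg D'"
    by (simp add: ddeg_superset[of ?F D] ddeg_superset[of ?F D'] lookup_add algebra_simps sum.distrib)
  finally show ?thesis .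
qed

lemma ddeg_uminus: "ddeg (- D) = - ddeg D"
  using ddeg_add[of D "- D"] by simp

lemma ddeg_diff: "ddeg (D - D') = ddeg D - ddeg D'"
  using ddeg_add[of D "- D'"] ddeg_uminus[of D'] by simp

lemma ddeg_single: "ddeg (Poly_Mapping.single P n) = n * int (pdeg P)"
  by (cases "n = 0") (auto simp: ddeg_def)

lemma ddeg_nonneg: "dle 0 D \<Longrightarrow> ddeg D \<ge> 0"
  by (auto simp: ddeg_def dle_def intro!: sum_nonneg)

lemma ddeg_mono: "dle D D' \<Longrightarrow> ddeg D \<le> ddeg D'"
  using ddeg_nonneg[of "D' - D"] by (auto simp: dle_def lookup_minus ddeg_diff)

definition pdiv :: "'a \<Rightarrow> 'a divisor"
  where "pdiv z = Abs_poly_mapping (\<lambda>P. if P \<in> places then v P z else 0)"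

lemma lookup_pdiv: "z \<noteq> 0 \<Longrightarrow> mult_at (pdiv z) P = (if P \<in> places then v P z else 0)"
proof -
  assume z: "z \<noteq> 0"
  have "{P. (if P \<in> places then v P z else 0) \<noteq> 0} = {P \<in> places. v P z \<noteq> 0}" by auto
  then show ?thesis unfolding pdiv_def using finite_support[OF z] by simp
qed

lemma pdiv_Divs: "z \<noteq> 0 \<Longrightarrow> pdiv z \<in> Divs"
  by (rule DivsI) (auto simp: lookup_pdiv split: if_splits)

lemma pdiv_mult: "z \<noteq> 0 \<Longrightarrow> w \<noteq> 0 \<Longrightarrow> pdiv (z * w) = pdiv z + pdiv w"
  by (rule poly_mapping_eqI) (auto simp: lookup_pdiv lookup_add v_mult)

lemma pdiv_inverse: "z \<noteq> 0 \<Longrightarrow> pdiv (inverse z) = - pdiv z"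
  by (rule poly_mapping_eqI) (auto simp: lookup_pdiv v_inverse)

text \<open>The Riemann-Roch space of \<open>D\<close>; 0 belongs to it by the convention in
  \<open>vge\<close>.\<close>

definition LL :: "'a divisor \<Rightarrow> 'a set" where "LL D = {z. \<forall>P\<in>places. vge P (- mult_at D P) z}"

lemma LL_iff:
  assumes D: "D \<in> Divs" and z: "z \<noteq> 0"
  shows "z \<in> LL D \<longleftrightarrow> dle 0 (D + pdiv z)"
proof -
  have "0 \<le> mult_at (D + pdiv z) P \<longleftrightarrow> (P \<in> places \<longrightarrow> vge P (- mult_at D P) z)" for P
    using DivsD[OF D, of P] z by (cases "P \<in> places"; cases "mult_at D P = 0") (auto simp: lookup_add lookup_pdiv vge_def')
  then show ?thesis unfolding LL_def dle_def by auto
qed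

lemma LL_zero: "0 \<in> LL D" by (simp add: LL_def vge_0)

lemma LL_0: "LL 0 = k"
proof
  show "LL 0 \<subseteq> k"
    using ex_pole by (auto simp: LL_def place_mem_iff)
  show "k \<subseteq> LL 0" using k_in_place by (auto simp: LL_def place_mem_iff)
qed

lemma ksub_LL: "ksub (LL D)"
  unfolding ksub_def add_subgroup_def LL_def using vge_0 vge_diff vge_const_mult by auto

lemma LL_mono:
  assumes "dle D D'"
  shows "LL D \<subseteq> LL D'"
  unfolding LL_def
proof safe
  fix z P assume z: "\<forall>P\<in>places. vge P (- mult_at D P) z" and P: "P \<in> places"
  show "vge P (- mult_at D' P) z"
    by (rule vge_mono[OF P bspec[OF z P]]) (use assms in \<open>simp add: dle_def\<close>)
qed

lemma LL_mult:
  assumes "z \<in> LL D" "w \<in> LL D'"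
  shows "z * w \<in> LL (D + D')"
  unfolding LL_def
proof safe
  fix P assume P: "P \<in> places"
  have "vge P (- mult_at D P + - mult_at D' P) (z * w)"
    using assms P by (intro vge_mult[OF P]) (auto simp: LL_def)
  then show "vge P (- mult_at (D + D') P) (z * w)" by (simp add: lookup_add)
qed

text \<open>Sending \<open>z\<close> to the residue of \<open>z * unif P powi m\<close> reads off
  its leading coefficient at the one newly permitted pole order. Functions with the same residue
  differ by an element of \<open>LL D\<close>.\<close>

lemma LL_add_place:
  assumes P: "P \<in> places" and fin: "finite (LL D)"
  shows "finite (LL (D + Poly_Mapping.single P 1)) \<and>
    card (LL (D + Poly_Mapping.single P 1)) \<le> card (LL D) * card k ^ pdeg P"
proof -
  let ?D = "D + Poly_Mapping.single P 1"
  define m where "m = mult_at D P + 1"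
  let ?s = "unif P powi m"
  note dP = dvr_place[OF P]
  have "\<exists>u\<in>reps P. vge P 1 (z * ?s - u)" if "z \<in> LL ?D" for z
  proof -
    have "vge P (- m) z" using that P by (auto simp: LL_def lookup_add m_def)
    then have "z * ?s \<in> P" by (simp add: dvr.vge_iff_mem[OF dP])
    then show ?thesis using repsD(4)[OF P] by blast
  qed
  then obtain f where f: "\<And>z. z \<in> LL ?D \<Longrightarrow> f z \<in> reps P" "\<And>z. z \<in> LL ?D \<Longrightarrow> vge P 1 (z * ?s - f z)"
    by metis
  have "finite (LL ?D) \<and> card (LL ?D) \<le> card (LL D) * card (reps P)"
  proof (rule card_le_fibers[OF fin repsD(1)[OF P] f(1)])
    fix a b assume ab: "a \<in> LL ?D" "b \<in> LL ?D" "f a = f b"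
    have "vge P 1 ((a * ?s - f a) - (b * ?s - f b))" using f(2) ab by (intro vge_diff[OF P, of _ "a * ?s - f a"])
    then have "vge P 1 ((a - b) * ?s)" using ab(3) by (simp add: algebra_simps)
    moreover have "vge P (- m) (unif P powi (- m))" by (simp add: vge_def'[OF P] dvr.val_powi[OF dP])
    ultimately have "vge P (1 + - m) ((a - b) * ?s * unif P powi (- m))" by (rule vge_mult[OF P])
    moreover have "(a - b) * ?s * unif P powi (- m) = a - b"
      using unif_nz[OF P] by (simp add: power_int_minus)
    ultimately have "vge P (1 + - m) (a - b)" by (simp only:)
    then have 1: "vge P (- mult_at D P) (a - b)" by (simp add: m_def)
    have 2: "a - b \<in> LL ?D" using ab ksub_LL[of ?D] unfolding ksub_def by (blast intro: add_subgroupD(2))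
    show "a - b \<in> LL D"
      unfolding LL_def
    proof (safe)
      fix Q assume Q: "Q \<in> places"
      show "vge Q (- mult_at D Q) (a - b)"
      proof (cases "Q = P")
        case True
        then show ?thesis using 1 by simp
      next
        case False
        have "vge Q (- mult_at ?D Q) (a - b)" using 2 Q unfolding LL_def by blast
        then show ?thesis using False by (simp add: lookup_add lookup_single)
      qed
    qed
  qed
  then show ?thesis using repsD(3)[OF P] by simp
qed

lemma LL_add_effective:
  assumes fin: "finite (LL D)" and E: "E \<in> Divs" "dle 0 E"
  shows "finite (LL (D + E)) \<and> card (LL (D + E)) \<le> card (LL D) * card k ^ nat (ddeg E)"
  using E
proof (induction "nat (ddeg E)" arbitrary: E rule: less_induct)
  case less
  show ?case
  proof (cases "E = 0")
    case True
    then show ?thesis using fin by simp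
  next
    case False
    then obtain P where P: "mult_at E P \<noteq> 0" by (metis lookup_zero poly_mapping_eqI)
    then have Pp: "P \<in> places" using less.prems DivsD by blast
    define E' where "E' = E - Poly_Mapping.single P 1"
    have E: "E = E' + Poly_Mapping.single P 1" by (simp add: E'_def)
    have "mult_at E P \<ge> 1" using P less.prems(2)[unfolded dle_def, rule_format, of P] by simp
    then have E': "E' \<in> Divs" "dle 0 E'"
      using less.prems Pp by (auto simp: E'_def Divs_closed dle_def lookup_minus lookup_single when_def)
    have deg: "ddeg E = ddeg E' + int (pdeg P)" unfolding E by (simp add: ddeg_add ddeg_single)
    have nn: "ddeg E' \<ge> 0" using E' ddeg_nonneg by simp
    then have "nat (ddeg E') < nat (ddeg E)" using deg pdeg_pos[OF Pp] by simp
    then have IH: "finite (LL (D + E'))" "card (LL (D + E')) \<le> card (LL D) * card k ^ nat (ddeg E')"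
      using less.hyps E' by auto
    have "finite (LL (D + E' + Poly_Mapping.single P 1))"
      and le: "card (LL (D + E' + Poly_Mapping.single P 1)) \<le> card (LL (D + E')) * card k ^ pdeg P"
      using LL_add_place[OF Pp IH(1)] by auto
    moreover have "nat (ddeg E) = nat (ddeg E') + pdeg P" using deg nn by simp
    then have "card (LL (D + E')) * card k ^ pdeg P \<le> card (LL D) * card k ^ nat (ddeg E)"
      using mult_right_mono[OF IH(2), of "card k ^ pdeg P"] by (simp add: power_add mult.assoc)
    ultimately show ?thesis using le by (simp add: E add.assoc)
  qed
qed

lemma dle_pos_part: "dle D (pos_part D)" "dle 0 (pos_part D)"
  by (auto simp: dle_def lookup_pos_part)

lemma finite_LL:
  assumes "D \<in> Divs"
  shows "finite (LL D)"
proof -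
  have "finite (LL (0 + pos_part D))"
    using LL_add_effective[of 0 "pos_part D"] assms by (auto simp: LL_0 finite_k Divs_closed dle_pos_part)
  then show ?thesis using finite_subset[OF LL_mono[OF dle_pos_part(1)[of D]]] by simp
qed

text \<open>The dimension of the Riemann-Roch space, read off from its cardinality.\<close>

definition l :: "'a divisor \<Rightarrow> nat" where "l D = (SOME n. card (LL D) = card k ^ n)"

lemma card_LL: "D \<in> Divs \<Longrightarrow> card (LL D) = card k ^ l D"
  unfolding l_def by (rule someI_ex) (intro card_ksub ksub_LL finite_LL)

lemma card_k_power_le_iff: "card k ^ m \<le> card k ^ n \<longleftrightarrow> m \<le> n"
  using card_k_ge_2 by (intro power_increasing_iff) auto

lemma l_0: "l 0 = 1"
proof -
  have "card k ^ l 0 = card k ^ 1" using card_LL[OF Divs_closed(1)] by (simp add: LL_0)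
  then show ?thesis using card_k_power_le_iff by (metis order.antisym order.refl)
qed

text \<open>Equivalently, \<open>ddeg - l\<close> is monotone with respect to \<open>dle\<close>.
  Together with invariance under \<open>pdiv\<close>, this monotonicity is what Riemann's theorem
  rests on.\<close>

lemma l_le:
  assumes D: "D \<in> Divs" "D' \<in> Divs" "dle D D'"
  shows "int (l D') \<le> int (l D) + (ddeg D' - ddeg D)"
proof -
  have "D' - D \<in> Divs" "dle 0 (D' - D)" using D by (auto simp: Divs_closed dle_def lookup_minus)
  then have "card (LL (D + (D' - D))) \<le> card (LL D) * card k ^ nat (ddeg (D' - D))"
    using LL_add_effective[OF finite_LL[OF D(1)]] by blast
  then have "card k ^ l D' \<le> card k ^ (l D + nat (ddeg (D' - D)))"
    using D by (simp add: card_LL power_add)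
  then have "l D' \<le> l D + nat (ddeg (D' - D))" by (simp only: card_k_power_le_iff)
  moreover have "ddeg (D' - D) \<ge> 0" using \<open>dle 0 (D' - D)\<close> by (rule ddeg_nonneg)
  ultimately show ?thesis by (simp add: ddeg_diff)
qed

lemma LL_shift:
  assumes z: "z \<noteq> 0" and D: "D \<in> Divs"
  shows "LL (D + pdiv z) = (*) (inverse z) ` LL D"
proof -
  have cl: "D + pdiv z \<in> Divs" using D pdiv_Divs[OF z] by (simp add: Divs_closed)
  have zi: "inverse z \<in> LL (pdiv z)"
    using z by (subst LL_iff) (auto simp: pdiv_Divs pdiv_inverse dle_def)
  have 1: "inverse z * y \<in> LL (D + pdiv z)" if "y \<in> LL D" for y
    using LL_mult[OF that zi] by (simp only: mult.commute)
  have zl: "z \<in> LL (- pdiv z)"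
    using z by (subst LL_iff) (auto simp: pdiv_Divs Divs_closed dle_def)
  have "y * z \<in> LL D" if "y \<in> LL (D + pdiv z)" for y
    using LL_mult[OF that zl] by simp
  then have "y \<in> (*) (inverse z) ` LL D" if "y \<in> LL (D + pdiv z)" for y
    using that z by (intro image_eqI[of _ _ "y * z"]) auto
  then show ?thesis using 1 by blast
qed

lemma l_shift:
  assumes z: "z \<noteq> 0" and D: "D \<in> Divs"
  shows "l (D + pdiv z) = l D"
proof -
  have "card (LL (D + pdiv z)) = card (LL D)"
    unfolding LL_shift[OF z D] using z by (intro card_image) (auto simp: inj_on_def)
  then show ?thesis by (simp add: l_def)
qed

lemma ex_pole_bound:
  assumes "finite U"
  shows "\<exists>C\<in>Divs. dle 0 C \<and> U \<subseteq> LL C"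
  using assms
proof (induction U rule: finite_induct)
  case empty
  then show ?case using Divs_closed(1) by (intro bexI[of _ 0]) (auto simp: dle_def)
next
  case (insert u U)
  then obtain C where C: "C \<in> Divs" "dle 0 C" "U \<subseteq> LL C" by blast
  show ?case
  proof (cases "u = 0")
    case True
    then show ?thesis using C LL_zero by blast
  next
    case False
    let ?E = "pos_part (- pdiv u)"
    have E: "?E \<in> Divs" "dle 0 ?E" using pdiv_Divs[OF False] by (auto simp: Divs_closed dle_pos_part)
    have "u \<in> LL ?E" using False E(1) by (subst LL_iff) (auto simp: dle_def lookup_add lookup_pos_part)
    moreover have "dle C (C + ?E)" "dle ?E (C + ?E)" "dle 0 (C + ?E)"
      using C E by (auto simp: dle_def lookup_add)
    ultimately show ?thesis using C E LL_mono by (intro bexI[of _ "C + ?E"]) (auto simp: Divs_closed)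
  qed
qed

primrec nmult :: "nat \<Rightarrow> 'a divisor \<Rightarrow> 'a divisor"
  where "nmult 0 D = 0" | "nmult (Suc m) D = D + nmult m D"

lemma nmult_Divs: "D \<in> Divs \<Longrightarrow> nmult m D \<in> Divs"
  by (induction m) (auto simp: Divs_closed)

lemma ddeg_nmult: "ddeg (nmult m D) = int m * ddeg D"
  by (induction m) (auto simp: ddeg_add algebra_simps)

lemma nmult_nonneg: "dle 0 D \<Longrightarrow> dle 0 (nmult m D)"
  by (induction m) (auto simp: dle_def lookup_add)

definition poles :: "'a \<Rightarrow> 'a divisor" where "poles z = pos_part (- pdiv z)"

lemma poles_Divs: "z \<noteq> 0 \<Longrightarrow> poles z \<in> Divs" "dle 0 (poles z)"
  by (auto simp: poles_def Divs_closed pdiv_Divs dle_pos_part)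

text \<open>The zeros of \<open>z\<close> provide digits, the poles bound the resulting digit sums.\<close>

lemma digit_sums_in_LL:
  assumes z: "z \<noteq> 0"
  shows "\<exists>C\<in>Divs. dle 0 C \<and> (\<forall>m. m * nat (ddeg (pos_part (pdiv z))) \<le> l (C + nmult m (poles z)))"
proof -
  let ?T = "{P \<in> places. v P z > 0}"
  let ?d = "nat (ddeg (pos_part (pdiv z)))"
  have keys: "Poly_Mapping.keys (pos_part (pdiv z)) \<subseteq> ?T"
    using z by (auto simp: in_keys_iff lookup_pos_part lookup_pdiv split: if_splits)
  have deg: "ddeg (pos_part (pdiv z)) = (\<Sum>Q\<in>?T. int (pdeg Q * nat (v Q z)))"
    unfolding ddeg_superset[OF finite_zeros[OF z] keys]
    using z by (intro sum.cong) (auto simp: lookup_pos_part lookup_pdiv)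
  obtain U where U: "finite U" "digit_free z U" "card U = card k ^ (\<Sum>Q\<in>?T. pdeg Q * nat (v Q z))"
    using digit_free_of_zeros[OF finite_zeros[OF z] _ z] by auto
  have "?d = (\<Sum>Q\<in>?T. pdeg Q * nat (v Q z))" unfolding deg of_nat_sum[symmetric] by (rule nat_int)
  \<comment> \<open>The divisor \<open>C\<close> chosen next absorbs the poles of all digits at once
    and does not depend on \<open>m\<close>.\<close>
  then have cU: "card U = card k ^ ?d" using U(3) by simp
  obtain C where C: "C \<in> Divs" "dle 0 C" "U \<subseteq> LL C" using ex_pole_bound[OF U(1)] by blast
  let ?D = "\<lambda>m. C + nmult m (poles z)"
  have Dm: "?D m \<in> Divs" for m using C poles_Divs(1)[OF z] by (intro Divs_closed nmult_Divs) auto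
  have "z \<in> LL (poles z)"
    using z poles_Divs(1)[OF z] by (subst LL_iff) (auto simp: poles_def dle_def lookup_add lookup_pos_part)
  have mem: "digit_sum z m f \<in> LL (?D m)" if "\<And>i. i < m \<Longrightarrow> f i \<in> U" for m f
    using that
  proof (induction m arbitrary: f)
    case 0
    then show ?case by (simp add: LL_zero)
  next
    case (Suc m)
    have "dle 0 (nmult (Suc m) (poles z))" by (rule nmult_nonneg[OF poles_Divs(2)])
    then have "dle C (?D (Suc m))" by (simp add: dle_def lookup_add del: nmult.simps)
    then have 1: "f 0 \<in> LL (?D (Suc m))" using Suc.prems[of 0] C(3) LL_mono by blast
    have "z * digit_sum z m (\<lambda>i. f (Suc i)) \<in> LL (poles z + ?D m)"
      using Suc by (intro LL_mult \<open>z \<in> LL (poles z)\<close>) auto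
    then have 2: "z * digit_sum z m (\<lambda>i. f (Suc i)) \<in> LL (?D (Suc m))" by (simp add: add_ac)
    show ?case unfolding digit_sum_Suc
      using 1 2 ksub_LL[of "?D (Suc m)"] add_subgroupD(4) unfolding ksub_def by blast
  qed
  have "m * ?d \<le> l (?D m)" for m
  proof -
    have "card k ^ (?d * m) = card (digit_sum z m ` ({..<m} \<rightarrow>\<^sub>E U))"
      using U cU by (simp add: card_digit_sums digit_free_def power_mult)
    also have "\<dots> \<le> card (LL (?D m))"
      using mem by (intro card_mono finite_LL Dm) (auto simp: PiE_iff)
    also have "\<dots> = card k ^ l (?D m)" by (rule card_LL[OF Dm])
    finally show ?thesis by (simp add: card_k_power_le_iff mult.commute)
  qed
  then show ?thesis using C by blast
qed

text \<open>The dimension of \<open>LL (C + nmult m (poles z))\<close> is at least \<open>m\<close>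
  times the degree of the zeros and at most \<open>m\<close> times the degree of the poles plus a
  constant. Compare the growth in \<open>m\<close>.\<close>

lemma ddeg_zeros_le_poles:
  assumes z: "z \<noteq> 0"
  shows "ddeg (pos_part (pdiv z)) \<le> ddeg (poles z)"
proof -
  let ?a = "ddeg (pos_part (pdiv z))" and ?b = "ddeg (poles z)"
  obtain C where C: "C \<in> Divs" "dle 0 C" "\<And>m. m * nat ?a \<le> l (C + nmult m (poles z))"
    using digit_sums_in_LL[OF z] by blast
  have pos: "?a \<ge> 0" "?b \<ge> 0" using ddeg_nonneg dle_pos_part poles_Divs by auto
  have "int m * ?a \<le> 1 + ddeg C + int m * ?b" for m
  proof -
    let ?D = "C + nmult m (poles z)"
    have "dle 0 (nmult m (poles z))" by (rule nmult_nonneg[OF poles_Divs(2)])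
    then have "dle 0 ?D" "?D \<in> Divs" using C poles_Divs(1)[OF z] by (auto simp: dle_def lookup_add intro!: Divs_closed nmult_Divs)
    then have "int (l ?D) \<le> int (l 0) + (ddeg ?D - ddeg 0)" using Divs_closed(1) by (intro l_le)
    then have "int (l ?D) \<le> 1 + ddeg C + int m * ?b" by (simp add: l_0 ddeg_add ddeg_nmult)
    moreover have "int m * ?a \<le> int (l ?D)" using C(3)[of m] pos by (metis nat_0_le of_nat_le_iff of_nat_mult)
    ultimately show ?thesis by simp
  qed
  \<comment> \<open>With \<open>m = 2 + ddeg C\<close> the constant \<open>1 + ddeg C\<close> is
    less than \<open>m\<close>, which forces the integer difference of the degrees to be at most
    0.\<close>
  from this[of "nat (2 + ddeg C)"] have "(2 + ddeg C) * ?a \<le> 1 + ddeg C + (2 + ddeg C) * ?b"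
    using ddeg_nonneg[OF C(2)] by simp
  then have "(2 + ddeg C) * (?a - ?b) < 2 + ddeg C" by (simp add: algebra_simps)
  then have "?a - ?b < 1" using ddeg_nonneg[OF C(2)] by (smt (verit) mult_less_cancel_left2)
  then show ?thesis by simp
qed

lemma pdiv_split: "pdiv z = pos_part (pdiv z) - poles z"
  by (rule poly_mapping_eqI) (auto simp: poles_def lookup_minus lookup_pos_part)

text \<open>Passing to \<open>inverse z\<close> exchanges zeros and poles, so the inequality holds
  in both directions.\<close>

lemma ddeg_pdiv:
  assumes "z \<noteq> 0"
  shows "ddeg (pdiv z) = 0"
proof -
  have "pos_part (pdiv (inverse z)) = poles z" "poles (inverse z) = pos_part (pdiv z)"
    using assms by (auto simp: poles_def pdiv_inverse)
  then have "ddeg (pos_part (pdiv z)) = ddeg (poles z)"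
    using ddeg_zeros_le_poles[OF assms] ddeg_zeros_le_poles[of "inverse z"] assms by simp
  then show ?thesis using arg_cong[OF pdiv_split[of z], of ddeg] by (simp add: ddeg_diff)
qed

lemma ex_LL_nonzero: "D \<in> Divs \<Longrightarrow> l D > 0 \<Longrightarrow> \<exists>z\<in>LL D. z \<noteq> 0"
proof (rule ccontr)
  assume D: "D \<in> Divs" "l D > 0" and "\<not> ?thesis"
  then have "LL D \<subseteq> {0}" by auto
  then have "card (LL D) \<le> card {0 :: 'a}" by (intro card_mono) auto
  then have "card k ^ l D \<le> card k ^ 0" using card_LL[OF D(1)] by simp
  then show False using D(2) by (simp only: card_k_power_le_iff)
qed

text \<open>Riemann's inequality. For multiples of the pole divisor of \<open>x\<close> it is the
  digit count. Any other \<open>A\<close> is linearly equivalent to a divisor below such a multiple,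
  and \<open>ddeg - l\<close> is monotone and invariant under equivalence.\<close>

lemma l_lower_bound: "\<exists>c. \<forall>A\<in>Divs. ddeg A - c \<le> int (l A)"
proof -
  have x0: "x \<noteq> 0" using x_notin_k k_0 by auto
  let ?B = "poles x"
  have B: "?B \<in> Divs" "dle 0 ?B" using poles_Divs x0 by auto
  obtain P where P: "P \<in> places" "x \<notin> P" using ex_pole[OF x_notin_k] by blast
  then have "v P x < 0" using x0 by (auto simp: place_mem_iff vge_def')
  then have "mult_at ?B P \<ge> 1" using P x0 by (simp add: poles_def lookup_pos_part lookup_pdiv)
  then have "dle (Poly_Mapping.single P 1) ?B"
    using B(2) by (auto simp: dle_def lookup_single when_def)
  then have "int (pdeg P) \<le> ddeg ?B" using ddeg_mono by (force simp: ddeg_single)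
  then have Bpos: "ddeg ?B \<ge> 1" using pdeg_pos[OF P(1)] by simp
  obtain C where C: "C \<in> Divs" "dle 0 C" "\<And>m. m * nat (ddeg (pos_part (pdiv x))) \<le> l (C + nmult m ?B)"
    using digit_sums_in_LL[OF x0] by blast
  have eq: "ddeg (pos_part (pdiv x)) = ddeg ?B"
    using ddeg_pdiv[OF x0] arg_cong[OF pdiv_split[of x], of ddeg] by (simp add: ddeg_diff)
  define mB where "mB m = nmult m ?B" for m :: nat
  have mB: "mB m \<in> Divs" "ddeg (mB m) = int m * ddeg ?B" for m
    using B by (auto simp: mB_def ddeg_nmult intro!: nmult_Divs)
  have lmB: "int m * ddeg ?B - ddeg C \<le> int (l (mB m))" for m
  proof -
    have "int (l (C + mB m)) \<le> int (l (mB m)) + (ddeg (C + mB m) - ddeg (mB m))"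
      using C mB by (intro l_le) (auto simp: Divs_closed dle_def lookup_add)
    moreover have "int m * ddeg ?B \<le> int (l (C + mB m))"
      using C(3)[of m] Bpos unfolding eq mB_def[symmetric] by (metis nat_0_le of_nat_le_iff of_nat_mult order.trans zero_le_one)
    ultimately show ?thesis by (simp add: ddeg_add)
  qed
  have "ddeg A - ddeg C \<le> int (l A)" if A: "A \<in> Divs" for A
  proof -
    let ?A = "pos_part A"
    \<comment> \<open>Large enough for the bound \<open>m * ddeg ?B - ddeg C - ddeg ?A\<close> on
      the dimension of \<open>LL (mB m - ?A)\<close> to be positive, because
      \<open>ddeg ?B \<ge> 1\<close>.\<close>
    define m where "m = nat (ddeg C + ddeg ?A + 1)"
    have nn: "ddeg C \<ge> 0" "ddeg ?A \<ge> 0" using ddeg_nonneg C(2) dle_pos_part by auto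
    have D: "mB m - ?A \<in> Divs" using A mB by (simp add: Divs_closed)
    have "int (l (mB m)) \<le> int (l (mB m - ?A)) + (ddeg (mB m) - ddeg (mB m - ?A))"
      using D mB by (intro l_le) (auto simp: dle_def lookup_minus lookup_pos_part)
    then have "int m * ddeg ?B - ddeg C - ddeg ?A \<le> int (l (mB m - ?A))"
      using lmB[of m] by (simp add: ddeg_diff)
    moreover have "int m * 1 \<le> int m * ddeg ?B" using Bpos by (intro mult_left_mono) auto
    moreover have "int m = ddeg C + ddeg ?A + 1" using nn by (simp add: m_def)
    ultimately have "l (mB m - ?A) > 0" by linarith
    then obtain z where z: "z \<in> LL (mB m - ?A)" "z \<noteq> 0" using ex_LL_nonzero[OF D] by blast
    then have "dle 0 (mB m - ?A + pdiv z)" using LL_iff[OF D] by blast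
    have le: "dle (A - pdiv z) (mB m)"
      unfolding dle_def
    proof
      fix P
      have "0 \<le> mult_at (mB m - ?A + pdiv z) P" "mult_at A P \<le> mult_at ?A P"
        using \<open>dle 0 (mB m - ?A + pdiv z)\<close> dle_pos_part(1)[of A] by (auto simp: dle_def)
      then show "mult_at (A - pdiv z) P \<le> mult_at (mB m) P" by (simp add: lookup_add lookup_minus)
    qed
    have Az: "A - pdiv z \<in> Divs" using A pdiv_Divs[OF z(2)] by (simp add: Divs_closed)
    have "int (l (mB m)) \<le> int (l (A - pdiv z)) + (ddeg (mB m) - ddeg (A - pdiv z))"
      using le mB Az by (intro l_le) auto
    moreover have "l (A - pdiv z) = l A" using l_shift[OF z(2) Az] by simp
    moreover have "ddeg (A - pdiv z) = ddeg A" using ddeg_pdiv[OF z(2)] by (simp add: ddeg_diff)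
    ultimately show ?thesis using lmB[of m] mB(2)[of m] by simp
  qed
  then show ?thesis by blast
qed

text \<open>By \<open>l_lower_bound\<close> the quantity \<open>ddeg - l\<close> is bounded and
  attains its maximum at some \<open>A0\<close>. A divisor of large degree is equivalent to one
  above \<open>A0\<close>, so monotonicity gives it the same value. The constant
  \<open>\<gamma>\<close> is the genus minus 1.\<close>

theorem riemann: "\<exists>\<gamma> n1. \<forall>A\<in>Divs. ddeg A \<ge> n1 \<longrightarrow> int (l A) = ddeg A - \<gamma>"
proof -
  obtain c where c: "\<And>A. A \<in> Divs \<Longrightarrow> ddeg A - c \<le> int (l A)" using l_lower_bound by blast
  \<comment> \<open>The truncation by \<open>nat\<close> turns a maximum over integers into a
    minimum over natural numbers; \<open>c\<close> bounds the quantity, so no information is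
    lost.\<close>
  define f where "f A = nat (c - (ddeg A - int (l A)))" for A
  obtain A0 where A0: "A0 \<in> Divs" "\<And>A. A \<in> Divs \<Longrightarrow> f A0 \<le> f A"
    using ex_has_least_nat[of "\<lambda>A. A \<in> Divs" 0 f] Divs_closed(1) by blast
  let ?g = "ddeg A0 - int (l A0)"
  have max: "ddeg A - int (l A) \<le> ?g" if "A \<in> Divs" for A
    using A0(2)[OF that] c[OF that] c[OF A0(1)] by (simp add: f_def)
  have "int (l A) = ddeg A - ?g" if A: "A \<in> Divs" "ddeg A \<ge> ddeg A0 + c + 1" for A
  proof -
    have D: "A - A0 \<in> Divs" using A A0 by (simp add: Divs_closed)
    have "l (A - A0) > 0" using c[OF D] A(2) by (simp add: ddeg_diff)
    then obtain z where z: "z \<in> LL (A - A0)" "z \<noteq> 0" using ex_LL_nonzero[OF D] by blast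
    have Az: "A + pdiv z \<in> Divs" using A pdiv_Divs[OF z(2)] by (simp add: Divs_closed)
    have "dle 0 (A - A0 + pdiv z)" using z LL_iff[OF D] by blast
    then have "dle A0 (A + pdiv z)" by (auto simp: dle_def lookup_add lookup_minus algebra_simps)
    then have "int (l (A + pdiv z)) \<le> int (l A0) + (ddeg (A + pdiv z) - ddeg A0)"
      using A0 Az by (intro l_le) auto
    then have "int (l A) \<le> int (l A0) + (ddeg A - ddeg A0)"
      using l_shift[OF z(2) A(1)] ddeg_pdiv[OF z(2)] by (simp add: ddeg_add)
    then show ?thesis using max[OF A(1)] by simp
  qed
  then show ?thesis by blast
qed

subsection \<open>Counting effective divisors\<close>

definition Eff :: "nat \<Rightarrow> 'a divisor set"
  where "Eff n = {D \<in> Divs. dle 0 D \<and> ddeg D = int n}"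

lemma finite_places_of_degree_le: "finite {P \<in> places. pdeg P \<le> n}"
proof -
  have "{P \<in> places. pdeg P \<le> n} = (\<Union>i\<le>n. {P \<in> places. pdeg P = i})" by auto
  then show ?thesis using finite_places_of_degree by simp
qed

lemma EffD:
  assumes D: "D \<in> Eff n" and P: "mult_at D P \<noteq> 0"
  shows "P \<in> places" "pdeg P \<le> n" "0 \<le> mult_at D P" "mult_at D P \<le> int n"
proof -
  have *: "D \<in> Divs" "dle 0 D" "ddeg D = int n" using D by (auto simp: Eff_def)
  show Pp: "P \<in> places" using DivsD[OF *(1) P] .
  show nn: "0 \<le> mult_at D P" using * by (auto simp: dle_def)
  have "dle (Poly_Mapping.single P (mult_at D P)) D"
    using * by (auto simp: dle_def lookup_single when_def)
  then have le: "mult_at D P * int (pdeg P) \<le> int n" using ddeg_mono * by (force simp: ddeg_single)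
  have "1 * int (pdeg P) \<le> mult_at D P * int (pdeg P)" using nn P by (intro mult_right_mono) auto
  then show "pdeg P \<le> n" using le by linarith
  have "mult_at D P * 1 \<le> mult_at D P * int (pdeg P)" using nn pdeg_pos[OF Pp] by (intro mult_left_mono) auto
  then show "mult_at D P \<le> int n" using le by linarith
qed

lemma finite_Eff: "finite (Eff n)"
proof -
  let ?S = "{P \<in> places. pdeg P \<le> n}"
  let ?f = "\<lambda>D. restrict (mult_at D) ?S"
  have "?f ` Eff n \<subseteq> ?S \<rightarrow>\<^sub>E {0..int n}"
  proof (intro image_subsetI PiE_I)
    fix D P assume D: "D \<in> Eff n" and P: "P \<in> ?S"
    show "?f D P \<in> {0..int n}" using EffD(3,4)[OF D, of P] P by (cases "mult_at D P = 0") auto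
  qed auto
  moreover have "inj_on ?f (Eff n)"
  proof (rule inj_onI)
    fix D D' assume D: "D \<in> Eff n" "D' \<in> Eff n" "?f D = ?f D'"
    show "D = D'"
    proof (rule poly_mapping_eqI)
      fix P
      show "mult_at D P = mult_at D' P"
      proof (cases "P \<in> ?S")
        case True
        then show ?thesis using fun_cong[OF D(3), of P] by simp
      next
        case False
        then show ?thesis using EffD(1,2)[OF D(1), of P] EffD(1,2)[OF D(2), of P] by force
      qed
    qed
  qed
  ultimately show ?thesis
    using finite_places_of_degree_le finite_imageD finite_subset by (metis (no_types, lifting) finite_PiE finite_atLeastAtMost_int)
qed

lemma pdiv_eq_iff:
  assumes "z \<noteq> 0" "w \<noteq> 0"
  shows "pdiv z = pdiv w \<longleftrightarrow> z / w \<in> k"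
proof
  assume "pdiv z = pdiv w"
  then have "pdiv (z / w) = 0" using assms pdiv_mult[of z "inverse w"] pdiv_inverse[of w] by (simp add: divide_inverse)
  then have "z / w \<in> LL 0" using assms LL_iff[OF Divs_closed(1), of "z / w"] by (simp add: dle_def)
  then show "z / w \<in> k" by (simp add: LL_0)
next
  assume "z / w \<in> k"
  then have "v P (z / w) = 0" if "P \<in> places" for P using v_const[OF that] assms by simp
  then show "pdiv z = pdiv w"
    using assms by (intro poly_mapping_eqI) (auto simp: lookup_pdiv v_divide)
qed

definition lin_equiv :: "'a divisor \<Rightarrow> 'a divisor \<Rightarrow> bool"
  where "lin_equiv D D' \<longleftrightarrow> (\<exists>z. z \<noteq> 0 \<and> D' = D + pdiv z)"

lemma lin_equiv_shift: "lin_equiv (D + A) D' \<longleftrightarrow> lin_equiv (D' - A) D"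
proof -
  have "lin_equiv (D + A) D'" if eq: "lin_equiv (D' - A) D" for D A D'
  proof -
    obtain z where z: "z \<noteq> 0" "D = D' - A + pdiv z" using eq by (auto simp: lin_equiv_def)
    then have "D' = D + A + pdiv (inverse z)" by (simp add: pdiv_inverse)
    then show ?thesis unfolding lin_equiv_def using z(1) by (intro exI[of _ "inverse z"]) simp
  qed
  from this[of D' A D] this[of D "- A" D'] this[of D' "- A" D] show ?thesis by auto
qed

text \<open>A divisor \<open>D + pdiv z\<close> determines \<open>z\<close> up to a nonzero
  constant, so the linear system is a projective space over \<open>k\<close>.\<close>

lemma card_linear_system:
  assumes D: "D \<in> Divs" "ddeg D = int n"
  shows "card {E \<in> Eff n. lin_equiv D E} * (card k - 1) = card k ^ l D - 1"
proof -
  let ?g = "\<lambda>z. D + pdiv z"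
  let ?A = "LL D - {0}"
  have img: "?g ` ?A = {E \<in> Eff n. lin_equiv D E}"
    using D LL_iff[OF D(1)] by (auto simp: Eff_def lin_equiv_def Divs_closed pdiv_Divs ddeg_add ddeg_pdiv)
  have finA: "finite ?A" using finite_LL[OF D(1)] by simp
  have fiber: "card {w \<in> ?A. ?g w = ?g z} = card k - 1" if z: "z \<in> ?A" for z
  proof -
    have "{w \<in> ?A. ?g w = ?g z} = (\<lambda>c. c * z) ` (k - {0})"
    proof (intro equalityI subsetI)
      fix w assume "w \<in> {w \<in> ?A. ?g w = ?g z}"
      then have "w \<noteq> 0" "w / z \<in> k" using z pdiv_eq_iff[of w z] by auto
      then show "w \<in> (\<lambda>c. c * z) ` (k - {0})" using z by (intro image_eqI[of _ _ "w / z"]) auto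
    next
      fix w assume "w \<in> (\<lambda>c. c * z) ` (k - {0})"
      then obtain c where c: "c \<in> k" "c \<noteq> 0" "w = c * z" by auto
      then have "w \<in> LL D" using ksub_LL[of D] z by (auto simp: ksub_def)
      then show "w \<in> {w \<in> ?A. ?g w = ?g z}" using c z pdiv_eq_iff[of w z] by auto
    qed
    also have "card \<dots> = card (k - {0})" using z by (intro card_image) (auto simp: inj_on_def)
    also have "\<dots> = card k - 1" using k_0 finite_k by simp
    finally show ?thesis .
  qed
  have "card ?A = (\<Sum>E\<in>?g ` ?A. card {w \<in> ?A. ?g w = E})"
    using sum.image_gen[OF finA, of "\<lambda>_. 1::nat" ?g] by simp
  also have "\<dots> = (\<Sum>E\<in>?g ` ?A. card k - 1)"
  proof (rule sum.cong[OF refl])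
    fix E assume "E \<in> ?g ` ?A"
    then obtain z where "z \<in> ?A" "E = ?g z" by blast
    then show "card {w \<in> ?A. ?g w = E} = card k - 1" using fiber[of z] by (simp only:)
  qed
  also have "\<dots> = card {E \<in> Eff n. lin_equiv D E} * (card k - 1)" using img by simp
  finally show ?thesis using card_LL[OF D(1)] LL_zero finite_LL[OF D(1)] by simp
qed

text \<open>Count the pairs \<open>(E, E')\<close> of effective divisors of degrees \<open>n\<close>, \<open>n'\<close> with \<open>E'\<close> linearly equivalent
  to \<open>E + A\<close> in two ways.\<close>

lemma card_Eff_ratio:
  assumes r: "\<And>A. A \<in> Divs \<Longrightarrow> ddeg A \<ge> n1 \<Longrightarrow> int (l A) = ddeg A - \<gamma>"
    and n: "int n \<ge> n1" "int n' \<ge> n1" and A: "A \<in> Divs" "ddeg A = int n' - int n"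
  shows "card (Eff n) * (card k ^ nat (int n' - \<gamma>) - 1) = card (Eff n') * (card k ^ nat (int n - \<gamma>) - 1)"
proof -
  have 1: "card {E' \<in> Eff n'. lin_equiv (E + A) E'} * (card k - 1) = card k ^ nat (int n' - \<gamma>) - 1"
    if "E \<in> Eff n" for E
  proof -
    have D: "E + A \<in> Divs" "ddeg (E + A) = int n'" using that A by (auto simp: Eff_def Divs_closed ddeg_add)
    then have "l (E + A) = nat (int n' - \<gamma>)" using r[OF D(1)] n by simp
    then show ?thesis using card_linear_system[OF D] by simp
  qed
  have 2: "card {E \<in> Eff n. lin_equiv (E' - A) E} * (card k - 1) = card k ^ nat (int n - \<gamma>) - 1"
    if "E' \<in> Eff n'" for E'
  proof -
    have D: "E' - A \<in> Divs" "ddeg (E' - A) = int n" using that A by (auto simp: Eff_def Divs_closed ddeg_diff)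
    then have "l (E' - A) = nat (int n - \<gamma>)" using r[OF D(1)] n by simp
    then show ?thesis using card_linear_system[OF D] by simp
  qed
  have "card (Eff n) * (card k ^ nat (int n' - \<gamma>) - 1) = (\<Sum>E\<in>Eff n. card {E' \<in> Eff n'. lin_equiv (E + A) E'} * (card k - 1))"
    using 1 by simp
  also have "\<dots> = (\<Sum>E\<in>Eff n. \<Sum>E'\<in>Eff n'. if lin_equiv (E + A) E' then 1 else 0) * (card k - 1)"
    unfolding sum_distrib_right[symmetric] by (simp add: finite_Eff flip: sum.inter_filter)
  also have "(\<Sum>E\<in>Eff n. \<Sum>E'\<in>Eff n'. if lin_equiv (E + A) E' then 1 else (0::nat)) =
      (\<Sum>E'\<in>Eff n'. \<Sum>E\<in>Eff n. if lin_equiv (E' - A) E then 1 else 0)"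
    by (subst sum.swap) (simp add: lin_equiv_shift)
  also have "\<dots> * (card k - 1) = (\<Sum>E'\<in>Eff n'. card {E \<in> Eff n. lin_equiv (E' - A) E} * (card k - 1))"
    unfolding sum_distrib_right[symmetric] by (simp add: finite_Eff flip: sum.inter_filter)
  also have "\<dots> = card (Eff n') * (card k ^ nat (int n - \<gamma>) - 1)" using 2 by simp
  finally show ?thesis .
qed

text \<open>Comparing every degree with one fixed degree \<open>n\<close> by
  \<open>card_Eff_ratio\<close> gives the count in closed form,
  \<open>\<kappa> * (q ^ (n' - \<gamma>) - 1)\<close> with \<open>q = card k\<close>. Thus
  \<open>\<alpha> = \<kappa> * q powi (- \<gamma>)\<close> and
  \<open>\<beta> = \<kappa>\<close>.\<close>

theorem card_Eff_asymptotics: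
  "\<exists>d \<alpha> \<beta> n0. d > 0 \<and> \<alpha> > 0 \<and> (\<forall>D\<in>Divs. int d dvd ddeg D) \<and>
     (\<forall>n\<ge>n0. d dvd n \<longrightarrow> real (card (Eff n)) = \<alpha> * real (card k) ^ n - \<beta>)"
proof -
  define S where "S = ddeg ` Divs"
  have S: "add_subgroup S"
    unfolding add_subgroup_def
  proof (intro conjI ballI)
    show "0 \<in> S" unfolding S_def using Divs_closed(1) by (intro image_eqI[of _ _ 0]) auto
    fix a b assume "a \<in> S" "b \<in> S"
    then obtain A B where "A \<in> Divs" "B \<in> Divs" "a = ddeg A" "b = ddeg B" by (auto simp: S_def)
    then show "a - b \<in> S" unfolding S_def by (intro image_eqI[of _ _ "A - B"]) (auto simp: ddeg_diff Divs_closed)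
  qed
  define d where "d = (LEAST e. e > 0 \<and> int e \<in> S)"
  obtain P where P: "P \<in> places" using ex_pole[OF x_notin_k] by blast
  have "int (pdeg P) \<in> S"
    unfolding S_def using P by (intro image_eqI[of _ _ "Poly_Mapping.single P 1"]) (auto simp: ddeg_single Divs_closed)
  then have "\<exists>e. e > 0 \<and> int e \<in> S" using pdeg_pos[OF P] by blast
  then have d: "d > 0 \<and> int d \<in> S" unfolding d_def by (rule LeastI_ex)
  have dvd: "int d dvd i" if "i \<in> S" for i
    using int_subgroup_generator[OF S, of d i] d that Least_le[of "\<lambda>e. e > 0 \<and> int e \<in> S"] by (auto simp: d_def)
  obtain \<gamma> n1 where r: "\<And>A. A \<in> Divs \<Longrightarrow> ddeg A \<ge> n1 \<Longrightarrow> int (l A) = ddeg A - \<gamma>"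
    using riemann by blast
  let ?q = "card k"
  \<comment> \<open>A multiple of \<open>d\<close> that lies in the range of Riemann's theorem and
    exceeds \<open>\<gamma>\<close>, so that linear systems of this degree are nonempty.\<close>
  define n where "n = d * nat (\<bar>n1\<bar> + \<bar>\<gamma>\<bar> + 1)"
  have "1 * nat (\<bar>n1\<bar> + \<bar>\<gamma>\<bar> + 1) \<le> n" unfolding n_def using d by (intro mult_right_mono) auto
  then have n: "int n \<ge> n1" "int n - \<gamma> \<ge> 1" by auto
  have ex: "\<exists>A\<in>Divs. ddeg A = m * int d" for m using int_subgroup_mult[OF S, of "int d" m] d by (auto simp: S_def)
  \<comment> \<open>This is the number of divisor classes of degree \<open>n\<close> over
    \<open>card k - 1\<close>. Existence of an effective divisor of degree \<open>n\<close> makes it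
    positive.\<close>
  define \<kappa> where "\<kappa> = real (card (Eff n)) / (real ?q ^ nat (int n - \<gamma>) - 1)"
  have q1: "real ?q > 1" using card_k_ge_2 by simp
  have pos: "real ?q ^ nat (int n - \<gamma>) - 1 > 0" using q1 n(2) by simp
  have "card (Eff n) > 0"
  proof -
    obtain D where D: "D \<in> Divs" "ddeg D = int n" using ex[of "int (nat (\<bar>n1\<bar> + \<bar>\<gamma>\<bar> + 1))"] by (auto simp: n_def mult.commute)
    have "int (l D) = int n - \<gamma>" using r[OF D(1)] D(2) n(1) by simp
    then have "l D \<noteq> 0" using n(2) by linarith
    then have "?q ^ l D > 1" using card_k_ge_2 by (intro one_less_power) auto
    then have "card {E \<in> Eff n. lin_equiv D E} \<noteq> 0" using card_linear_system[OF D] by (intro notI) simp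
    then have "{E \<in> Eff n. lin_equiv D E} \<noteq> {}" by (metis card.empty)
    then show ?thesis using finite_Eff[of n] by (auto simp: card_gt_0_iff)
  qed
  then have \<kappa>: "\<kappa> > 0" using pos by (simp add: \<kappa>_def)
  have main: "real (card (Eff n')) = \<kappa> * real ?q powi (- \<gamma>) * real ?q ^ n' - \<kappa>"
    if n': "n' \<ge> nat (max n1 \<gamma>)" "d dvd n'" for n'
  proof -
    have n'': "int n' \<ge> n1" "int n' \<ge> \<gamma>" using n' by auto
    obtain m where m: "n' = d * m" using n'(2) by auto
    obtain A where A: "A \<in> Divs" "ddeg A = int n' - int n"
      using ex[of "int m - int (nat (\<bar>n1\<bar> + \<bar>\<gamma>\<bar> + 1))"] by (auto simp: m n_def algebra_simps)
    have "card (Eff n) * (?q ^ nat (int n' - \<gamma>) - 1) = card (Eff n') * (?q ^ nat (int n - \<gamma>) - 1)"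
      using card_Eff_ratio[OF r n(1) n''(1) A] .
    then have "real (card (Eff n) * (?q ^ nat (int n' - \<gamma>) - 1)) = real (card (Eff n') * (?q ^ nat (int n - \<gamma>) - 1))"
      by (simp only:)
    moreover have "real (?q ^ m - 1) = real ?q ^ m - 1" for m
      using card_k_ge_2 by (subst of_nat_diff) (auto intro: one_le_power)
    ultimately have "real (card (Eff n)) * (real ?q ^ nat (int n' - \<gamma>) - 1) = real (card (Eff n')) * (real ?q ^ nat (int n - \<gamma>) - 1)"
      by (simp only: of_nat_mult)
    then have "real (card (Eff n')) = \<kappa> * (real ?q ^ nat (int n' - \<gamma>) - 1)"
      using pos by (simp add: \<kappa>_def field_simps)
    also have "real ?q ^ nat (int n' - \<gamma>) = real ?q powi (int n' - \<gamma>)" using n'' by (simp add: power_int_def)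
    also have "\<dots> = real ?q powi (- \<gamma>) * real ?q ^ n'" using q1 by (simp add: power_int_diff power_int_minus field_simps)
    finally show ?thesis by (simp add: algebra_simps)
  qed
  have "\<kappa> * real ?q powi (- \<gamma>) > 0" using \<kappa> q1 by (intro mult_pos_pos zero_less_power_int) auto
  then show ?thesis
    using d dvd main unfolding S_def by blast
qed

end

subsection \<open>Global function fields\<close>

lemma field_fld: "field (fld :: 'a::field ring)"
  by (rule field_from_type_algebra)

lemma fld_simps [simp]:
  "carrier (fld :: 'a::field ring) = UNIV" "\<one>\<^bsub>fld :: 'a ring\<^esub> = 1" "\<zero>\<^bsub>fld :: 'a ring\<^esub> = 0"
  "(a::'a) \<otimes>\<^bsub>fld\<^esub> b = a * b" "a \<oplus>\<^bsub>fld\<^esub> b = a + b"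
  by (auto simp: ring_of_type_algebra_def)

lemma fld_a_inv [simp]: "\<ominus>\<^bsub>fld\<^esub> (a::'a::field) = - a"
proof -
  interpret field "fld :: 'a ring" by (rule field_fld)
  show ?thesis by (rule minus_equality) auto
qed

lemma fld_m_inv: "a \<noteq> 0 \<Longrightarrow> inv\<^bsub>fld\<^esub> (a::'a::field) = inverse a"
proof -
  assume a: "a \<noteq> 0"
  interpret field "fld :: 'a ring" by (rule field_fld)
  show ?thesis using a by (intro comm_inv_char) auto
qed

lemma fld_pow [simp]: "(a::'a::field) [^]\<^bsub>fld\<^esub> (n::nat) = a ^ n"
proof -
  interpret field "fld :: 'a ring" by (rule field_fld)
  show ?thesis by (induction n) (auto simp: nat_pow_Suc mult.commute)
qed

lemma subfield_prime_subfield: "subfield (prime_subfield :: 'a::field set) fld"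
proof -
  interpret field "fld :: 'a ring" by (rule field_fld)
  show ?thesis unfolding prime_subfield_def by (rule generate_field_is_subfield) auto
qed

lemma subfield_constant_field: "subfield (constant_field :: 'a::field set) fld"
proof -
  interpret field "fld :: 'a ring" by (rule field_fld)
  have "{x \<in> carrier fld. (algebraic over (prime_subfield :: 'a set)) x} = constant_field"
    by (auto simp: constant_field_def over_def)
  then show ?thesis using subfield_of_algebraics[OF subfield_prime_subfield] by simp
qed

text \<open>\<open>transcendental\<close> means that evaluation at \<open>y\<close> is injective on
  polynomials; equal powers of \<open>y\<close> refute this for two monomials over the prime
  field.\<close>

lemma root_in_constant_field:
  fixes y :: "'a::field"
  assumes "m < l" "y ^ m = y ^ l"
  shows "y \<in> constant_field"
proof -
  interpret field "fld :: 'a ring" by (rule field_fld)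
  let ?K = "prime_subfield :: 'a set"
  have sr: "subring ?K fld" using subfieldE(1)[OF subfield_prime_subfield] .
  have one: "1 \<in> ?K" using subringE(3)[OF sr] by simp
  have ev0: "eval (replicate n 0) y = 0" for n by (induction n) auto
  have ev: "eval (monom 1 n) y = y ^ n" for n by (simp add: monom_def ev0)
  have car: "monom 1 n \<in> carrier (?K [X]\<^bsub>fld\<^esub>)" for n
    using monom_is_polynomial[OF sr, of 1 n] one by (simp add: univ_poly_def)
  have "(monom 1 m :: 'a list) \<noteq> monom 1 l" using assms(1) by (auto simp: monom_def dest: arg_cong[of _ _ length])
  moreover have "eval (monom 1 m) y = eval (monom 1 l) y" using assms(2) by (simp add: ev)
  ultimately have "\<not> inj_on (\<lambda>p. eval p y) (carrier (?K [X]\<^bsub>fld\<^esub>))"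
    using car unfolding inj_on_def by blast
  then show ?thesis by (simp add: constant_field_def transcendental_def)
qed

lemma finite_subfield_constant_field:
  assumes "finite (constant_field :: 'a::field set)"
  shows "finite_subfield (constant_field :: 'a set)"
proof -
  interpret field "fld :: 'a ring" by (rule field_fld)
  note sf = subfield_constant_field[where 'a = 'a]
  note sr = subringE[OF subfieldE(1)[OF sf]]
  show ?thesis
  proof
    show "finite (constant_field :: 'a set)" by fact
    show "1 \<in> (constant_field :: 'a set)" using sr(3) by simp
    fix a b :: 'a assume a: "a \<in> constant_field"
    show "inverse a \<in> constant_field"
    proof (cases "a = 0")
      case False
      then show ?thesis using subfield_m_inv(1)[OF sf, of a] a by (simp add: fld_m_inv)
    qed (use a in simp)
    assume b: "b \<in> constant_field"
    show "a * b \<in> constant_field" using sr(6)[OF a b] by simp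
    show "a - b \<in> constant_field" using sr(7)[OF a sr(5)[OF b]] by simp
  qed
qed

lemma (in finite_subfield) ratioI:
  assumes "f \<in> kpoly" "g \<in> kpoly" "poly g x \<noteq> 0" "z = poly f x / poly g x"
  shows "\<exists>f\<in>kpoly. \<exists>g\<in>kpoly. poly g x \<noteq> 0 \<and> z = poly f x / poly g x"
  using assms by blast

lemma (in finite_subfield) generate_field_ratio:
  assumes "z \<in> generate_field fld {x}"
  shows "\<exists>f\<in>kpoly. \<exists>g\<in>kpoly. poly g x \<noteq> 0 \<and> z = poly f x / poly g x"
  using assms
proof (induction rule: generate_field.induct)
  case one
  then show ?case using kpoly_1 by (intro ratioI[of 1 1]) auto
next
  case (incl h)
  then show ?case using kpoly_1 polys_over_X[OF k_subring] by (intro ratioI[of "[:0, 1:]" 1]) auto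
next
  case (a_inv h)
  then obtain f g where "f \<in> kpoly" "g \<in> kpoly" "poly g x \<noteq> 0" "h = poly f x / poly g x" by blast
  moreover have "0 - f \<in> kpoly" using calculation by (intro polys_over_diff k_subring kpoly_0)
  ultimately show ?case by (intro ratioI[of "0 - f" g]) auto
next
  case (m_inv h)
  then obtain f g where *: "f \<in> kpoly" "g \<in> kpoly" "poly g x \<noteq> 0" "h = poly f x / poly g x" by blast
  moreover have "poly f x \<noteq> 0" using * m_inv.hyps(2) by auto
  ultimately show ?case using m_inv.hyps(2) by (intro ratioI[of g f]) (auto simp: fld_m_inv)
next
  case (eng_add h1 h2)
  then obtain f g f' g' where *: "f \<in> kpoly" "g \<in> kpoly" "poly g x \<noteq> 0" "h1 = poly f x / poly g x"
    "f' \<in> kpoly" "g' \<in> kpoly" "poly g' x \<noteq> 0" "h2 = poly f' x / poly g' x" by blast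
  then show ?case
    by (intro ratioI[of "f * g' + f' * g" "g * g'"]) (auto simp: kpoly_add kpoly_mult add_frac_eq)
next
  case (eng_mult h1 h2)
  then obtain f g f' g' where *: "f \<in> kpoly" "g \<in> kpoly" "poly g x \<noteq> 0" "h1 = poly f x / poly g x"
    "f' \<in> kpoly" "g' \<in> kpoly" "poly g' x \<noteq> 0" "h2 = poly f' x / poly g' x" by blast
  then show ?case
    by (intro ratioI[of "f * f'" "g * g'"]) (auto simp: kpoly_mult)
qed

lemma dimension_spanning:
  assumes "ring.dimension fld n K (E :: 'a::field set)"
  shows "\<exists>w. \<forall>y\<in>E. \<exists>c. (\<forall>i<n. c i \<in> K) \<and> y = (\<Sum>i<n. c i * w i)"
proof -
  interpret field "fld :: 'a ring" by (rule field_fld)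
  show ?thesis using assms
  proof (induction rule: dimension.induct)
    case (zero_dim K)
    then show ?case by simp
  next
    case (Suc_dim v E n K)
    then obtain w where w: "\<And>y. y \<in> E \<Longrightarrow> \<exists>c. (\<forall>i<n. c i \<in> K) \<and> y = (\<Sum>i<n. c i * w i)" by blast
    show ?case
    proof (rule exI[of _ "w(n := v)"], rule ballI)
      fix y assume "y \<in> line_extension K v E"
      then obtain a u where au: "a \<in> K" "u \<in> E" "y = a * v + u"
        by (auto simp: line_extension_def set_add_def' r_coset_def)
      obtain c where c: "\<forall>i<n. c i \<in> K" "u = (\<Sum>i<n. c i * w i)" using w[OF au(2)] by blast
      have "(\<Sum>i<n. (c(n := a)) i * (w(n := v)) i) = (\<Sum>i<n. c i * w i)" by (intro sum.cong) auto
      then show "\<exists>c. (\<forall>i<Suc n. c i \<in> K) \<and> y = (\<Sum>i<Suc n. c i * (w(n := v)) i)"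
        using c au by (intro exI[of _ "c(n := a)"]) (auto simp: less_Suc_eq)
    qed
  qed
qed

lemma (in finite_subfield) common_denominator:
  fixes n :: nat
  assumes "\<And>i. i < n \<Longrightarrow> c i \<in> generate_field fld {x}"
  shows "\<exists>h\<in>kpoly. \<exists>f. poly h x \<noteq> 0 \<and> (\<forall>i<n. f i \<in> kpoly \<and> poly h x * c i = poly (f i) x)"
  using assms
proof (induction n)
  case 0
  then show ?case using kpoly_1 by (intro bexI[of _ 1]) auto
next
  case (Suc n)
  then obtain h f where h: "h \<in> kpoly" "poly h x \<noteq> 0" "\<And>i. i < n \<Longrightarrow> f i \<in> kpoly \<and> poly h x * c i = poly (f i) x"
    by auto
  obtain a g where ag: "a \<in> kpoly" "g \<in> kpoly" "poly g x \<noteq> 0" "c n = poly a x / poly g x"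
    using generate_field_ratio[OF Suc.prems[of n]] by auto
  let ?f = "\<lambda>i. if i = n then h * a else g * f i"
  have "?f i \<in> kpoly \<and> poly (h * g) x * c i = poly (?f i) x" if "i < Suc n" for i
    using h ag h(3)[of i] that by (cases "i = n") (auto simp: kpoly_mult)
  then show ?case using h ag
    by (intro bexI[of _ "h * g"] exI[of _ ?f]) (auto simp: kpoly_mult)
qed

theorem global_function_field_imp_function_field:
  assumes "global_function_field p q TYPE('a::field)"
  shows "\<exists>(x::'a) W. function_field constant_field x W"
    and "card (constant_field :: 'a set) = q"
proof -
  interpret field "fld :: 'a ring" by (rule field_fld)
  show q: "card (constant_field :: 'a set) = q" using assms by (simp add: global_function_field_def)
  have "q > 0" using assms by (auto simp: global_function_field_def prime_gt_0_nat)
  then have fin: "finite (constant_field :: 'a set)" using q card_ge_0_finite by blast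
  interpret finite_subfield "constant_field :: 'a set" by (rule finite_subfield_constant_field[OF fin])
  obtain x :: 'a where x: "transcendental prime_subfield x" "finite_dimension (generate_field fld {x}) (UNIV :: 'a set)"
    using assms by (auto simp: global_function_field_def)
  obtain n where "dimension n (generate_field fld {x}) (UNIV :: 'a set)" using x(2) by (auto simp: finite_dimension_def)
  then obtain w where w: "\<And>y. \<exists>c. (\<forall>i<n. c i \<in> generate_field fld {x}) \<and> y = (\<Sum>i<n. c i * w i)"
    using dimension_spanning by blast
  have span: "\<exists>h f. h \<in> kpoly \<and> poly h x \<noteq> 0 \<and> (\<forall>u\<in>w ` {..<n}. f u \<in> kpoly) \<and>
      poly h x * y = (\<Sum>u\<in>w ` {..<n}. poly (f u) x * u)" for y
  proof -
    obtain c where c: "\<And>i. i < n \<Longrightarrow> c i \<in> generate_field fld {x}" "y = (\<Sum>i<n. c i * w i)" using w by blast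
    obtain h f where h: "h \<in> kpoly" "poly h x \<noteq> 0" "\<And>i. i < n \<Longrightarrow> f i \<in> kpoly \<and> poly h x * c i = poly (f i) x"
      using common_denominator[where c = c and n = n, OF c(1)] by auto
    \<comment> \<open>The generators \<open>w i\<close> need not be distinct, so coefficients
      belonging to the same value are added up.\<close>
    let ?F = "\<lambda>u. \<Sum>i\<in>{i\<in>{..<n}. w i = u}. f i"
    have "poly h x * y = (\<Sum>i<n. poly (f i) x * w i)"
      unfolding c(2) sum_distrib_left using h(3) by (intro sum.cong) (auto simp flip: mult.assoc)
    also have "\<dots> = (\<Sum>u\<in>w ` {..<n}. \<Sum>i\<in>{i\<in>{..<n}. w i = u}. poly (f i) x * w i)"
      by (rule sum.image_gen) simp
    also have "\<dots> = (\<Sum>u\<in>w ` {..<n}. poly (?F u) x * u)"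
      by (intro sum.cong) (auto simp: poly_sum sum_distrib_right)
    finally show ?thesis
      using h by (intro exI[of _ h] exI[of _ ?F]) (auto intro!: polys_over_sum k_subring)
  qed
  have "x \<notin> constant_field" using x by (simp add: constant_field_def)
  then have "function_field constant_field x (w ` {..<n})"
    by unfold_locales (use span root_in_constant_field in auto)
  then show "\<exists>(x::'a) W. function_field constant_field x W" by blast
qed

section \<open>Prime divisors and the places constructed above\<close>

lemma subring_set_iff: "subring_set (P :: 'a::field set) \<longleftrightarrow> subring P fld"
proof -
  interpret field "fld :: 'a ring" by (rule field_fld)
  show ?thesis
  proof
    assume "subring_set P"
    then show "subring P fld" by (intro subringI) (auto dest: subring_setD)
  next
    assume P: "subring P fld"
    have "a - b \<in> P" if "a \<in> P" "b \<in> P" for a b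
      using subringE(7)[OF P, of a "- b"] subringE(5)[OF P, of b] that by simp
    then show "subring_set P" using subringE(3,6)[OF P] by (auto simp: subring_set_def)
  qed
qed

lemma pd_ring_simps [simp]:
  "carrier (pd_ring P) = (P :: 'a::field set)" "\<one>\<^bsub>pd_ring P\<^esub> = 1" "\<zero>\<^bsub>pd_ring P\<^esub> = 0"
  "(a::'a) \<otimes>\<^bsub>pd_ring P\<^esub> b = a * b" "a \<oplus>\<^bsub>pd_ring P\<^esub> b = a + b"
  by (auto simp: pd_ring_def)

lemma Units_pd_ring: "subring_set (P :: 'a::field set) \<Longrightarrow> Units (pd_ring P) = {u \<in> P. u \<noteq> 0 \<and> inverse u \<in> P}"
proof -
  have "inverse u = y" if "u * y = 1" for u y :: 'a using inverse_unique that by blast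
  then show ?thesis unfolding Units_def
    by (force simp: mult.commute intro: bexI[of _ "inverse _"])
qed

lemma domain_pd_ring:
  assumes "subring_set (P :: 'a::field set)"
  shows "domain (pd_ring P)"
proof -
  interpret field "fld :: 'a ring" by (rule field_fld)
  show ?thesis using subring_is_domain[of P] assms by (simp add: pd_ring_def subring_set_iff)
qed

lemma PIdl_pd_ring: "PIdl\<^bsub>pd_ring P\<^esub> a = (\<lambda>y. y * a) ` (P :: 'a::field set)"
  by (auto simp: cgenideal_def)

context dvr
begin

lemma vge_1_eq: "{z. vge 1 z} = (\<lambda>y. y * t) ` P"
proof (intro equalityI subsetI)
  fix z assume "z \<in> {z. vge 1 z}"
  then have "z * inverse t \<in> P" by (simp add: vge_iff_mem power_int_minus)
  then show "z \<in> (\<lambda>y. y * t) ` P" using t_nz by (intro image_eqI[of _ _ "z * inverse t"]) auto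
next
  fix z assume "z \<in> (\<lambda>y. y * t) ` P"
  then show "z \<in> {z. vge 1 z}" using t_nz by (auto simp: vge_iff_mem power_int_minus mult.assoc)
qed

lemma one_not_vge_1: "\<not> vge 1 1" by (simp add: vge_def val_1)

lemma unit_iff: "a \<in> P \<Longrightarrow> unit a \<longleftrightarrow> \<not> vge 1 a"
proof (cases "a = 0")
  case False
  assume a: "a \<in> P"
  then have "val a \<ge> 0" using False mem_iff_val by simp
  moreover have "inverse a \<in> P \<longleftrightarrow> val a \<le> 0" using False mem_iff_val[of "inverse a"] val_inverse[OF False] by simp
  ultimately show ?thesis using a False by (auto simp: unit_def vge_def)
qed (auto simp: unit_def)

lemma ideal_with_unit:
  assumes J: "ideal J (pd_ring P)" and a: "a \<in> J" "unit a"
  shows "J = P"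
proof -
  interpret J: ideal J "pd_ring P" by (rule J)
  have "y \<in> J" if "y \<in> P" for y
  proof -
    have "(y * inverse a) \<otimes>\<^bsub>pd_ring P\<^esub> a \<in> J"
      using that a by (intro J.I_l_closed) (auto simp: unit_def P_ring)
    then show ?thesis using a by (simp add: unit_def mult.assoc)
  qed
  then show ?thesis using J.a_subset by auto
qed

text \<open>A nonzero element of least valuation generates the ideal, because dividing by it keeps
  the valuation nonnegative.\<close>

lemma principal_domain_pd_ring: "principal_domain (pd_ring P)"
proof -
  interpret domain "pd_ring P" by (rule domain_pd_ring[OF P_subring])
  show ?thesis
  proof
    fix I assume I: "ideal I (pd_ring P)"
    then interpret I: ideal I "pd_ring P" .
    show "\<exists>a\<in>carrier (pd_ring P). I = PIdl\<^bsub>pd_ring P\<^esub> a"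
    proof (cases "I \<subseteq> {0}")
      case True
      then have "I = {0}" using I.zero_closed by auto
      then show ?thesis using P_ring by (intro bexI[of _ 0]) (auto simp: PIdl_pd_ring)
    next
      case False
      then obtain a0 where a0: "a0 \<in> I \<and> a0 \<noteq> 0" by auto
      obtain a where a: "a \<in> I" "a \<noteq> 0" and least: "\<And>b. b \<in> I \<Longrightarrow> b \<noteq> 0 \<Longrightarrow> nat (val a) \<le> nat (val b)"
        using ex_has_least_nat[of "\<lambda>a. a \<in> I \<and> a \<noteq> 0" a0 "\<lambda>a. nat (val a)", OF a0] by auto
      have IP: "I \<subseteq> P" using I.a_subset by simp
      have "b \<in> (\<lambda>y. y * a) ` P" if b: "b \<in> I" for b
      proof (cases "b = 0")
        case True
        then show ?thesis using P_ring by (intro image_eqI[of _ _ 0]) auto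
      next
        case False
        have "val a \<ge> 0" "val b \<ge> 0" using a b False IP mem_iff_val by auto
        then have "val (b / a) \<ge> 0" using least[OF b False] False a by (simp add: val_divide)
        then have "b / a \<in> P" using False a mem_iff_val by simp
        then show ?thesis using a by (intro image_eqI[of _ _ "b / a"]) auto
      qed
      moreover have "y * a \<in> I" if "y \<in> P" for y using I.I_l_closed[OF a(1), of y] that by simp
      ultimately have "I = PIdl\<^bsub>pd_ring P\<^esub> a" unfolding PIdl_pd_ring by blast
      then show ?thesis using a IP by auto
    qed
  qed
qed

lemma maximalideal_pd_ring: "maximalideal {z. vge 1 z} (pd_ring P)"
proof -
  interpret domain "pd_ring P" by (rule domain_pd_ring[OF P_subring])
  show ?thesis
  proof (rule maximalidealI)
    show "ideal {z. vge 1 z} (pd_ring P)"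
      using cgenideal_ideal[of t] t_in by (simp add: PIdl_pd_ring vge_1_eq)
    show "carrier (pd_ring P) \<noteq> {z. vge 1 z}"
      using P_ring(1) one_not_vge_1 by force
    fix J assume J: "ideal J (pd_ring P)" "{z. vge 1 z} \<subseteq> J" "J \<subseteq> carrier (pd_ring P)"
    show "J = {z. vge 1 z} \<or> J = carrier (pd_ring P)"
    proof (cases "J \<subseteq> {z. vge 1 z}")
      case False
      then obtain a where "a \<in> J" "\<not> vge 1 a" by auto
      then show ?thesis using ideal_with_unit[OF J(1)] unit_iff[of a] J(3) by auto
    qed (use J in auto)
  qed
qed

lemma maximalideal_unique:
  assumes "maximalideal J (pd_ring P)"
  shows "J = {z. vge 1 z}"
proof -
  interpret J: maximalideal J "pd_ring P" by (rule assms)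
  have JP: "J \<subseteq> P" "J \<noteq> P" using J.a_subset J.I_notcarr by auto
  then have "\<not> unit a" if "a \<in> J" for a using ideal_with_unit[OF J.is_ideal that] by auto
  then have "J \<subseteq> {z. vge 1 z}" using unit_iff JP by blast
  moreover have "{z. vge 1 z} \<subseteq> P" using mem_iff_vge vge_mono by (auto intro: vge_mono)
  moreover have "{z. vge 1 z} \<noteq> P" using P_ring(1) one_not_vge_1 by blast
  ultimately show ?thesis
    using J.I_maximal[of "{z. vge 1 z}"] maximalideal.axioms(1)[OF maximalideal_pd_ring] by auto
qed

lemma pd_ideal_eq: "pd_ideal P = {z. vge 1 z}"
  unfolding pd_ideal_def using maximalideal_pd_ring maximalideal_unique by (rule the_equality)

lemma discrete_valuation_ring_pd_ring: "discrete_valuation_ring (pd_ring P)"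
proof -
  have "\<not> field (pd_ring P)"
  proof
    assume "field (pd_ring P)"
    then interpret F: field "pd_ring P" .
    have "t \<in> Units (pd_ring P)" using F.field_Units t_in t_nz by auto
    then show False using t_inv by (simp add: Units_pd_ring[OF P_subring])
  qed
  then show ?thesis
    unfolding discrete_valuation_ring_def
    using principal_domain_pd_ring maximalideal_pd_ring maximalideal_unique by blast
qed

end

text \<open>In a principal domain every irreducible generates a maximal ideal. There is only one, so
  all irreducibles are associates of a single \<open>t\<close>, and factorisation writes each
  nonzero element as a power of \<open>t\<close> times a unit. Such a \<open>t\<close> exists since
  the ring is not a field.\<close>

lemma ex_dvr:
  fixes P :: "'a::field set"
  assumes P: "subring_set P" and dv: "discrete_valuation_ring (pd_ring P)"
    and quot: "\<And>z. \<exists>a\<in>P. \<exists>b\<in>P. b \<noteq> 0 \<and> z = a / b"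
  shows "\<exists>t. dvr P t"
proof -
  note PD = subring_setD[OF P]
  interpret R: principal_domain "pd_ring P" using dv by (simp add: discrete_valuation_ring_def)
  have uniq: "I = J" if "maximalideal I (pd_ring P)" "maximalideal J (pd_ring P)" for I J
    using dv that by (auto simp: discrete_valuation_ring_def)
  have units: "Units (pd_ring P) = {u \<in> P. u \<noteq> 0 \<and> inverse u \<in> P}" by (rule Units_pd_ring[OF P])
  have "\<exists>z\<in>P. z \<noteq> 0 \<and> z \<notin> Units (pd_ring P)"
  proof (rule ccontr)
    assume "\<not> ?thesis"
    then have "Units (pd_ring P) = carrier (pd_ring P) - {\<zero>\<^bsub>pd_ring P\<^esub>}" by (auto simp: units)
    then have "field (pd_ring P)" by (rule R.cring_fieldI)
    then show False using dv by (simp add: discrete_valuation_ring_def)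
  qed
  then obtain z0 where z0: "z0 \<in> P" "z0 \<noteq> 0" "z0 \<notin> Units (pd_ring P)" by blast
  have factors: "\<exists>fs. set fs \<subseteq> P - {0} \<and> (\<forall>f\<in>set fs. ring_irreducible\<^bsub>pd_ring P\<^esub> f) \<and> foldr (*) fs 1 = z"
    if z: "z \<in> P" "z \<noteq> 0" "z \<notin> Units (pd_ring P)" for z
  proof -
    have "z \<in> carrier (mult_of (pd_ring P))" "z \<notin> Units (mult_of (pd_ring P))" using z by auto
    then obtain fs where fs: "set fs \<subseteq> carrier (mult_of (pd_ring P))" "factors (mult_of (pd_ring P)) fs z"
      using R.mult_of.factors_exist by blast
    have mult: "(\<otimes>\<^bsub>mult_of (pd_ring P)\<^esub>) = ((*) :: 'a \<Rightarrow> 'a \<Rightarrow> 'a)" by (intro ext) simp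
    have "foldr (*) fs 1 = z" using fs(2) unfolding factors_def mult by simp
    moreover have "ring_irreducible\<^bsub>pd_ring P\<^esub> f" if "f \<in> set fs" for f
      using fs that by (intro R.ring_irreducibleI') (auto simp: factors_def)
    ultimately show ?thesis using fs(1) by auto
  qed
  obtain fs where fs: "set fs \<subseteq> P - {0}" "\<forall>f\<in>set fs. ring_irreducible\<^bsub>pd_ring P\<^esub> f" "foldr (*) fs 1 = z0"
    using factors[OF z0] by blast
  have "fs \<noteq> []" using fs(3) z0(3) PD(1) by (auto simp: units)
  then obtain t where t: "t \<in> set fs" by (cases fs) auto
  have tirr: "ring_irreducible\<^bsub>pd_ring P\<^esub> t" and tP: "t \<in> P" "t \<noteq> 0" using t fs by auto
  have tu: "inverse t \<notin> P" using R.ring_irreducibleE(4)[OF _ tirr] tP by (simp add: units)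
  have assoc: "\<exists>u. u \<in> P \<and> u \<noteq> 0 \<and> inverse u \<in> P \<and> f = t * u" if f: "f \<in> P" "f \<noteq> 0" "ring_irreducible\<^bsub>pd_ring P\<^esub> f" for f
  proof -
    have eq: "(\<lambda>y. y * f) ` P = (\<lambda>y. y * t) ` P"
      using uniq[OF R.irreducible_imp_maximalideal R.irreducible_imp_maximalideal, of f t] f tP tirr
      by (simp add: PIdl_pd_ring)
    have "f \<in> (\<lambda>y. y * f) ` P" using PD(1) by (intro image_eqI[of _ _ 1]) auto
    then obtain a where a: "a \<in> P" "f = a * t" unfolding eq by blast
    have "t \<in> (\<lambda>y. y * t) ` P" using PD(1) by (intro image_eqI[of _ _ 1]) auto
    then obtain b where b: "b \<in> P" "t = b * f" unfolding eq[symmetric] by blast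
    have "a * b * t = t" using a b by (simp add: mult_ac)
    then have "a * b = 1" using tP by simp
    then have "inverse a = b" using inverse_unique by blast
    then show ?thesis using a b f tP by (intro exI[of _ a]) auto
  qed
  have dec: "\<exists>n::nat. \<exists>u. u \<in> P \<and> u \<noteq> 0 \<and> inverse u \<in> P \<and> z = t ^ n * u" if z: "z \<in> P" "z \<noteq> 0" for z
  proof (cases "z \<in> Units (pd_ring P)")
    case True
    then show ?thesis using units by (intro exI[of _ "0::nat"] exI[of _ z]) auto
  next
    case False
    obtain fs where fs: "set fs \<subseteq> P - {0}" "\<forall>f\<in>set fs. ring_irreducible\<^bsub>pd_ring P\<^esub> f" "foldr (*) fs 1 = z"
      using factors[OF z False] by blast
    have "\<exists>n::nat. \<exists>u. u \<in> P \<and> u \<noteq> 0 \<and> inverse u \<in> P \<and> foldr (*) fs 1 = t ^ n * u"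
      using fs(1,2)
    proof (induction fs)
      case Nil
      then show ?case using PD(1) by (intro exI[of _ "0::nat"] exI[of _ 1]) auto
    next
      case (Cons f fs)
      then obtain n u where u: "u \<in> P" "u \<noteq> 0" "inverse u \<in> P" "foldr (*) fs 1 = t ^ n * u" by auto
      obtain w where w: "w \<in> P" "w \<noteq> 0" "inverse w \<in> P" "f = t * w" using assoc[of f] Cons.prems by auto
      show ?case using u w PD(5)
        by (intro exI[of _ "Suc n"] exI[of _ "w * u"]) (auto simp: mult_ac)
    qed
    then show ?thesis using fs(3) by simp
  qed
  have "dvr P t"
  proof
    fix z :: 'a assume z: "z \<noteq> 0"
    obtain a b where ab: "a \<in> P" "b \<in> P" "b \<noteq> 0" "z = a / b" using quot[of z] by blast
    then have a0: "a \<noteq> 0" using z by auto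
    obtain n u where u: "u \<in> P" "u \<noteq> 0" "inverse u \<in> P" "a = t ^ n * u" using dec[OF ab(1) a0] by blast
    obtain m w where w: "w \<in> P" "w \<noteq> 0" "inverse w \<in> P" "b = t ^ m * w" using dec[OF ab(2,3)] by blast
    have "z = t powi (int n - int m) * (u * inverse w)"
      unfolding ab(4) u(4) w(4) using tP w by (simp add: power_int_diff field_simps)
    then show "\<exists>n::int. \<exists>u. u \<in> P \<and> u \<noteq> 0 \<and> inverse u \<in> P \<and> z = t powi n * u"
      using u w PD(5) by (intro exI[of _ "int n - int m"] exI[of _ "u * inverse w"]) auto
  qed (use P tP tu in auto)
  then show ?thesis by blast
qed

context function_field
begin

lemma prime_divisors_eq_places:
  assumes "k = constant_field"
  shows "(prime_divisors :: 'a set set) = places"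
proof (intro equalityI subsetI)
  fix P :: "'a set" assume "P \<in> prime_divisors"
  then show "P \<in> places"
    using ex_dvr[of P] by (auto simp: prime_divisors_def places_def subring_set_iff assms[symmetric])
next
  fix P :: "'a set" assume P: "P \<in> places"
  interpret D: dvr P "unif P" by (rule dvr_place[OF P])
  have "\<exists>a\<in>P. \<exists>b\<in>P. b \<noteq> 0 \<and> z = a / b" for z
  proof (cases "z \<in> P")
    case True
    show ?thesis by (rule bexI[OF _ True], rule bexI[OF _ D.P_ring(1)]) simp
  next
    case False
    then have z0: "z \<noteq> 0" using D.P_ring(2) by auto
    then have zi: "inverse z \<in> P"
      using False D.mem_iff_val[of z] D.mem_iff_val[of "inverse z"] D.val_inverse[of z] by auto
    show ?thesis by (rule bexI[OF _ D.P_ring(1)], rule bexI[OF _ zi]) (use z0 in \<open>simp add: divide_inverse\<close>)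
  qed
  then show "P \<in> prime_divisors"
    using P D.P_subring D.discrete_valuation_ring_pd_ring k_in_place[OF P]
    by (auto simp: prime_divisors_def subring_set_iff assms[symmetric])
qed

text \<open>\<open>reps P\<close> meets every coset of the maximal ideal exactly once.\<close>

lemma pd_norm_eq:
  assumes P: "P \<in> places"
  shows "pd_norm P = card k ^ pdeg P"
proof -
  interpret D: dvr P "unif P" by (rule dvr_place[OF P])
  let ?M = "{z. D.vge 1 z}"
  define cs where "cs a = (\<lambda>h. h + a) ` ?M" for a
  have car: "carrier (pd_ring P Quot pd_ideal P) = cs ` P"
    by (auto simp: FactRing_def A_RCOSETS_def' a_r_coset_def' D.pd_ideal_eq cs_def)
  have eq: "cs a = cs b \<longleftrightarrow> D.vge 1 (a - b)" for a b
  proof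
    assume "cs a = cs b"
    moreover have "a \<in> cs a" by (simp add: cs_def image_iff)
    ultimately obtain h where "D.vge 1 h" "a = h + b" by (auto simp: cs_def)
    then show "D.vge 1 (a - b)" by simp
  next
    have *: "cs a \<subseteq> cs b" if ab: "D.vge 1 (a - b)" for a b
    proof
      fix y assume "y \<in> cs a"
      then obtain h where h: "D.vge 1 h" "y = h + a" by (auto simp: cs_def)
      then show "y \<in> cs b" unfolding cs_def using D.vge_add[OF h(1) ab]
        by (intro image_eqI[of _ _ "h + (a - b)"]) auto
    qed
    assume "D.vge 1 (a - b)"
    moreover from this have "D.vge 1 (b - a)" using D.vge_uminus by fastforce
    ultimately show "cs a = cs b" using * by blast
  qed
  have "cs ` P = cs ` reps P"
  proof (intro equalityI image_subsetI)
    fix a assume "a \<in> P"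
    then obtain u where "u \<in> reps P" "D.vge 1 (a - u)" using repsD(4)[OF P] by blast
    then show "cs a \<in> cs ` reps P" using eq by auto
  qed (use repsD(2)[OF P] in auto)
  moreover have "inj_on cs (reps P)"
    using eq repsD(5)[OF P] by (auto intro!: inj_onI)
  ultimately show ?thesis unfolding pd_norm_def car using repsD(3)[OF P] by (simp add: card_image)
qed

lemma pd_degree_eq:
  assumes P: "P \<in> places"
  shows "pd_degree (card k) P = pdeg P"
proof -
  have "n = pdeg P" if "card k ^ pdeg P = card k ^ n" for n
    using that card_k_power_le_iff by (metis order.antisym order.refl)
  then show ?thesis unfolding pd_degree_def pd_norm_eq[OF P] by (intro the_equality) auto
qed

end

unbundle no vec_syntax

subsection \<open>Non-vanishing on the unit circle\<close>

lemma conv_radius_ge_geometric: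
  fixes f :: "nat \<Rightarrow> 'b::{banach, real_normed_div_algebra}"
  assumes "\<And>n. norm (f n) \<le> C * (1 / R) ^ n" "R > 0"
  shows "conv_radius f \<ge> ereal R"
proof (rule conv_radius_geI_ex)
  fix r :: real assume r: "0 < r" "ereal r < ereal R"
  have "summable (\<lambda>n. f n * of_real r ^ n)"
  proof (rule summable_comparison_test[OF _ summable_mult[OF summable_geometric[of "r / R"]]])
    show "norm (r / R) < 1" using r assms(2) by simp
    show "\<exists>N. \<forall>n\<ge>N. norm (f n * of_real r ^ n) \<le> C * (r / R) ^ n"
    proof (intro exI[of _ 0] allI impI)
      fix n
      have "norm (f n * of_real r ^ n) = norm (f n) * r ^ n" using r by (simp add: norm_mult norm_power)
      also have "\<dots> \<le> C * (1 / R) ^ n * r ^ n" using assms(1)[of n] r by (intro mult_right_mono) auto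
      finally show "norm (f n * of_real r ^ n) \<le> C * (r / R) ^ n" by (simp add: power_divide)
    qed
  qed
  then show "\<exists>z. norm z = r \<and> summable (\<lambda>n. f n * z ^ n)"
    using r by (intro exI[of _ "of_real r"]) auto
qed

text \<open>The substitution of \<open>-X\<close> for \<open>X\<close>.\<close>

definition fps_alt :: "real fps \<Rightarrow> real fps" where "fps_alt f = Abs_fps (\<lambda>n. (-1) ^ n * f $ n)"

lemma fps_alt_nth [simp]: "fps_alt f $ n = (-1) ^ n * f $ n" by (simp add: fps_alt_def)

lemma fps_alt_mult: "fps_alt (f * g) = fps_alt f * fps_alt g"
proof (rule fps_ext)
  fix n
  have e: "(-1) ^ n * (f $ i * g $ (n - i)) = (-1) ^ i * f $ i * ((-1) ^ (n - i) * g $ (n - i))"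
    if "i \<in> {0..n}" for i
  proof -
    have "(-1 :: real) ^ n = (-1) ^ i * (-1) ^ (n - i)" using that by (simp flip: power_add)
    then show ?thesis by simp
  qed
  show "fps_alt (f * g) $ n = (fps_alt f * fps_alt g) $ n"
    unfolding fps_alt_nth fps_mult_nth sum_distrib_left by (rule sum.cong[OF refl e])
qed

text \<open>\<open>\<beta>\<close> and \<open>lam\<close> are the coefficients of the zeta series
  and of its logarithmic derivative, the analogue of the von Mangoldt function, rescaled so that the
  pole lies at 1. \<open>rec\<close> is the differential equation between them, and
  \<open>\<beta>_asymp\<close> says that the pole is simple and that nothing else happens up to
  radius \<open>Q\<close>. In \<open>lam_double\<close> the factor \<open>Q ^ m\<close> comes from
  the rescaling.\<close>

locale zeta_like =
  fixes \<beta> lam :: "nat \<Rightarrow> real" and Q \<alpha> C :: real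
  assumes Q: "Q > 1" and \<alpha>: "\<alpha> > 0"
    and \<beta>_0: "\<beta> 0 = 1" and lam_0: "lam 0 = 0" and lam_nonneg: "lam n \<ge> 0"
    and lam_double: "lam m \<le> lam (2 * m) * Q ^ m"
    and rec: "real n * \<beta> n = (\<Sum>i=0..n. \<beta> i * lam (n - i))"
    and \<beta>_asymp: "\<bar>\<beta> n - \<alpha>\<bar> \<le> C * (1 / Q) ^ n"
begin

definition zr :: "real fps" where "zr = Abs_fps \<beta>"
definition lr :: "real fps" where "lr = Abs_fps lam"
definition Lr :: "real fps" where "Lr = (1 - fps_X) * zr"

lemma C_nonneg: "C \<ge> 0" using \<beta>_asymp[of 0] by simp

lemma \<beta>_nonneg: "\<beta> n \<ge> 0"
proof (induction n rule: less_induct)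
  case (less n)
  show ?case
  proof (cases "n = 0")
    case False
    have "(\<Sum>i=0..n. \<beta> i * lam (n - i)) = (\<Sum>i=0..<n. \<beta> i * lam (n - i))"
      by (simp add: sum.last_plus[of 0 n] lam_0 atLeastLessThanSuc_atLeastAtMost[symmetric])
    also have "\<dots> \<ge> 0" using less.IH lam_nonneg by (intro sum_nonneg) auto
    finally have "real n * \<beta> n \<ge> 0" using rec by simp
    then show ?thesis using False by (simp add: zero_le_mult_iff)
  qed (simp add: \<beta>_0)
qed

lemma \<beta>_bound: "\<beta> n \<le> \<alpha> + C"
proof -
  have "C * (1 / Q) ^ n \<le> C * 1" using Q C_nonneg by (intro mult_left_mono power_le_one) auto
  then show ?thesis using \<beta>_asymp[of n] by simp
qed

lemma lam_le: "lam n \<le> real n * \<beta> n"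
proof -
  have "\<beta> 0 * lam (n - 0) \<le> (\<Sum>i=0..n. \<beta> i * lam (n - i))"
    by (rule member_le_sum) (auto intro!: mult_nonneg_nonneg \<beta>_nonneg lam_nonneg)
  then show ?thesis using rec[of n] \<beta>_0 by simp
qed

lemma fps_rec: "fps_X * fps_deriv zr = zr * lr"
proof (rule fps_ext)
  fix n
  have "(fps_X * fps_deriv zr) $ n = real n * \<beta> n" by (cases n) (auto simp: zr_def)
  moreover have "(zr * lr) $ n = real n * \<beta> n"
    unfolding rec zr_def lr_def by (simp add: fps_mult_nth)
  ultimately show "(fps_X * fps_deriv zr) $ n = (zr * lr) $ n" by (simp only:)
qed

lemma Lr_nth: "Lr $ n = (if n = 0 then 1 else \<beta> n - \<beta> (n - 1))"
  by (simp add: Lr_def zr_def left_diff_distrib \<beta>_0)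

text \<open>Consecutive differences cancel \<open>\<alpha>\<close> and leave two error terms, the
  one at \<open>n - 1\<close> costing a factor \<open>Q\<close>. The summand 1 serves
  \<open>n = 0\<close>. Removing the pole thus continues the series to radius
  \<open>Q\<close>.\<close>

lemma Lr_bound: "\<bar>Lr $ n\<bar> \<le> (1 + C * (1 + Q)) * (1 / Q) ^ n"
proof (cases n)
  case 0
  then show ?thesis using C_nonneg Q by (simp add: Lr_nth)
next
  case (Suc m)
  have "\<bar>Lr $ n\<bar> \<le> C * (1 / Q) ^ n + C * (1 / Q) ^ m"
    using \<beta>_asymp[of n] \<beta>_asymp[of m] by (simp add: Lr_nth Suc)
  also have "\<dots> = C * (1 + Q) * (1 / Q) ^ n" using Q by (simp add: Suc field_simps)
  also have "\<dots> \<le> (1 + C * (1 + Q)) * (1 / Q) ^ n" using Q by (intro mult_right_mono) auto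
  finally show ?thesis .
qed

lemma \<beta>_lim: "\<beta> \<longlonglongrightarrow> \<alpha>"
proof -
  have "(\<lambda>n. C * (1 / Q) ^ n) \<longlonglongrightarrow> C * 0" using Q by (intro tendsto_mult LIMSEQ_power_zero) auto
  then have g: "(\<lambda>n. C * (1 / Q) ^ n) \<longlonglongrightarrow> 0" by simp
  have "(\<lambda>n. \<beta> n - \<alpha>) \<longlonglongrightarrow> 0"
    by (rule Lim_null_comparison[OF always_eventually g]) (simp add: \<beta>_asymp)
  then show ?thesis by (simp add: LIM_zero_iff)
qed

lemma Lr_sums: "(\<lambda>n. Lr $ n) sums \<alpha>"
proof -
  have "(\<Sum>i<Suc n. Lr $ i) = \<beta> n" for n
    by (induction n) (auto simp: Lr_nth \<beta>_0)
  then have "(\<lambda>n. \<Sum>i<Suc n. Lr $ i) \<longlonglongrightarrow> \<alpha>" using \<beta>_lim by simp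
  then show ?thesis unfolding sums_def by (rule LIMSEQ_imp_Suc)
qed

text \<open>If \<open>Lr\<close> vanishes at \<open>-1\<close>, the even part \<open>zr(u) zr(-u)\<close> continues analytically to \<open>|u| < Q\<close>,
  but its coefficients dominate those of \<open>zr\<close> in the variable \<open>u\<^sup>2 / Q\<close>.\<close>

lemma even_coeffs_ge: "(zr * fps_alt zr) $ (2 * n) * Q ^ n \<ge> \<beta> n"
proof (induction n rule: less_induct)
  case (less n)
  define w where "w = zr * fps_alt zr"
  show ?case
  proof (cases "n = 0")
    case True
    then show ?thesis by (simp add: zr_def \<beta>_0)
  next
    case False
    have alt: "fps_X * fps_deriv (fps_alt zr) = fps_alt zr * fps_alt lr"
    proof -
      have "fps_X * fps_deriv (fps_alt zr) = fps_alt (fps_X * fps_deriv zr)"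
      proof (rule fps_ext)
        fix n show "(fps_X * fps_deriv (fps_alt zr)) $ n = fps_alt (fps_X * fps_deriv zr) $ n"
          by (cases n) auto
      qed
      then show ?thesis by (simp add: fps_rec fps_alt_mult)
    qed
    \<comment> \<open>The logarithmic derivative of the product keeps twice the even coefficients of
      \<open>lr\<close> and drops the odd ones. The result is a recursion of the same shape as
      \<open>rec\<close>, to be compared with it term by term.\<close>
    have "fps_X * fps_deriv w = (fps_X * fps_deriv zr) * fps_alt zr + zr * (fps_X * fps_deriv (fps_alt zr))"
      by (simp add: w_def algebra_simps)
    also have "\<dots> = w * (lr + fps_alt lr)" by (simp add: fps_rec alt w_def algebra_simps)
    finally have "(fps_X * fps_deriv w) $ (2 * n) = (w * (lr + fps_alt lr)) $ (2 * n)" by simp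
    moreover have "(fps_X * fps_deriv w) $ (2 * n) = real (2 * n) * w $ (2 * n)"
      using False by (cases n) auto
    ultimately have "real (2 * n) * w $ (2 * n) = (\<Sum>j=0..2*n. w $ j * (lr + fps_alt lr) $ (2 * n - j))"
      by (simp add: fps_mult_nth)
    also have "\<dots> = (\<Sum>j\<in>(\<lambda>i. 2 * i) ` {0..n}. w $ j * (lr + fps_alt lr) $ (2 * n - j))"
    proof (rule sum.mono_neutral_right)
      show "\<forall>j\<in>{0..2 * n} - (\<lambda>i. 2 * i) ` {0..n}. w $ j * (lr + fps_alt lr) $ (2 * n - j) = 0"
      proof
        fix j assume j: "j \<in> {0..2 * n} - (\<lambda>i. 2 * i) ` {0..n}"
        have "odd j"
        proof
          assume "even j"
          then obtain i where "j = 2 * i" by blast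
          then show False using j by auto
        qed
        then have "odd (2 * n - j)" using j by auto
        then show "w $ j * (lr + fps_alt lr) $ (2 * n - j) = 0" by simp
      qed
    qed auto
    also have "\<dots> = (\<Sum>i=0..n. w $ (2 * i) * (2 * lam (2 * (n - i))))"
      by (subst sum.reindex) (auto simp: inj_on_def lr_def right_diff_distrib' intro!: sum.cong)
    finally have w: "real n * w $ (2 * n) = (\<Sum>i=0..n. w $ (2 * i) * lam (2 * (n - i)))"
      by (simp add: mult_ac flip: sum_distrib_left)
    have "real n * \<beta> n = (\<Sum>i=0..n. \<beta> i * lam (n - i))" by (rule rec)
    \<comment> \<open>\<open>lam_double\<close> at \<open>n - i\<close> supplies exactly the factor
      \<open>Q ^ (n - i)\<close>. The term \<open>i = n\<close>, outside the induction hypothesis,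
      vanishes by \<open>lam_0\<close>.\<close>
    also have "\<dots> \<le> (\<Sum>i=0..n. (w $ (2 * i) * Q ^ i) * (lam (2 * (n - i)) * Q ^ (n - i)))"
    proof (rule sum_mono)
      fix i assume i: "i \<in> {0..n}"
      show "\<beta> i * lam (n - i) \<le> (w $ (2 * i) * Q ^ i) * (lam (2 * (n - i)) * Q ^ (n - i))"
      proof (cases "i = n")
        case False
        then have "\<beta> i \<le> w $ (2 * i) * Q ^ i" using less.IH[of i] i by (simp add: w_def)
        then show ?thesis
          using lam_double[of "n - i"] \<beta>_nonneg[of i] lam_nonneg by (intro mult_mono) auto
      qed (simp add: lam_0)
    qed
    also have "\<dots> = (\<Sum>i=0..n. w $ (2 * i) * lam (2 * (n - i)) * Q ^ n)"
    proof (intro sum.cong refl)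
      fix i assume "i \<in> {0..n}"
      then have "Q ^ n = Q ^ i * Q ^ (n - i)" by (simp flip: power_add)
      then show "(w $ (2 * i) * Q ^ i) * (lam (2 * (n - i)) * Q ^ (n - i)) = w $ (2 * i) * lam (2 * (n - i)) * Q ^ n"
        by simp
    qed
    also have "\<dots> = real n * (w $ (2 * n) * Q ^ n)"
      using w by (simp add: mult_ac flip: sum_distrib_left sum_distrib_right)
    finally show ?thesis using False by (simp add: w_def)
  qed
qed

lemma Lr_at_minus_one: "suminf (\<lambda>n. Lr $ n * (-1) ^ n) \<noteq> 0"
proof
  assume zero: "suminf (\<lambda>n. Lr $ n * (-1) ^ n) = 0"
  define K where "K = 1 + C * (1 + Q)"
  have K: "K \<ge> 0" using C_nonneg Q by (simp add: K_def)
  have bd: "norm (Lr $ n * (-1) ^ n) \<le> K * (1 / Q) ^ n" for n using Lr_bound[of n] by (simp add: K_def abs_mult)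
  have geo: "summable (\<lambda>n. K * (1 / Q) ^ n)" using Q by (intro summable_mult summable_geometric) auto
  have summ: "summable (\<lambda>n. Lr $ n * (-1) ^ n)"
    by (rule summable_comparison_test'[OF geo, of 0]) (use bd in auto)
  \<comment> \<open>The quotient \<open>Lr / (1 + X)\<close>; its coefficients are signed partial
    sums of the series of \<open>Lr\<close> at -1.\<close>
  define M where "M = Abs_fps (\<lambda>n. (-1) ^ n * (\<Sum>i<Suc n. Lr $ i * (-1) ^ i))"
  have LM: "Lr = (1 + fps_X) * M"
  proof (rule fps_ext)
    fix n
    show "Lr $ n = ((1 + fps_X) * M) $ n"
      by (cases n) (auto simp: M_def distrib_right algebra_simps simp flip: power_mult_distrib)
  qed
  \<comment> \<open>The full sum being 0, each partial sum is the negative of a tail and hence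
    exponentially small: the division loses no radius of convergence.\<close>
  have Mb: "\<bar>M $ n\<bar> \<le> K / (1 - 1 / Q) * (1 / Q) ^ n" for n
  proof -
    have "suminf (\<lambda>i. Lr $ (i + Suc n) * (-1) ^ (i + Suc n)) = - (\<Sum>i<Suc n. Lr $ i * (-1) ^ i)"
      using suminf_minus_initial_segment[OF summ, of "Suc n"] zero by simp
    then have "\<bar>M $ n\<bar> = \<bar>suminf (\<lambda>i. Lr $ (i + Suc n) * (-1) ^ (i + Suc n))\<bar>"
      by (simp add: M_def abs_mult)
    also have "\<dots> \<le> suminf (\<lambda>i. K * (1 / Q) ^ (i + Suc n))"
    proof -
      have s: "summable (\<lambda>i. K * (1 / Q) ^ (i + Suc n))" by (rule iffD2[OF summable_iff_shift geo])
      have "norm (suminf (\<lambda>i. Lr $ (i + Suc n) * (-1) ^ (i + Suc n))) \<le> suminf (\<lambda>i. K * (1 / Q) ^ (i + Suc n))"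
        by (rule norm_suminf_le[OF bd s])
      then show ?thesis by (simp only: real_norm_def)
    qed
    also have "\<dots> = K * (1 / Q) ^ Suc n * suminf (\<lambda>i. (1 / Q) ^ i)"
      using Q by (subst suminf_mult[symmetric]) (auto simp: power_add mult_ac)
    also have "\<dots> = K * (1 / Q) ^ Suc n * (1 / (1 - 1 / Q))" using Q by (subst suminf_geometric) auto
    also have "\<dots> \<le> K / (1 - 1 / Q) * (1 / Q) ^ n"
    proof -
      have "(1 / Q) ^ Suc n \<le> (1 / Q) ^ n" using Q by (intro power_decreasing) auto
      then have "K * (1 / Q) ^ Suc n * (1 / (1 - 1 / Q)) \<le> K * (1 / Q) ^ n * (1 / (1 - 1 / Q))"
        using K Q by (intro mult_right_mono mult_left_mono) auto
      then show ?thesis by simp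
    qed
    finally show ?thesis .
  qed
  have R1: "fps_conv_radius M \<ge> ereal Q" "fps_conv_radius (fps_alt M) \<ge> ereal Q"
    unfolding fps_conv_radius_def using Mb Q
    by (auto intro!: conv_radius_ge_geometric[where C = "K / (1 - 1 / Q)"] simp: abs_mult)
  have R2: "fps_conv_radius (M * fps_alt M) \<ge> ereal Q"
    using fps_conv_radius_mult[of M "fps_alt M"] R1 by (meson min.boundedI order.trans)
  \<comment> \<open>The zero of \<open>Lr\<close> at -1 cancels the pole of
    \<open>fps_alt zr\<close> there, and by symmetry the pole of \<open>zr\<close> at 1 is cancelled
    too.\<close>
  have "zr * fps_alt zr = M * fps_alt M"
  proof -
    have "fps_alt (1 - fps_X) = 1 + fps_X" "fps_alt (1 + fps_X) = 1 - fps_X"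
      by (auto intro!: fps_ext simp: fps_X_def)
    then have alt: "(1 + fps_X) * fps_alt zr = (1 - fps_X) * fps_alt M"
      using arg_cong[OF Lr_def, of fps_alt] arg_cong[OF LM, of fps_alt] by (simp add: fps_alt_mult)
    have "((1 - fps_X) * (1 + fps_X)) * (zr * fps_alt zr) = ((1 - fps_X) * zr) * ((1 + fps_X) * fps_alt zr)" by simp
    also have "\<dots> = ((1 + fps_X) * M) * ((1 - fps_X) * fps_alt M)" using LM alt by (simp add: Lr_def)
    also have "\<dots> = ((1 - fps_X) * (1 + fps_X)) * (M * fps_alt M)" by simp
    finally have "((1 - fps_X) * (1 + fps_X)) * (zr * fps_alt zr) = ((1 - fps_X) * (1 + fps_X)) * (M * fps_alt M)" .
    moreover have "(1 - fps_X) * (1 + fps_X :: real fps) \<noteq> 0"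
    proof
      assume "(1 - fps_X) * (1 + fps_X :: real fps) = 0"
      then have "((1 - fps_X) * (1 + fps_X :: real fps)) $ 0 = 0" by simp
      then show False by simp
    qed
    ultimately show ?thesis by (metis mult_left_cancel)
  qed
  \<comment> \<open>At the point \<open>sqrt Q\<close> the even terms are the quantities bounded
    below by \<open>\<beta> n\<close>. Convergence sends them to 0, although \<open>\<beta>\<close>
    tends to \<open>\<alpha> > 0\<close>.\<close>
  moreover have "ereal (norm (sqrt Q)) < fps_conv_radius (M * fps_alt M)"
  proof -
    have "norm (sqrt Q) < Q" using Q by (simp add: real_less_lsqrt power2_eq_square)
    then show ?thesis using R2 by (meson ereal_less_eq(3) less_ereal.simps(1) order.strict_trans2)
  qed
  ultimately have "summable (\<lambda>n. (zr * fps_alt zr) $ n * sqrt Q ^ n)"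
    using summable_fps by metis
  then have "(\<lambda>n. (zr * fps_alt zr) $ n * sqrt Q ^ n) \<longlonglongrightarrow> 0" by (rule summable_LIMSEQ_zero)
  then have "(\<lambda>n. (zr * fps_alt zr) $ (2 * n) * sqrt Q ^ (2 * n)) \<longlonglongrightarrow> 0"
    by (rule LIMSEQ_subseq_LIMSEQ[unfolded comp_def, where f = "\<lambda>n. 2 * n"]) (auto simp: strict_mono_def)
  then have "(\<lambda>n. (zr * fps_alt zr) $ (2 * n) * Q ^ n) \<longlonglongrightarrow> 0" using Q by (simp add: power_mult)
  then have "\<alpha> \<le> 0" using \<beta>_lim even_coeffs_ge by (intro LIMSEQ_le[of \<beta> \<alpha>]) auto
  then show False using \<alpha> by simp
qed

section \<open>The zeta series as an analytic function: logarithm and 3-4-1 inequality\<close>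

definition zc :: "complex fps" where "zc = Abs_fps (\<lambda>n. of_real (\<beta> n))"
definition Lc :: "complex fps" where "Lc = Abs_fps (\<lambda>n. of_real (Lr $ n))"
text \<open>The logarithm of \<open>zc\<close>. Its coefficient at 0 is 0, as it has to be for
  \<open>zc\<close> with constant term 1.\<close>

definition Ac :: "complex fps" where "Ac = Abs_fps (\<lambda>n. of_real (lam n / real n))"

lemma Lc_eq: "Lc = (1 - fps_X) * zc"
  by (rule fps_ext) (auto simp: Lc_def zc_def Lr_nth left_diff_distrib \<beta>_0)

lemma conv_radius_zc: "fps_conv_radius zc \<ge> 1"
proof -
  have "fps_conv_radius zc \<ge> ereal 1" unfolding fps_conv_radius_def
    by (rule conv_radius_ge_geometric[where C = "\<alpha> + C"]) (auto simp: zc_def \<beta>_nonneg \<beta>_bound)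
  then show ?thesis by (simp add: one_ereal_def)
qed

lemma conv_radius_Lc: "fps_conv_radius Lc \<ge> ereal Q"
  unfolding fps_conv_radius_def
  by (rule conv_radius_ge_geometric[where C = "1 + C * (1 + Q)"]) (use Lr_bound Q in \<open>auto simp: Lc_def\<close>)

lemma conv_radius_Ac: "fps_conv_radius Ac \<ge> 1"
proof -
  have "lam n / real n \<le> \<alpha> + C" for n
  proof (cases "n = 0")
    case False
    then have "lam n / real n \<le> \<beta> n" using lam_le[of n] by (simp add: field_simps)
    then show ?thesis using \<beta>_bound[of n] by simp
  qed (use \<alpha> C_nonneg in auto)
  then have "fps_conv_radius Ac \<ge> ereal 1" unfolding fps_conv_radius_def
    by (intro conv_radius_ge_geometric[where C = "\<alpha> + C"]) (auto simp: Ac_def lam_nonneg norm_divide)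
  then show ?thesis by (simp add: one_ereal_def)
qed

lemma in_radius:
  assumes "norm (z :: complex) < 1"
  shows "ereal (norm z) < fps_conv_radius zc" "ereal (norm z) < fps_conv_radius Ac"
proof -
  have "ereal (norm z) < 1" using assms by (simp add: one_ereal_def)
  then show "ereal (norm z) < fps_conv_radius zc" "ereal (norm z) < fps_conv_radius Ac"
    by (rule order.strict_trans2[OF _ conv_radius_zc] order.strict_trans2[OF _ conv_radius_Ac])+
qed

lemma in_radius_Lc: "norm (z :: complex) < Q \<Longrightarrow> ereal (norm z) < fps_conv_radius Lc"
  using conv_radius_Lc by (metis less_ereal.simps(1) order.strict_trans2)

lemma deriv_zc: "fps_deriv zc = zc * fps_deriv Ac"
proof (rule fps_ext)
  fix n
  have "real (Suc n) * \<beta> (Suc n) = (\<Sum>i=0..n. \<beta> i * lam (Suc n - i))"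
    unfolding rec by (simp add: lam_0)
  then have "complex_of_real (real (Suc n) * \<beta> (Suc n)) = of_real (\<Sum>i=0..n. \<beta> i * lam (Suc n - i))"
    by (simp only:)
  also have "\<dots> = (zc * fps_deriv Ac) $ n"
    unfolding of_real_sum fps_mult_nth
  proof (rule sum.cong[OF refl])
    fix i assume "i \<in> {0..n}"
    then have i: "Suc n - i = Suc (n - i)" by auto
    have "fps_deriv Ac $ (n - i) = of_real (real (Suc (n - i)) * (lam (Suc (n - i)) / real (Suc (n - i))))"
      unfolding Ac_def fps_deriv_nth fps_nth_Abs_fps of_real_mult by simp
    also have "\<dots> = of_real (lam (Suc (n - i)))" by (simp del: of_nat_Suc)
    finally show "complex_of_real (\<beta> i * lam (Suc n - i)) = zc $ i * fps_deriv Ac $ (n - i)"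
      by (simp add: zc_def i)
  qed
  finally show "fps_deriv zc $ n = (zc * fps_deriv Ac) $ n" by (simp add: zc_def)
qed

text \<open>The product of \<open>zc\<close> with the exponential of \<open>- Ac\<close> has
  derivative 0. In particular \<open>zc\<close> has no zero in the open disc.\<close>

lemma zc_exp:
  assumes z: "norm z < 1"
  shows "eval_fps zc z = exp (eval_fps Ac z)"
proof -
  define g where "g z = eval_fps zc z * exp (- eval_fps Ac z)" for z
  have "(g has_field_derivative 0) (at z within ball 0 1)" if z: "z \<in> ball 0 1" for z
  proof -
    have nz: "norm z < 1" using z by simp
    have d: "eval_fps (fps_deriv zc) z = eval_fps zc z * eval_fps (fps_deriv Ac) z"
      unfolding deriv_zc using in_radius[OF nz] fps_conv_radius_deriv[of Ac]
      by (intro eval_fps_mult) (auto intro: order.strict_trans2)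
    show ?thesis unfolding g_def
      by (rule derivative_eq_intros has_field_derivative_eval_fps in_radius[OF nz] refl)+ (simp add: d)
  qed
  then have "\<exists>c. \<forall>z\<in>ball 0 1. g z = c" by (intro has_field_derivative_zero_constant) auto
  then have "g z = g 0" using z by force
  also have "\<dots> = 1" by (simp add: g_def eval_fps_at_0 zc_def Ac_def \<beta>_0)
  finally show ?thesis by (simp add: g_def exp_minus field_simps)
qed

lemma eval_Lc:
  assumes "norm z < 1"
  shows "eval_fps Lc z = (1 - z) * eval_fps zc z"
proof -
  have "ereal (norm z) < fps_conv_radius (1 - fps_X :: complex fps)"
  proof -
    have "fps_conv_radius (1 - fps_X :: complex fps) \<ge> \<infinity>"
      using fps_conv_radius_diff[of "1 :: complex fps" fps_X] by simp
    then show ?thesis by simp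
  qed
  then show ?thesis unfolding Lc_eq using in_radius[OF assms]
    by (subst eval_fps_mult) (auto simp: eval_fps_diff)
qed

text \<open>Mertens' inequality. For \<open>u\<close> on the unit circle,
  \<open>3 + 4 * Re u + Re (u ^ 2) = 2 * (1 + Re u) ^ 2\<close>; sum this against the nonnegative
  coefficients of the logarithm.\<close>

lemma three_four_one:
  assumes r: "0 \<le> r" "r < 1" and w: "norm (w :: complex) = 1"
  shows "norm (eval_fps zc (of_real r)) ^ 3 * norm (eval_fps zc (of_real r * w)) ^ 4 * norm (eval_fps zc (of_real r * w\<^sup>2)) \<ge> 1"
proof -
  let ?A = "eval_fps Ac"
  have n1: "norm (complex_of_real r) < 1" "norm (of_real r * w) < 1" "norm (of_real r * w\<^sup>2) < 1"
    using r w by (auto simp: norm_mult norm_power)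
  have s: "(\<lambda>n. Ac $ n * z ^ n) sums ?A z" if "norm z < 1" for z
    using sums_eval_fps[OF in_radius(2)[OF that]] .
  have "(\<lambda>n. 3 * (Ac $ n * of_real r ^ n) + 4 * (Ac $ n * (of_real r * w) ^ n) + Ac $ n * (of_real r * w\<^sup>2) ^ n)
      sums (3 * ?A (of_real r) + 4 * ?A (of_real r * w) + ?A (of_real r * w\<^sup>2))"
    using n1 by (intro sums_add sums_mult s)
  then have S: "(\<lambda>n. Re (3 * (Ac $ n * of_real r ^ n) + 4 * (Ac $ n * (of_real r * w) ^ n) + Ac $ n * (of_real r * w\<^sup>2) ^ n))
      sums Re (3 * ?A (of_real r) + 4 * ?A (of_real r * w) + ?A (of_real r * w\<^sup>2))"
    by (rule sums_Re)
  have nn: "Re (3 * (Ac $ n * of_real r ^ n) + 4 * (Ac $ n * (of_real r * w) ^ n) + Ac $ n * (of_real r * w\<^sup>2) ^ n) \<ge> 0" for n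
  proof -
    define u where "u = w ^ n"
    have "norm u = 1" by (simp add: u_def norm_power w)
    then have "(Re u)\<^sup>2 + (Im u)\<^sup>2 = 1" by (metis cmod_power2 one_power2)
    then have "3 + 4 * Re u + Re (u\<^sup>2) = 2 * (1 + Re u)\<^sup>2" by (simp add: power2_eq_square algebra_simps)
    then have pos: "3 + 4 * Re u + Re (u\<^sup>2) \<ge> 0" by simp
    have w2: "(w\<^sup>2) ^ n = u\<^sup>2" unfolding u_def by (simp flip: power_mult add: mult.commute)
    have "3 * (Ac $ n * of_real r ^ n) + 4 * (Ac $ n * (of_real r * w) ^ n) + Ac $ n * (of_real r * w\<^sup>2) ^ n
        = of_real (lam n / real n * r ^ n) * (3 + 4 * u + u\<^sup>2)"
      unfolding power_mult_distrib w2 u_def[symmetric] Ac_def by (simp add: algebra_simps)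
    then have "Re (3 * (Ac $ n * of_real r ^ n) + 4 * (Ac $ n * (of_real r * w) ^ n) + Ac $ n * (of_real r * w\<^sup>2) ^ n)
        = (lam n / real n * r ^ n) * (3 + 4 * Re u + Re (u\<^sup>2))" by (simp only: Re_complex_of_real) simp
    then show ?thesis using pos r lam_nonneg[of n] by simp
  qed
  have "Re (3 * ?A (of_real r) + 4 * ?A (of_real r * w) + ?A (of_real r * w\<^sup>2)) \<ge> 0"
    by (rule sums_le[OF nn sums_zero S])
  then have "1 \<le> exp (3 * Re (?A (of_real r)) + 4 * Re (?A (of_real r * w)) + Re (?A (of_real r * w\<^sup>2)))" by simp
  also have "\<dots> = norm (eval_fps zc (of_real r)) ^ 3 * norm (eval_fps zc (of_real r * w)) ^ 4 * norm (eval_fps zc (of_real r * w\<^sup>2))"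
    using n1 by (simp add: zc_exp exp_add norm_mult norm_power flip: exp_of_nat_mult)
  finally show ?thesis .
qed

end

lemma inverse_one_minus_X_power:
  fixes d :: nat
  assumes "d > 0"
  shows "inverse (1 - fps_X ^ d :: real fps) = Abs_fps (\<lambda>n. if d dvd n then 1 else 0)"
proof (rule fps_inverse_unique, rule fps_ext)
  fix n
  show "((1 - fps_X ^ d) * Abs_fps (\<lambda>n. if d dvd n then 1 else 0)) $ n = (1 :: real fps) $ n"
    using assms by (auto simp: left_diff_distrib fps_X_power_mult_nth dvd_minus_self dest: dvd_imp_le)
qed

section \<open>The zero-free disc and its consequences for coefficients\<close>

context zeta_like
begin

lemma continuous_Lc: "norm z < Q \<Longrightarrow> isCont (eval_fps Lc) z"
  using has_field_derivative_eval_fps[OF in_radius_Lc] DERIV_isCont by blast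

lemma Lr_summable: "summable (\<lambda>n. norm (Lr $ n))"
  by (rule summable_comparison_test'[of "\<lambda>n. (1 + C * (1 + Q)) * (1 / Q) ^ n" 0])
     (use Lr_bound Q in \<open>auto intro!: summable_mult summable_geometric\<close>)

lemma Lc_one: "eval_fps Lc 1 = of_real \<alpha>"
proof -
  have "(\<lambda>n. Lc $ n * 1 ^ n) sums of_real \<alpha>" using sums_of_real[OF Lr_sums, where 'a = complex] by (simp add: Lc_def)
  then show ?thesis unfolding eval_fps_def by (rule sums_unique[symmetric])
qed

lemma Lc_minus_one: "eval_fps Lc (-1) \<noteq> 0"
proof -
  have "norm (Lr $ n * (-1) ^ n) \<le> norm (Lr $ n)" for n by (simp add: abs_mult)
  then have "summable (\<lambda>n. Lr $ n * (-1) ^ n)"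
    by (rule summable_comparison_test'[OF Lr_summable, of 0])
  then have "(\<lambda>n. complex_of_real (Lr $ n * (-1) ^ n)) sums of_real (suminf (\<lambda>n. Lr $ n * (-1) ^ n))"
    by (intro sums_of_real) (rule summable_sums)
  then have "eval_fps Lc (-1) = of_real (suminf (\<lambda>n. Lr $ n * (-1) ^ n))"
    unfolding eval_fps_def Lc_def by (intro sums_unique[symmetric]) simp
  then show ?thesis using Lr_at_minus_one by simp
qed

text \<open>As \<open>r\<close> tends to 1, a zero at \<open>w\<close> contributes order at least 4
  to the 3-4-1 product against the pole of order 3 at 1, so the product would tend to 0. The factor
  at \<open>w ^ 2\<close> stays bounded only if \<open>w ^ 2 \<noteq> 1\<close>, hence the separate
  treatment of -1.\<close>

lemma Lc_circle:
  assumes w: "norm w = 1"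
  shows "eval_fps Lc w \<noteq> 0"
proof
  assume zero: "eval_fps Lc w = 0"
  have w1: "w \<noteq> 1" using zero Lc_one \<alpha> by auto
  have "w \<noteq> - 1" using zero Lc_minus_one by auto
  then have w2: "w\<^sup>2 \<noteq> 1" using w1 by (simp add: power2_eq_1_iff)
  let ?L = "eval_fps Lc"
  have nQ: "norm (1 * w) < Q" "norm (1 * w\<^sup>2) < Q" "norm (1 :: complex) < Q" using w Q by (auto simp: norm_power)
  have toC: "((\<lambda>r. complex_of_real r * u) \<longlongrightarrow> 1 * u) (at_left 1)" for u
    by (rule tendsto_eq_intros refl tendsto_of_real tendsto_ident_at | simp)+
  have lim: "((\<lambda>r. ?L (of_real r * u)) \<longlongrightarrow> ?L (1 * u)) (at_left 1)" if "norm (1 * u) < Q" for u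
    by (rule isCont_tendsto_compose[OF continuous_Lc[OF that] toC])
  have lim1: "((\<lambda>r. ?L (of_real r)) \<longlongrightarrow> ?L 1) (at_left 1)" using lim[of 1] nQ by simp
  \<comment> \<open>Because of the zero at \<open>w\<close> this is, up to sign, a difference
    quotient along the radius, so it converges.\<close>
  obtain D where D: "((\<lambda>r. ?L (of_real r * w) / (1 - of_real r)) \<longlongrightarrow> D) (at_left 1)"
  proof -
    have "((\<lambda>s. ?L (s * w)) has_field_derivative (eval_fps (fps_deriv Lc) (1 * w) * w)) (at 1)"
      using has_field_derivative_eval_fps[OF in_radius_Lc[OF nQ(1)], of UNIV]
      by (intro DERIV_chain2[where f = ?L and g = "\<lambda>s. s * w"]) (auto intro!: derivative_eq_intros)
    then have "((\<lambda>s. (?L (s * w) - ?L (1 * w)) / (s - 1)) \<longlongrightarrow> eval_fps (fps_deriv Lc) (1 * w) * w) (at 1)"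
      by (simp only: has_field_derivative_iff)
    moreover have "filterlim complex_of_real (at 1) (at_left 1)"
      using toC[of 1] by (auto simp: filterlim_at eventually_at_filter)
    ultimately have "((\<lambda>r. (?L (of_real r * w) - ?L (1 * w)) / (of_real r - 1)) \<longlongrightarrow> eval_fps (fps_deriv Lc) (1 * w) * w) (at_left 1)"
      by (rule filterlim_compose)
    from tendsto_minus[OF this] have "((\<lambda>r. ?L (of_real r * w) / (1 - of_real r)) \<longlongrightarrow> - (eval_fps (fps_deriv Lc) (1 * w) * w)) (at_left 1)"
    proof (rule Lim_transform_eventually)
      have "- (A / (s - 1)) = A / (1 - s)" for A s :: complex by (cases "s = 1") (auto simp: field_simps)
      then show "eventually (\<lambda>r. - ((?L (of_real r * w) - ?L (1 * w)) / (of_real r - 1)) = ?L (of_real r * w) / (1 - of_real r)) (at_left 1)"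
        using zero by simp
    qed
    then show ?thesis by (rule that)
  qed
  have alg: "a ^ 3 * (b / e) ^ 4 * e / u ^ 4 * c / y = (a / e) ^ 3 * (b / u) ^ 4 * (c / y)"
    if "e \<noteq> 0" for a b c e u y :: real
  proof -
    have "e ^ 4 = e ^ 3 * e" by (simp add: eval_nat_numeral)
    then show ?thesis using that by (simp add: power_divide)
  qed
  \<comment> \<open>The 3-4-1 product expressed through \<open>Lc\<close>. Four powers of
    \<open>1 - r\<close> are moved under the vanishing factor, against three from the pole; the
    surplus \<open>1 - r\<close> drives \<open>F\<close> to 0.\<close>
  define F where "F r = norm (?L (of_real r)) ^ 3 * norm (?L (of_real r * w) / (1 - of_real r)) ^ 4 * (1 - r)
      / norm (1 - of_real r * w) ^ 4 * norm (?L (of_real r * w\<^sup>2)) / norm (1 - of_real r * w\<^sup>2)" for r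
  have "(F \<longlongrightarrow> norm (?L 1) ^ 3 * norm D ^ 4 * (1 - 1) / norm (1 - 1 * w) ^ 4 * norm (?L (1 * w\<^sup>2)) / norm (1 - 1 * w\<^sup>2)) (at_left 1)"
    unfolding F_def using w1 w2
    by (intro tendsto_intros lim1 D lim nQ toC) auto
  then have F0: "(F \<longlongrightarrow> 0) (at_left 1)" by simp
  have "eventually (\<lambda>r. r \<in> {0<..<1}) (at_left (1::real))"
    by (rule eventually_at_left_real) simp
  then have "eventually (\<lambda>r. 1 \<le> F r) (at_left 1)"
  proof (rule eventually_mono)
    fix r :: real assume r: "r \<in> {0<..<1}"
    have n1: "norm (complex_of_real r) < 1" "norm (of_real r * w) < 1" "norm (of_real r * w\<^sup>2) < 1"
      using r w by (auto simp: norm_mult norm_power)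
    have nz: "1 - complex_of_real r \<noteq> 0" "1 - of_real r * w \<noteq> 0" "1 - of_real r * w\<^sup>2 \<noteq> 0"
      using n1 by auto
    have z: "norm (eval_fps zc u) = norm (?L u) / norm (1 - u)" if "norm u < 1" "1 - u \<noteq> 0" for u
      using eval_Lc[OF that(1)] that(2) by (simp add: norm_mult)
    have nr: "norm (1 - complex_of_real r) = 1 - r" using r by (metis abs_of_pos diff_gt_0_iff_gt greaterThanLessThan_iff norm_of_real of_real_1 of_real_diff)
    have "F r = (norm (?L (of_real r)) / (1 - r)) ^ 3 * (norm (?L (of_real r * w)) / norm (1 - of_real r * w)) ^ 4
        * (norm (?L (of_real r * w\<^sup>2)) / norm (1 - of_real r * w\<^sup>2))"
      unfolding F_def norm_divide nr using r by (intro alg) auto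
    also have "\<dots> \<ge> 1"
      using three_four_one[of r w] r w z[OF n1(1) nz(1)] z[OF n1(2) nz(2)] z[OF n1(3) nz(3)] nr by simp
    finally show "1 \<le> F r" .
  qed
  then have "(1::real) \<le> 0" using F0 by (intro tendsto_lowerbound[OF F0]) auto
  then show False by simp
qed

lemma Lc_disc: "norm z \<le> 1 \<Longrightarrow> eval_fps Lc z \<noteq> 0"
  using Lc_circle eval_Lc[of z] zc_exp[of z] by (cases "norm z = 1") auto

lemma inverse_Lc: "inverse Lc = Abs_fps (\<lambda>n. of_real (inverse Lr $ n))"
proof (rule fps_inverse_unique)
  have Lr0: "Lr $ 0 \<noteq> 0" by (simp add: Lr_nth)
  show "Lc * Abs_fps (\<lambda>n. of_real (inverse Lr $ n)) = 1"
  proof (rule fps_ext)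
    fix n
    have "(Lc * Abs_fps (\<lambda>n. of_real (inverse Lr $ n))) $ n = of_real ((Lr * inverse Lr) $ n)"
      by (simp add: fps_mult_nth Lc_def)
    also have "Lr * inverse Lr = 1" using inverse_mult_eq_1[OF Lr0] by (simp add: mult.commute)
    finally show "(Lc * Abs_fps (\<lambda>n. of_real (inverse Lr $ n))) $ n = (1 :: complex fps) $ n" by simp
  qed
qed

text \<open>The radius is the modulus of a zero nearest to 0 in a compact disc reaching beyond the
  unit circle, or that of the disc itself if it contains no zero.\<close>

lemma ex_zero_free_radius: "\<exists>R>1. R < Q \<and> (\<forall>z. norm z < R \<longrightarrow> eval_fps Lc z \<noteq> 0)"
proof -
  define R where "R = (1 + Q) / 2"
  have R: "1 < R" "R < Q" using Q by (auto simp: R_def)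
  let ?S = "{z \<in> cball 0 R. eval_fps Lc z = 0}"
  have "continuous_on (cball 0 R) (eval_fps Lc)"
    using R by (intro continuous_at_imp_continuous_on ballI continuous_Lc) auto
  then have "closed ?S" by (intro continuous_closed_preimage_constant) auto
  then have comp: "compact ?S" by (simp add: compact_eq_bounded_closed bounded_subset[OF bounded_cball[of 0 R]] subset_iff)
  show ?thesis
  proof (cases "?S = {}")
    case True
    then show ?thesis using R by (intro exI[of _ R]) force
  next
    case False
    then obtain z0 where z0: "z0 \<in> ?S" "\<And>z. z \<in> ?S \<Longrightarrow> norm z0 \<le> norm z"
      using continuous_attains_inf[OF comp False, of norm] by (auto intro: continuous_on_norm_id)
    have "norm z0 > 1" using z0(1) Lc_disc[of z0] by force
    moreover have "norm z0 < Q" using z0(1) R by auto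
    moreover have "eval_fps Lc z \<noteq> 0" if "norm z < norm z0" for z
      using z0(1) z0(2)[of z] that by force
    ultimately show ?thesis by blast
  qed
qed

text \<open>The reciprocal is analytic in a disc of radius larger than 1, so its power series
  converges absolutely at 1.\<close>

lemma inverse_Lr_summable: "summable (\<lambda>n. \<bar>inverse Lr $ n\<bar>)"
proof -
  obtain R where R: "R > 1" "R < Q" "\<And>z. norm z < R \<Longrightarrow> eval_fps Lc z \<noteq> 0" using ex_zero_free_radius by blast
  have "fps_conv_radius (inverse Lc) \<ge> min (ereal R) (fps_conv_radius Lc)"
    using R(3) by (intro fps_conv_radius_inverse) auto
  moreover have "ereal R \<le> fps_conv_radius Lc" using R(2) conv_radius_Lc by (meson ereal_less_eq(3) less_imp_le order.trans)
  ultimately have "ereal R \<le> fps_conv_radius (inverse Lc)" by (simp add: min_def)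
  moreover have "ereal (norm (1::complex)) < ereal R" using R(1) by simp
  ultimately have "ereal (norm (1::complex)) < conv_radius (fps_nth (inverse Lc))"
    unfolding fps_conv_radius_def by (rule order.strict_trans2[rotated])
  from abs_summable_in_conv_radius[OF this] show ?thesis by (simp add: inverse_Lc)
qed

lemma inverse_Lr_sum: "suminf (\<lambda>n. inverse Lr $ n) = 1 / \<alpha>"
proof -
  have Lr0: "Lr $ 0 \<noteq> 0" by (simp add: Lr_nth)
  have "(\<lambda>n. \<Sum>i\<le>n. Lr $ i * inverse Lr $ (n - i)) sums (suminf (\<lambda>n. Lr $ n) * suminf (\<lambda>n. inverse Lr $ n))"
    using Lr_summable inverse_Lr_summable by (intro Cauchy_product_sums) auto
  moreover have "(\<Sum>i\<le>n. Lr $ i * inverse Lr $ (n - i)) = (1 :: real fps) $ n" for n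
  proof -
    have "Lr * inverse Lr = 1" using inverse_mult_eq_1[OF Lr0] by (simp add: mult.commute)
    from arg_cong[OF this, of "\<lambda>f. f $ n"] show ?thesis by (simp only: fps_mult_nth atLeast0AtMost)
  qed
  moreover have "(\<lambda>n. (1 :: real fps) $ n) sums 1" using sums_single[of 0 "\<lambda>_. 1 :: real"] by (simp add: if_distrib cong: if_cong)
  ultimately have "suminf (\<lambda>n. Lr $ n) * suminf (\<lambda>n. inverse Lr $ n) = 1" by (simp add: sums_unique2)
  then show ?thesis using sums_unique[OF Lr_sums] \<alpha> by (simp add: field_simps)
qed

text \<open>A bound of Chebyshev type: \<open>lr\<close> is
  \<open>X * Lr' / Lr + X / (1 - X)\<close>. The first summand convolves the bounded coefficients of
  \<open>X * Lr'\<close> with summable ones, and the second has coefficients at most 1.\<close>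

lemma lam_bounded: "\<exists>K. \<forall>n. lam n \<le> K"
proof -
  define I where "I = inverse Lr"
  define g where "g = inverse (1 - fps_X :: real fps)"
  have Lr0: "Lr $ 0 \<noteq> 0" by (simp add: Lr_nth)
  have I: "Lr * I = 1" using inverse_mult_eq_1[OF Lr0] by (simp add: I_def mult.commute)
  have g: "(1 - fps_X) * g = 1" "g * (1 - fps_X) = 1" using inverse_mult_eq_1[of "1 - fps_X :: real fps"] by (auto simp: g_def mult.commute)
  have zr: "zr = Lr * g"
  proof -
    have "Lr * g = zr * ((1 - fps_X) * g)" by (simp add: Lr_def mult_ac)
    then show ?thesis by (simp add: g)
  qed
  have dg: "fps_deriv g = g * g"
    unfolding g_def by (subst fps_inverse_deriv) (auto simp: power2_eq_square)
  have "zr * lr = zr * (fps_X * fps_deriv Lr * I + fps_X * g)"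
  proof -
    have "zr * lr = fps_X * fps_deriv zr" by (rule fps_rec[symmetric])
    also have "\<dots> = fps_X * (fps_deriv Lr * g + Lr * (g * g))" by (subst zr) (simp add: dg algebra_simps)
    also have "\<dots> = fps_X * fps_deriv Lr * g * 1 + fps_X * Lr * g * g" by (simp add: algebra_simps)
    also have "\<dots> = fps_X * fps_deriv Lr * g * (Lr * I) + fps_X * Lr * g * g" by (simp only: I)
    also have "\<dots> = zr * (fps_X * fps_deriv Lr * I + fps_X * g)" by (simp add: zr algebra_simps)
    finally show ?thesis .
  qed
  moreover have "zr \<noteq> 0"
  proof
    assume "zr = 0"
    then have "zr $ 0 = 0" by simp
    then show False by (simp add: zr_def \<beta>_0)
  qed
  ultimately have lr: "lr = fps_X * fps_deriv Lr * I + fps_X * g" by simp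
  define K where "K = suminf (\<lambda>n. \<bar>I $ n\<bar>)"
  obtain B where B: "\<And>n. \<bar>(fps_X * fps_deriv Lr) $ n\<bar> \<le> B"
  proof -
    have "(\<lambda>n. (1 + C * (1 + Q)) * (real n * (1 / Q) ^ n)) \<longlonglongrightarrow> (1 + C * (1 + Q)) * 0"
      using Q by (intro tendsto_mult tendsto_const powser_times_n_limit_0) auto
    then have "Bseq (\<lambda>n. (1 + C * (1 + Q)) * (real n * (1 / Q) ^ n))" by (intro convergent_imp_Bseq convergentI)
    then obtain B where B: "\<And>n. norm ((1 + C * (1 + Q)) * (real n * (1 / Q) ^ n)) \<le> B" by (auto simp: Bseq_def)
    have "\<bar>(fps_X * fps_deriv Lr) $ n\<bar> \<le> B" for n
    proof -
      have "(fps_X * fps_deriv Lr) $ n = real n * Lr $ n" by (cases n) auto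
      then have "\<bar>(fps_X * fps_deriv Lr) $ n\<bar> = real n * \<bar>Lr $ n\<bar>" by (simp add: abs_mult)
      also have "\<dots> \<le> real n * ((1 + C * (1 + Q)) * (1 / Q) ^ n)" using Lr_bound by (intro mult_left_mono) auto
      also have "\<dots> \<le> B" using B[of n] by (simp add: mult_ac)
      finally show ?thesis .
    qed
    then show ?thesis by (rule that)
  qed
  have "lam n \<le> B * K + 1" for n
  proof -
    have "lam n = lr $ n" by (simp add: lr_def)
    also have "\<dots> = (fps_X * fps_deriv Lr * I) $ n + (fps_X * g) $ n" by (simp add: lr)
    also have "(fps_X * g) $ n \<le> 1"
      using inverse_one_minus_X_power[of 1] by (cases n) (auto simp: g_def)
    also have "(fps_X * fps_deriv Lr * I) $ n \<le> B * K"
    proof -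
      have "(fps_X * fps_deriv Lr * I) $ n \<le> (\<Sum>i=0..n. \<bar>(fps_X * fps_deriv Lr) $ i\<bar> * \<bar>I $ (n - i)\<bar>)"
        unfolding fps_mult_nth[of "fps_X * fps_deriv Lr"] by (intro sum_mono) (metis abs_ge_self abs_mult)
      also have "\<dots> \<le> (\<Sum>i=0..n. B * \<bar>I $ (n - i)\<bar>)" by (intro sum_mono mult_right_mono B) auto
      also have "\<dots> = B * (\<Sum>i<Suc n. \<bar>I $ i\<bar>)"
        unfolding sum_distrib_left[symmetric]
        by (intro arg_cong[of _ _ "\<lambda>t. B * t"] sum.reindex_bij_witness[of _ "\<lambda>i. n - i" "\<lambda>i. n - i"]) auto
      also have "\<dots> \<le> B * K" unfolding K_def
        using inverse_Lr_summable B[of 0] by (intro mult_left_mono sum_le_suminf) (auto simp: I_def)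
      finally show ?thesis .
    qed
    finally show ?thesis by simp
  qed
  then show ?thesis by blast
qed

end

subsection \<open>Euler products\<close>

definition fps_nn :: "real fps \<Rightarrow> bool" where "fps_nn f \<longleftrightarrow> (\<forall>n. f $ n \<ge> 0)"

lemma fps_nn_mult: "fps_nn f \<Longrightarrow> fps_nn g \<Longrightarrow> fps_nn (f * g)"
  by (auto simp: fps_nn_def fps_mult_nth intro!: sum_nonneg)

lemma fps_nn_1: "fps_nn 1" by (auto simp: fps_nn_def)

lemma fps_nn_X_power: "fps_nn (fps_X ^ n)" by (auto simp: fps_nn_def fps_X_power_nth)

lemma fps_nn_power: "fps_nn f \<Longrightarrow> fps_nn (f ^ n)"
  by (induction n) (auto simp: fps_nn_1 fps_nn_mult)

lemma fps_nn_sum: "(\<And>i. i \<in> I \<Longrightarrow> fps_nn (f i)) \<Longrightarrow> fps_nn (sum f I)"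
  by (auto simp: fps_nn_def fps_sum_nth intro!: sum_nonneg)

lemma fps_nn_prod: "(\<And>i. i \<in> I \<Longrightarrow> fps_nn (f i)) \<Longrightarrow> fps_nn (prod f I)"
  by (induction I rule: infinite_finite_induct) (auto simp: fps_nn_1 fps_nn_mult)

lemma fps_nn_of_nat: "fps_nn (of_nat n)" by (auto simp: fps_nn_def fps_nth_of_nat)

text \<open>Multiplication by such a series leaves all coefficients below \<open>d\<close>
  unchanged, which makes truncated Euler products stabilise.\<close>

definition fps_gap :: "nat \<Rightarrow> real fps \<Rightarrow> bool"
  where "fps_gap d f \<longleftrightarrow> f $ 0 = 1 \<and> (\<forall>n. 0 < n \<and> n < d \<longrightarrow> f $ n = 0)"

lemma fps_gap_mult_nth:
  assumes "fps_gap d g" "n < d"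
  shows "(f * g) $ n = f $ n"
proof -
  have "(f * g) $ n = (\<Sum>i=0..n. if i = n then f $ n else 0)"
    unfolding fps_mult_nth using assms by (intro sum.cong) (auto simp: fps_gap_def)
  then show ?thesis by simp
qed

lemma fps_gap_mult: "fps_gap d f \<Longrightarrow> fps_gap d g \<Longrightarrow> fps_gap d (f * g)"
  unfolding fps_gap_def using fps_gap_mult_nth[of d g] by (auto simp: fps_gap_def)

lemma fps_gap_power: "fps_gap d f \<Longrightarrow> fps_gap d (f ^ k)"
  by (induction k) (auto simp: fps_gap_mult, auto simp: fps_gap_def)

lemma fps_gap_factors:
  assumes "d > 0"
  shows "fps_gap d (1 - fps_X ^ d)" "fps_gap d (inverse (1 - fps_X ^ d))"
  using assms by (auto simp: fps_gap_def fps_X_power_nth inverse_one_minus_X_power dest: dvd_imp_le)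

lemma fps_nn_geometric: "d > 0 \<Longrightarrow> fps_nn (inverse (1 - fps_X ^ d))"
  by (auto simp: fps_nn_def inverse_one_minus_X_power)

lemma geometric_cancel: "d > 0 \<Longrightarrow> inverse (1 - fps_X ^ d) * (1 - fps_X ^ d) = (1 :: real fps)"
  by (rule inverse_mult_eq_1) (auto simp: fps_X_power_nth)

lemma X_deriv_nth: "(fps_X * fps_deriv f) $ n = of_nat n * (f :: real fps) $ n"
  by (cases n) auto

lemma geometric_deriv:
  fixes G :: "real fps"
  assumes d: "d > 0"
  defines "G \<equiv> inverse (1 - fps_X ^ d)"
  shows "fps_X * fps_deriv (G ^ k) = G ^ k * (of_nat (d * k) * (fps_X ^ d * G))"
proof -
  let ?E = "1 - fps_X ^ d :: real fps"
  have GE: "G * ?E = 1" unfolding G_def by (rule geometric_cancel[OF d])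
  have XE: "fps_X * fps_deriv ?E = - (of_nat d * fps_X ^ d)"
    by (rule fps_ext) (auto simp: X_deriv_nth fps_X_power_nth simp flip: fps_of_nat)
  have "fps_deriv (G * ?E) = 0" unfolding GE by simp
  then have "G * fps_deriv ?E + fps_deriv G * ?E = 0" by simp
  then have "fps_X * G * (G * fps_deriv ?E + fps_deriv G * ?E) = 0" by simp
  then have "fps_X * fps_deriv G * (G * ?E) = - (G * G * (fps_X * fps_deriv ?E))" by (simp add: algebra_simps eq_neg_iff_add_eq_0 del: fps_deriv_sub)
  then have base: "fps_X * fps_deriv G = G * (of_nat d * (fps_X ^ d * G))" unfolding GE XE by (simp add: algebra_simps)
  show ?thesis
  proof (induction k)
    case 0
    then show ?case by simp
  next
    case (Suc k)
    have "fps_X * fps_deriv (G ^ Suc k) = (fps_X * fps_deriv G) * G ^ k + G * (fps_X * fps_deriv (G ^ k))"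
      by (simp add: algebra_simps)
    also have "\<dots> = G ^ Suc k * (of_nat (d * Suc k) * (fps_X ^ d * G))"
      unfolding base Suc.IH by (simp add: algebra_simps)
    finally show ?case .
  qed
qed

text \<open>Raising \<open>k\<close> by one adds the single term
  \<open>k * w ^ 2 * G ^ (k + 1)\<close>. With \<open>w\<close> the variable of a prime degree, this
  exhibits the surplus from two or more primes of that degree as a nonnegative series divisible by
  \<open>w ^ 2\<close>.\<close>

lemma geometric_remainder:
  fixes w G :: "real fps"
  assumes G: "G * (1 - w) = 1"
  shows "1 - (1 - of_nat k * w) * G ^ k = w\<^sup>2 * (\<Sum>i<k. of_nat i * G ^ Suc i)"
proof (induction k)
  case 0
  then show ?case by simp
next
  case (Suc k)
  have Gk: "G ^ k = G ^ Suc k * (1 - w)" using G by (simp add: mult.assoc mult.left_commute)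
  have "1 - (1 - of_nat (Suc k) * w) * G ^ Suc k = 1 - (1 - of_nat k * w) * (G ^ Suc k * (1 - w)) + of_nat k * w\<^sup>2 * G ^ Suc k"
    by (simp add: algebra_simps power2_eq_square del: power_Suc)
  also have "\<dots> = w\<^sup>2 * (\<Sum>i<k. of_nat i * G ^ Suc i) + of_nat k * w\<^sup>2 * G ^ Suc k"
    unfolding Gk[symmetric] using Suc.IH by simp
  finally show ?case by (simp add: algebra_simps)
qed

text \<open>Toeplitz's lemma: finitely many rows vanish in the limit individually, and on the others
  \<open>\<epsilon>\<close> is small while the column sums stay below \<open>B\<close>.\<close>

lemma toeplitz_null:
  fixes t :: "nat \<Rightarrow> nat \<Rightarrow> real"
  assumes t: "\<And>m n. t m n \<ge> 0" "\<And>n. (\<Sum>m=1..n. t m n) \<le> B" "\<And>m. t m \<longlonglongrightarrow> 0"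
    and \<epsilon>: "\<epsilon> \<longlonglongrightarrow> 0" "\<And>m. \<epsilon> m \<ge> 0"
  shows "(\<lambda>n. \<Sum>m=1..n. \<epsilon> m * t m n) \<longlonglongrightarrow> 0"
proof (rule LIMSEQ_I)
  fix r :: real assume r: "r > 0"
  have B: "B \<ge> 0" using t(2)[of 0] by simp
  define e where "e = r / (2 * (B + 1))"
  have e: "e > 0" using r B by (simp add: e_def)
  obtain M where M: "\<And>m. m \<ge> M \<Longrightarrow> norm (\<epsilon> m - 0) < e" using LIMSEQ_D[OF \<epsilon>(1) e] by blast
  have "(\<lambda>n. \<Sum>m\<in>{1..M}. \<epsilon> m * t m n) \<longlonglongrightarrow> (\<Sum>m\<in>{1..M}. \<epsilon> m * 0)"
    by (intro tendsto_sum tendsto_mult tendsto_const t)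
  then have "(\<lambda>n. \<Sum>m\<in>{1..M}. \<epsilon> m * t m n) \<longlonglongrightarrow> 0" by simp
  from LIMSEQ_D[OF this, of "r / 2"] obtain N where N: "\<And>n. n \<ge> N \<Longrightarrow> norm ((\<Sum>m\<in>{1..M}. \<epsilon> m * t m n) - 0) < r / 2"
    using r by auto
  have "norm ((\<Sum>m=1..n. \<epsilon> m * t m n) - 0) < r" if n: "n \<ge> N" for n
  proof -
    \<comment> \<open>Enlarging the index set by \<open>{1..M}\<close> makes the first part a sum
      over a range independent of \<open>n\<close>, also when \<open>n < M\<close>.\<close>
    have "(\<Sum>m=1..n. \<epsilon> m * t m n) \<le> (\<Sum>m\<in>{1..M} \<union> {1..n}. if m \<le> M then \<epsilon> m * t m n else e * t m n)"
    proof -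
      have "(\<Sum>m=1..n. \<epsilon> m * t m n) \<le> (\<Sum>m=1..n. if m \<le> M then \<epsilon> m * t m n else e * t m n)"
      proof (rule sum_mono)
        fix m
        show "\<epsilon> m * t m n \<le> (if m \<le> M then \<epsilon> m * t m n else e * t m n)"
          using M[of m] t(1)[of m n] \<epsilon>(2)[of m] by (auto intro!: mult_right_mono)
      qed
      also have "\<dots> \<le> (\<Sum>m\<in>{1..M} \<union> {1..n}. if m \<le> M then \<epsilon> m * t m n else e * t m n)"
        using t(1) \<epsilon>(2) e by (intro sum_mono2) auto
      finally show ?thesis .
    qed
    also have "\<dots> \<le> (\<Sum>m\<in>{1..M} \<union> {1..n}. (if m \<le> M then \<epsilon> m * t m n else 0) + (if m \<le> n then e * t m n else 0))"
      using t(1) \<epsilon>(2) e by (intro sum_mono) auto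
    also have "\<dots> = (\<Sum>m\<in>{1..M}. \<epsilon> m * t m n) + (\<Sum>m=1..n. e * t m n)"
    proof -
      have "(\<Sum>m\<in>{1..M} \<union> {1..n}. if m \<le> M then \<epsilon> m * t m n else 0) = (\<Sum>m\<in>{1..M}. \<epsilon> m * t m n)"
        by (intro sum.mono_neutral_cong_right) auto
      moreover have "(\<Sum>m\<in>{1..M} \<union> {1..n}. if m \<le> n then e * t m n else 0) = (\<Sum>m=1..n. e * t m n)"
        by (intro sum.mono_neutral_cong_right) auto
      ultimately show ?thesis by (simp add: sum.distrib)
    qed
    also have "(\<Sum>m=1..n. e * t m n) \<le> e * B" unfolding sum_distrib_left[symmetric] using t(2) e by (intro mult_left_mono) auto
    also have "e * B \<le> r / 2" using r B by (simp add: e_def field_simps)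
    also have "(\<Sum>m\<in>{1..M}. \<epsilon> m * t m n) < r / 2" using N[OF n] by simp
    finally have "(\<Sum>m=1..n. \<epsilon> m * t m n) < r" by simp
    moreover have "(\<Sum>m=1..n. \<epsilon> m * t m n) \<ge> 0" using t(1) \<epsilon>(2) by (intro sum_nonneg) auto
    ultimately show ?thesis by simp
  qed
  then show "\<exists>N. \<forall>n\<ge>N. norm ((\<Sum>m=1..n. \<epsilon> m * t m n) - 0) < r" by blast
qed

text \<open>Tannery's theorem for the summands extended by 0 beyond \<open>n\<close>, dominated by a
  multiple of \<open>\<bar>c k\<bar>\<close>.\<close>

lemma tendsto_convolution:
  fixes h c :: "nat \<Rightarrow> real"
  assumes h: "h \<longlonglongrightarrow> L" and c: "summable (\<lambda>n. \<bar>c n\<bar>)"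
  shows "(\<lambda>n. \<Sum>i=0..n. h i * c (n - i)) \<longlonglongrightarrow> L * suminf c"
proof -
  obtain B where B: "\<And>n. norm (h n) \<le> B" using convergent_imp_Bseq[OF convergentI[OF h]] by (auto simp: Bseq_def)
  define A where "A k n = (if k \<le> n then h (n - k) * c k else 0)" for k n
  have "(\<lambda>n. suminf (\<lambda>k. A k n)) \<longlonglongrightarrow> suminf (\<lambda>k. L * c k)"
  proof (rule tannerys_theorem[THEN conjunct2, THEN conjunct2])
    fix k
    have "(\<lambda>n. h (n - k) * c k) \<longlonglongrightarrow> L * c k"
    proof (intro tendsto_mult tendsto_const)
      have "(\<lambda>n. h (n + k - k)) \<longlonglongrightarrow> L" using h by simp
      then show "(\<lambda>n. h (n - k)) \<longlonglongrightarrow> L" by (rule LIMSEQ_offset)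
    qed
    moreover have "eventually (\<lambda>n. h (n - k) * c k = A k n) sequentially"
      using eventually_ge_at_top[of k] by eventually_elim (simp add: A_def)
    ultimately show "A k \<longlonglongrightarrow> L * c k" by (rule Lim_transform_eventually)
  next
    have "norm (A k n) \<le> B * \<bar>c k\<bar>" for k n
      using B[of "n - k"] B[of 0] by (auto simp: A_def abs_mult intro!: mult_right_mono)
    then show "eventually (\<lambda>(k, n). norm (A k n) \<le> B * \<bar>c k\<bar>) (at_top \<times>\<^sub>F sequentially)"
      by (intro always_eventually) auto
    show "summable (\<lambda>k. B * \<bar>c k\<bar>)" using c by (rule summable_mult)
  qed auto
  moreover have "suminf (\<lambda>k. A k n) = (\<Sum>i=0..n. h i * c (n - i))" for n
  proof -
    have "suminf (\<lambda>k. A k n) = (\<Sum>k\<in>{0..n}. A k n)" by (rule suminf_finite) (auto simp: A_def)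
    also have "\<dots> = (\<Sum>i=0..n. h i * c (n - i))"
      by (rule sum.reindex_bij_witness[of _ "\<lambda>i. n - i" "\<lambda>i. n - i"]) (auto simp: A_def)
    finally show ?thesis .
  qed
  moreover have "suminf (\<lambda>k. L * c k) = L * suminf c"
    using c by (intro suminf_mult) (rule summable_rabs_cancel)
  ultimately show ?thesis by simp
qed

definition fps_scale :: "real \<Rightarrow> real fps \<Rightarrow> real fps"
  where "fps_scale Q f = Abs_fps (\<lambda>n. f $ n / Q ^ n)"

lemma fps_scale_mult:
  assumes "Q \<noteq> 0"
  shows "fps_scale Q (f * g) = fps_scale Q f * fps_scale Q g"
proof (rule fps_ext)
  fix n
  show "fps_scale Q (f * g) $ n = (fps_scale Q f * fps_scale Q g) $ n"
    unfolding fps_mult_nth fps_scale_def fps_nth_Abs_fps sum_divide_distrib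
  proof (rule sum.cong[OF refl])
    fix i assume "i \<in> {0..n}"
    then have "Q ^ n = Q ^ i * Q ^ (n - i)" by (simp flip: power_add)
    then show "f $ i * g $ (n - i) / Q ^ n = f $ i / Q ^ i * (g $ (n - i) / Q ^ (n - i))" by simp
  qed
qed

text \<open>\<open>a d\<close> is meant as the number of primes of degree \<open>d\<close>. Factors
  beyond \<open>n\<close> cannot affect coefficient \<open>n\<close>, so \<open>asymp\<close> in
  fact describes the full Euler product.\<close>

locale euler_product =
  fixes a :: "nat \<Rightarrow> nat" and Q \<alpha> C :: real
  assumes Q: "Q > 1" and \<alpha>: "\<alpha> > 0"
    and asymp: "\<bar>(\<Prod>d=1..n. inverse (1 - fps_X ^ d :: real fps) ^ a d) $ n - \<alpha> * Q ^ n\<bar> \<le> C"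
begin

definition ZZ :: "nat \<Rightarrow> real fps" where "ZZ m = (\<Prod>d=1..m. inverse (1 - fps_X ^ d) ^ a d)"
definition Z :: "real fps" where "Z = Abs_fps (\<lambda>n. ZZ n $ n)"
text \<open>At \<open>n = 0\<close> the index set is infinite, so \<open>Lam 0 = 0\<close>.\<close>
definition Lam :: "nat \<Rightarrow> real" where "Lam n = (\<Sum>d | d dvd n. real (d * a d))"

lemma ZZ_0: "ZZ 0 = 1" by (simp add: ZZ_def)

lemma ZZ_Suc: "ZZ (Suc m) = ZZ m * inverse (1 - fps_X ^ Suc m) ^ a (Suc m)"
  by (simp add: ZZ_def mult.commute)

lemma ZZ_nn: "fps_nn (ZZ m)"
  unfolding ZZ_def by (intro fps_nn_prod fps_nn_power fps_nn_geometric) auto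

lemma ZZ_stable: "n \<le> m \<Longrightarrow> ZZ m $ n = Z $ n"
proof (induction m rule: dec_induct)
  case base
  then show ?case by (simp add: Z_def)
next
  case (step m)
  then show ?case unfolding ZZ_Suc
    by (subst fps_gap_mult_nth[of "Suc m"]) (auto intro!: fps_gap_power fps_gap_factors simp del: power_Suc)
qed

lemma ZZ_le: "ZZ m $ n \<le> Z $ n"
proof -
  have step: "ZZ m $ n \<le> ZZ (Suc m) $ n" for m
  proof -
    let ?F = "inverse (1 - fps_X ^ Suc m :: real fps) ^ a (Suc m)"
    have F: "fps_nn ?F" "?F $ 0 = 1"
      using fps_gap_power[OF fps_gap_factors(2)[of "Suc m"], of "a (Suc m)"]
      by (auto intro!: fps_nn_power fps_nn_geometric simp: fps_gap_def simp del: power_Suc)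
    have "ZZ m $ n * ?F $ (n - n) \<le> (\<Sum>i=0..n. ZZ m $ i * ?F $ (n - i))"
      using ZZ_nn[of m] F(1) by (intro member_le_sum) (auto simp: fps_nn_def)
    then show ?thesis unfolding ZZ_Suc fps_mult_nth[of "ZZ m"] using F(2) by simp
  qed
  have "ZZ m $ n \<le> ZZ (m + j) $ n" for j
  proof (induction j)
    case (Suc j)
    then show ?case using step[of "m + j"] by simp
  qed simp
  from this[of n] show ?thesis using ZZ_stable[of n "m + n"] by simp
qed

lemma Lam_nonneg: "Lam n \<ge> 0" unfolding Lam_def by (intro sum_nonneg) auto

lemma Lam_0: "Lam 0 = 0" by (simp add: Lam_def)

lemma Lam_ge: "n > 0 \<Longrightarrow> real n * real (a n) \<le> Lam n"
  using member_le_sum[of n "{d. d dvd n}" "\<lambda>d. real (d * a d)"] by (auto simp: Lam_def)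

lemma Lam_double: "Lam m \<le> Lam (2 * m)"
  unfolding Lam_def by (cases "m = 0") (auto intro!: sum_mono2)

text \<open>The logarithmic derivative turns the product into a sum of geometric series, whose
  coefficients up to \<open>n\<close> are \<open>Lam\<close>; the truncation at \<open>n\<close> is
  exact for coefficient \<open>n\<close>.\<close>

lemma Z_rec: "real n * Z $ n = (\<Sum>i=0..n. Z $ i * Lam (n - i))"
proof -
  define D where "D d = of_nat (d * a d) * (fps_X ^ d * inverse (1 - fps_X ^ d :: real fps))" for d
  have deriv: "fps_X * fps_deriv (ZZ m) = ZZ m * (\<Sum>d=1..m. D d)" for m
  proof (induction m)
    case 0
    then show ?case by (simp add: ZZ_0)
  next
    case (Suc m)
    let ?F = "inverse (1 - fps_X ^ Suc m :: real fps) ^ a (Suc m)"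
    have F: "fps_X * fps_deriv ?F = ?F * D (Suc m)" unfolding D_def by (rule geometric_deriv) simp
    have "fps_X * fps_deriv (ZZ (Suc m)) = (fps_X * fps_deriv (ZZ m)) * ?F + ZZ m * (fps_X * fps_deriv ?F)"
      unfolding ZZ_Suc fps_deriv_mult by (simp add: algebra_simps del: power_Suc)
    also have "\<dots> = ZZ (Suc m) * ((\<Sum>d=1..m. D d) + D (Suc m))"
      unfolding Suc.IH F ZZ_Suc by (simp add: algebra_simps del: power_Suc)
    finally show ?case by simp
  qed
  have coeff: "(\<Sum>d=1..n. D d) $ j = Lam j" if "j \<le> n" for j
  proof -
    have "(\<Sum>d=1..n. D d) $ j = (\<Sum>d=1..n. if d \<le> j \<and> d dvd j then real (d * a d) else 0)"
      unfolding fps_sum_nth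
    proof (rule sum.cong[OF refl])
      fix d assume "d \<in> {1..n}"
      then have d: "d > 0" by simp
      show "D d $ j = (if d \<le> j \<and> d dvd j then real (d * a d) else 0)"
        unfolding D_def inverse_one_minus_X_power[OF d] fps_of_nat[symmetric]
        by (auto simp: fps_X_power_mult_nth dvd_minus_self)
    qed
    also have "\<dots> = Lam j"
    proof (cases "j = 0")
      case False
      have "{d. d dvd j} = {d \<in> {1..n}. d \<le> j \<and> d dvd j}" using False that by (auto dest: dvd_imp_le intro: Nat.gr0I)
      then show ?thesis unfolding Lam_def by (subst sum.inter_filter[symmetric]) auto
    qed (auto simp: Lam_0)
    finally show ?thesis .
  qed
  have "real n * Z $ n = (fps_X * fps_deriv (ZZ n)) $ n" by (simp only: X_deriv_nth Z_def fps_nth_Abs_fps)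
  also have "\<dots> = (\<Sum>i=0..n. ZZ n $ i * (\<Sum>d=1..n. D d) $ (n - i))" unfolding deriv by (rule fps_mult_nth)
  also have "\<dots> = (\<Sum>i=0..n. Z $ i * Lam (n - i))" 
  proof (rule sum.cong[OF refl])
    fix i assume "i \<in> {0..n}"
    then show "ZZ n $ i * (\<Sum>d=1..n. D d) $ (n - i) = Z $ i * Lam (n - i)"
      using ZZ_stable[of i n] coeff[of "n - i"] by simp
  qed
  finally show ?thesis .
qed

sublocale zeta_like "\<lambda>n. Z $ n / Q ^ n" "\<lambda>n. Lam n / Q ^ n" Q \<alpha> C
proof
  have Qn: "Q ^ n > 0" for n using Q by simp
  show "Q > 1" "\<alpha> > 0" by (fact Q \<alpha>)+
  show "Z $ 0 / Q ^ 0 = 1" by (simp add: Z_def ZZ_0)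
  show "Lam 0 / Q ^ 0 = 0" by (simp add: Lam_0)
  show "Lam n / Q ^ n \<ge> 0" for n using Lam_nonneg Qn[of n] by simp
  show "Lam m / Q ^ m \<le> Lam (2 * m) / Q ^ (2 * m) * Q ^ m" for m
  proof -
    have "Q ^ (2 * m) = Q ^ m * Q ^ m" by (simp add: mult_2 power_add)
    then have "Lam (2 * m) / Q ^ (2 * m) * Q ^ m = Lam (2 * m) / Q ^ m" using Qn[of m] by simp
    then show ?thesis using Lam_double[of m] Qn[of m] by (simp add: divide_right_mono)
  qed
  show "real n * (Z $ n / Q ^ n) = (\<Sum>i=0..n. Z $ i / Q ^ i * (Lam (n - i) / Q ^ (n - i)))" for n
  proof -
    have "real n * (Z $ n / Q ^ n) = (\<Sum>i=0..n. Z $ i * Lam (n - i) / Q ^ n)"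
      using Z_rec[of n] by (simp add: sum_divide_distrib[symmetric])
    also have "\<dots> = (\<Sum>i=0..n. Z $ i / Q ^ i * (Lam (n - i) / Q ^ (n - i)))"
    proof (rule sum.cong[OF refl])
      fix i assume "i \<in> {0..n}"
      then have "Q ^ n = Q ^ i * Q ^ (n - i)" by (simp flip: power_add)
      then show "Z $ i * Lam (n - i) / Q ^ n = Z $ i / Q ^ i * (Lam (n - i) / Q ^ (n - i))" by simp
    qed
    finally show ?thesis .
  qed
  show "\<bar>Z $ n / Q ^ n - \<alpha>\<bar> \<le> C * (1 / Q) ^ n" for n
  proof -
    have "Z $ n / Q ^ n - \<alpha> = (Z $ n - \<alpha> * Q ^ n) / Q ^ n" using Q by (simp add: diff_divide_distrib)
    then have "\<bar>Z $ n / Q ^ n - \<alpha>\<bar> = \<bar>Z $ n - \<alpha> * Q ^ n\<bar> / Q ^ n" using Q by (simp add: abs_divide)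
    also have "\<dots> \<le> C / Q ^ n" using asymp[of n] Q by (intro divide_right_mono) (auto simp: Z_def ZZ_def)
    finally show ?thesis by (simp add: power_divide)
  qed
qed

text \<open>Among the divisors of \<open>m\<close>, the summand of \<open>Lam m\<close> at
  \<open>m\<close> alone is \<open>m * a m\<close>, and \<open>Lam\<close> is bounded by a multiple
  of \<open>Q ^ m\<close>.\<close>

lemma a_bound: "\<exists>K\<ge>0. \<forall>m>0. real (a m) / Q ^ m \<le> K / real m"
proof -
  obtain K where K: "\<And>n. Lam n / Q ^ n \<le> K" using lam_bounded by blast
  have "real (a m) / Q ^ m \<le> K / real m" if "m > 0" for m
  proof -
    have "real m * real (a m) / Q ^ m \<le> Lam m / Q ^ m" using Lam_ge[OF that] Q by (intro divide_right_mono) auto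
    also have "\<dots> \<le> K" by (rule K)
    finally show ?thesis using that by (simp add: field_simps)
  qed
  moreover have "K \<ge> 0" using K[of 0] by (simp add: Lam_0)
  ultimately show ?thesis by blast
qed

text \<open>A finite Euler product converges in the open unit disc, in particular at
  \<open>1 / Q\<close>. Divisors with only small primes are thus negligible.\<close>

lemma ZZ_null: "(\<lambda>n. ZZ m $ n / Q ^ n) \<longlonglongrightarrow> 0"
proof -
  have geo: "fps_conv_radius (inverse (1 - fps_X ^ d) :: real fps) \<ge> 1" if "d > 0" for d :: nat
  proof -
    have "fps_conv_radius (inverse (1 - fps_X ^ d) :: real fps) \<ge> ereal 1"
      unfolding fps_conv_radius_def
      by (rule conv_radius_ge_geometric[where C = 1]) (auto simp: inverse_one_minus_X_power[OF that])
    then show ?thesis by (simp add: one_ereal_def)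
  qed
  have "fps_conv_radius (ZZ m) \<ge> 1"
  proof (induction m)
    case 0
    then show ?case by (simp add: ZZ_0)
  next
    case (Suc m)
    have "1 \<le> fps_conv_radius (inverse (1 - fps_X ^ Suc m :: real fps) ^ a (Suc m))"
      by (rule order.trans[OF geo fps_conv_radius_power]) simp
    then show ?case unfolding ZZ_Suc using Suc.IH fps_conv_radius_mult by (meson min.boundedI order.trans)
  qed
  moreover have "ereal (norm (1 / Q)) < 1" using Q by (simp add: one_ereal_def)
  ultimately have "summable (\<lambda>n. ZZ m $ n * (1 / Q) ^ n)"
    by (intro summable_fps) (rule order.strict_trans2)
  from summable_LIMSEQ_zero[OF this] show ?thesis by (simp add: power_divide)
qed

lemma XZZ_null: "(\<lambda>n. (fps_X ^ j * ZZ m) $ n / Q ^ n) \<longlonglongrightarrow> 0"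
proof -
  have "(\<lambda>n. (fps_X ^ j * ZZ m) $ (n + j) / Q ^ (n + j)) = (\<lambda>n. (ZZ m $ n / Q ^ n) * (1 / Q ^ j))"
    by (auto simp: fps_X_power_mult_nth power_add)
  moreover have "(\<lambda>n. (ZZ m $ n / Q ^ n) * (1 / Q ^ j)) \<longlonglongrightarrow> 0"
    using tendsto_mult[OF ZZ_null[of m] tendsto_const[of "1 / Q ^ j"]] by simp
  ultimately have "(\<lambda>n. (fps_X ^ j * ZZ m) $ (n + j) / Q ^ (n + j)) \<longlonglongrightarrow> 0" by simp
  then show ?thesis by (rule LIMSEQ_offset)
qed

definition R :: "nat \<Rightarrow> real fps"
  where "R m = of_nat (a m) * (fps_X ^ m * ZZ m) - (ZZ m - ZZ (m - 1))"

text \<open>\<open>R m\<close> counts the divisors with maximal prime degree \<open>m\<close>, weighted by the number of their prime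
  factors of degree \<open>m\<close> in excess of one.\<close>

lemma R_bounds:
  assumes m: "m > 0"
  shows "0 \<le> R m $ n" "R m $ n \<le> real (a m) ^ 2 * (fps_X ^ (2 * m) * ZZ m) $ n"
proof -
  define G where "G = inverse (1 - fps_X ^ m :: real fps)"
  have Gnn: "fps_nn G" unfolding G_def by (rule fps_nn_geometric[OF m])
  have GE: "G * (1 - fps_X ^ m) = 1" unfolding G_def by (rule geometric_cancel[OF m])
  have Zm: "ZZ m = ZZ (m - 1) * G ^ a m" using ZZ_Suc[of "m - 1"] m by (simp add: G_def)
  define S where "S = (\<Sum>i<a m. of_nat i * G ^ Suc i)"
  \<comment> \<open>Factoring out the primes below \<open>m\<close> leaves the left side of
    \<open>geometric_remainder\<close>, which provides the nonnegativity and the factor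
    \<open>X ^ (2 * m)\<close>.\<close>
  have "R m = ZZ (m - 1) * (1 - (1 - of_nat (a m) * fps_X ^ m) * G ^ a m)"
    unfolding R_def Zm by (simp add: algebra_simps)
  also have "\<dots> = ZZ (m - 1) * ((fps_X ^ m)\<^sup>2 * S)" unfolding geometric_remainder[OF GE] S_def ..
  finally have RS: "R m = ZZ (m - 1) * ((fps_X ^ m)\<^sup>2 * S)" .
  have Snn: "fps_nn S" unfolding S_def by (intro fps_nn_sum fps_nn_mult fps_nn_of_nat fps_nn_power Gnn)
  show "0 \<le> R m $ n"
    using fps_nn_mult[OF ZZ_nn[of "m - 1"] fps_nn_mult[OF fps_nn_power[OF fps_nn_X_power] Snn]] unfolding RS fps_nn_def by blast
  have Gmono: "G ^ i $ n \<le> G ^ (i + j) $ n" for i j n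
  proof -
    have "(G ^ j) $ 0 = 1"
      using fps_gap_power[OF fps_gap_factors(2)[OF m]] by (simp add: G_def fps_gap_def)
    moreover have "G ^ i $ n * G ^ j $ (n - n) \<le> (\<Sum>l=0..n. G ^ i $ l * G ^ j $ (n - l))"
      using fps_nn_power[OF Gnn] by (intro member_le_sum) (auto simp: fps_nn_def)
    ultimately show ?thesis by (simp add: power_add fps_mult_nth)
  qed
  \<comment> \<open>There are \<open>a m\<close> summands, each with a factor below
    \<open>a m\<close>, and the coefficients of powers of \<open>G\<close> increase with the
    exponent.\<close>
  have Sle: "S $ n \<le> real (a m) ^ 2 * G ^ a m $ n" for n
  proof -
    have "S $ n = (\<Sum>i<a m. real i * G ^ Suc i $ n)"
      unfolding S_def fps_sum_nth by (intro sum.cong) (auto simp flip: fps_of_nat)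
    also have "\<dots> \<le> (\<Sum>i<a m. real (a m) * G ^ a m $ n)"
    proof (rule sum_mono)
      fix i assume i: "i \<in> {..<a m}"
      have "G ^ Suc i $ n \<le> G ^ a m $ n" using Gmono[of "Suc i" n "a m - Suc i"] i by (simp only: le_add_diff_inverse lessThan_iff Suc_le_eq)
      then show "real i * G ^ Suc i $ n \<le> real (a m) * G ^ a m $ n"
        using i fps_nn_power[OF Gnn, of "Suc i"] by (intro mult_mono) (auto simp: fps_nn_def simp del: power_Suc)
    qed
    also have "\<dots> = real (a m) ^ 2 * G ^ a m $ n" by (simp add: power2_eq_square)
    finally show ?thesis .
  qed
  let ?Y = "ZZ (m - 1) * (fps_X ^ m)\<^sup>2"
  have Y: "fps_nn ?Y" by (intro fps_nn_mult ZZ_nn fps_nn_power fps_nn_X_power)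
  have "R m $ n = (?Y * S) $ n" by (simp add: RS mult.assoc)
  also have "\<dots> \<le> (\<Sum>i=0..n. ?Y $ i * (real (a m) ^ 2 * G ^ a m $ (n - i)))"
    unfolding fps_mult_nth[of ?Y] using Y Sle by (intro sum_mono mult_left_mono) (auto simp: fps_nn_def)
  also have "\<dots> = real (a m) ^ 2 * (?Y * G ^ a m) $ n"
    unfolding fps_mult_nth[of ?Y] sum_distrib_left by (intro sum.cong) auto
  also have "?Y * G ^ a m = fps_X ^ (2 * m) * ZZ m"
    unfolding Zm by (simp add: power_mult[symmetric] mult.commute mult.left_commute)
  finally show "R m $ n \<le> real (a m) ^ 2 * (fps_X ^ (2 * m) * ZZ m) $ n" .
qed

text \<open>Tannery's theorem: each fixed \<open>m\<close> contributes 0 in the limit by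
  \<open>XZZ_null\<close>, and the square of \<open>a_bound\<close> gives the summable majorant
  \<open>1 / m ^ 2\<close> up to a constant.\<close>

lemma R_sum_null: "(\<lambda>n. (\<Sum>m=1..n. R m $ n) / Q ^ n) \<longlonglongrightarrow> 0"
proof -
  obtain K where K: "K \<ge> 0" "\<And>m. m > 0 \<Longrightarrow> real (a m) / Q ^ m \<le> K / real m" using a_bound by blast
  define A where "A m n = (if 1 \<le> m \<and> m \<le> n then R m $ n / Q ^ n else 0)" for m n
  have bd: "(fps_X ^ (2 * m) * ZZ m) $ n / Q ^ n \<le> (\<alpha> + C) / Q ^ (2 * m)" for m n
  proof (cases "n < 2 * m")
    case True
    have "\<alpha> + C \<ge> 0" using \<beta>_bound[of 0] \<beta>_nonneg[of 0] by simp
    then show ?thesis using True Q by (simp add: fps_X_power_mult_nth)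
  next
    case False
    then have n: "Q ^ n = Q ^ (n - 2 * m) * Q ^ (2 * m)" by (simp flip: power_add)
    have "(fps_X ^ (2 * m) * ZZ m) $ n / Q ^ n = ZZ m $ (n - 2 * m) / Q ^ (n - 2 * m) / Q ^ (2 * m)"
      using False by (simp add: fps_X_power_mult_nth n)
    also have "\<dots> \<le> Z $ (n - 2 * m) / Q ^ (n - 2 * m) / Q ^ (2 * m)"
      using Q ZZ_le by (intro divide_right_mono) auto
    also have "\<dots> \<le> (\<alpha> + C) / Q ^ (2 * m)" using Q \<beta>_bound by (intro divide_right_mono) auto
    finally show ?thesis .
  qed
  have "(\<lambda>n. suminf (\<lambda>m. A m n)) \<longlonglongrightarrow> suminf (\<lambda>m. 0)"
  proof (rule tannerys_theorem[THEN conjunct2, THEN conjunct2])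
    fix m
    have "(\<lambda>n. real (a m) ^ 2 * ((fps_X ^ (2 * m) * ZZ m) $ n / Q ^ n)) \<longlonglongrightarrow> real (a m) ^ 2 * 0"
      by (intro tendsto_mult tendsto_const XZZ_null)
    then have lim: "(\<lambda>n. real (a m) ^ 2 * ((fps_X ^ (2 * m) * ZZ m) $ n / Q ^ n)) \<longlonglongrightarrow> 0" by simp
    show "A m \<longlonglongrightarrow> 0"
    proof (rule Lim_null_comparison[OF always_eventually lim], rule allI)
      fix n
      have "0 \<le> (fps_X ^ (2 * m) * ZZ m) $ n" using fps_nn_mult[OF fps_nn_X_power ZZ_nn] unfolding fps_nn_def by blast
      then show "norm (A m n) \<le> real (a m) ^ 2 * ((fps_X ^ (2 * m) * ZZ m) $ n / Q ^ n)"
        using R_bounds[of m n] Q by (auto simp: A_def divide_simps)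
    qed
  next
    have "norm (A m n) \<le> K\<^sup>2 * (\<alpha> + C) * (1 / real m ^ 2)" for m n
    proof (cases "1 \<le> m \<and> m \<le> n")
      case True
      then have m: "m > 0" by simp
      have "norm (A m n) = R m $ n / Q ^ n" using True R_bounds(1)[OF m, of n] Q by (simp add: A_def)
      also have "\<dots> \<le> real (a m) ^ 2 * (fps_X ^ (2 * m) * ZZ m) $ n / Q ^ n"
        using R_bounds(2)[OF m, of n] Q by (intro divide_right_mono) auto
      also have "\<dots> \<le> real (a m) ^ 2 * ((\<alpha> + C) / Q ^ (2 * m))"
        using bd[of m n] by (simp only: times_divide_eq_right[symmetric]) (intro mult_left_mono, auto)
      also have "\<dots> = (real (a m) / Q ^ m) ^ 2 * (\<alpha> + C)" by (simp add: power_divide power_mult[symmetric] mult.commute)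
      also have "\<dots> \<le> (K / real m) ^ 2 * (\<alpha> + C)"
        using K(2)[OF m] Q \<beta>_bound[of 0] \<beta>_nonneg[of 0] by (intro mult_right_mono power_mono) auto
      finally show ?thesis by (simp add: power_divide)
    next
      case False
      have "\<alpha> + C \<ge> 0" using \<beta>_bound[of 0] \<beta>_nonneg[of 0] by simp
      then show ?thesis using False by (auto simp: A_def)
    qed
    then show "eventually (\<lambda>(m, n). norm (A m n) \<le> K\<^sup>2 * (\<alpha> + C) * (1 / real m ^ 2)) (at_top \<times>\<^sub>F sequentially)"
      by (intro always_eventually) auto
    show "summable (\<lambda>m. K\<^sup>2 * (\<alpha> + C) * (1 / real m ^ 2))"
      using inverse_power_summable[of 2, where 'a = real] by (intro summable_mult) (simp add: inverse_eq_divide)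
  qed auto
  moreover have "suminf (\<lambda>m. A m n) = (\<Sum>m=1..n. R m $ n) / Q ^ n" for n
  proof -
    have "suminf (\<lambda>m. A m n) = (\<Sum>m\<in>{1..n}. A m n)" by (rule suminf_finite) (auto simp: A_def)
    then show ?thesis by (simp add: A_def sum_divide_distrib)
  qed
  ultimately show ?thesis by simp
qed

text \<open>The differences \<open>ZZ m - ZZ (m - 1)\<close> sort all divisors by their top prime
  degree and telescope to \<open>Z\<close>; \<open>R m\<close> corrects for repeated
  counting.\<close>

lemma top_weight_sum: "n > 0 \<Longrightarrow> (\<Sum>m=1..n. real (a m) * (fps_X ^ m * ZZ m) $ n) = Z $ n + (\<Sum>m=1..n. R m $ n)"
proof -
  assume n: "n > 0"
  have "(\<Sum>m=1..k. (ZZ m - ZZ (m - 1)) $ n) = (ZZ k - ZZ 0) $ n" for k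
    by (induction k) auto
  then have "(\<Sum>m=1..n. (ZZ m - ZZ (m - 1)) $ n) = Z $ n" using n by (simp add: ZZ_0 Z_def)
  moreover have "real (a m) * (fps_X ^ m * ZZ m) $ n = (ZZ m - ZZ (m - 1)) $ n + R m $ n" for m
    unfolding R_def by (simp flip: fps_of_nat)
  ultimately show ?thesis by (simp add: sum.distrib)
qed

lemma top_weight_lim: "(\<lambda>n. (\<Sum>m=1..n. real (a m) * (fps_X ^ m * ZZ m) $ n) / Q ^ n) \<longlonglongrightarrow> \<alpha>"
proof -
  have "(\<lambda>n. Z $ n / Q ^ n + (\<Sum>m=1..n. R m $ n) / Q ^ n) \<longlonglongrightarrow> \<alpha> + 0"
    by (intro tendsto_add \<beta>_lim R_sum_null)
  moreover have "eventually (\<lambda>n. Z $ n / Q ^ n + (\<Sum>m=1..n. R m $ n) / Q ^ n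
      = (\<Sum>m=1..n. real (a m) * (fps_X ^ m * ZZ m) $ n) / Q ^ n) sequentially"
    using eventually_gt_at_top[of 0] by eventually_elim (simp only: top_weight_sum add_divide_distrib)
  ultimately show ?thesis using Lim_transform_eventually by fastforce
qed

text \<open>Replacing \<open>s m\<close> by \<open>\<delta> * a m\<close> changes the sum by terms
  weighted with the deviation of the ratio from \<open>\<delta>\<close>; this deviation tends to 0,
  so Toeplitz's lemma applies.\<close>

lemma weighted_top_lim:
  fixes s :: "nat \<Rightarrow> real"
  assumes s: "\<And>m. 0 \<le> s m" "\<And>m. s m \<le> real (a m)" and \<delta>: "(\<lambda>m. s m / real (a m)) \<longlonglongrightarrow> \<delta>"
  shows "(\<lambda>n. (\<Sum>m=1..n. s m * (fps_X ^ m * ZZ m) $ n) / Q ^ n) \<longlonglongrightarrow> \<alpha> * \<delta>"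
proof -
  define t where "t m n = real (a m) * (fps_X ^ m * ZZ m) $ n / Q ^ n" for m n
  have nn: "0 \<le> (fps_X ^ m * ZZ m) $ n" for m n using fps_nn_mult[OF fps_nn_X_power ZZ_nn] unfolding fps_nn_def by blast
  define \<epsilon> where "\<epsilon> m = \<bar>s m / real (a m) - \<delta>\<bar>" for m
  have sum_t: "(\<Sum>m=1..n. t m n) = (\<Sum>m=1..n. real (a m) * (fps_X ^ m * ZZ m) $ n) / Q ^ n" for n
    by (simp add: t_def sum_divide_distrib)
  obtain B where B: "\<And>n. norm (\<Sum>m=1..n. t m n) \<le> B"
    using convergent_imp_Bseq[OF convergentI[OF top_weight_lim]] unfolding sum_t[symmetric] by (auto simp: Bseq_def)
  have lim: "(\<lambda>n. \<Sum>m=1..n. \<epsilon> m * t m n) \<longlonglongrightarrow> 0"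
  proof (rule toeplitz_null)
    show "0 \<le> t m n" for m n using nn[of m n] Q by (simp add: t_def)
    show "(\<Sum>m=1..n. t m n) \<le> B" for n using B[of n] by simp
    have "(\<lambda>n. real (a m) * ((fps_X ^ m * ZZ m) $ n / Q ^ n)) \<longlonglongrightarrow> real (a m) * 0" for m
      by (intro tendsto_mult tendsto_const XZZ_null)
    then show "t m \<longlonglongrightarrow> 0" for m unfolding t_def by simp
    show "\<epsilon> \<longlonglongrightarrow> 0" unfolding \<epsilon>_def using \<delta> by (simp add: LIM_zero tendsto_rabs_zero)
  qed (auto simp: \<epsilon>_def)
  have bnd: "norm ((\<Sum>m=1..n. s m * (fps_X ^ m * ZZ m) $ n) / Q ^ n - \<delta> * (\<Sum>m=1..n. t m n)) \<le> (\<Sum>m=1..n. \<epsilon> m * t m n)" for n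
  proof -
    have "(\<Sum>m=1..n. s m * (fps_X ^ m * ZZ m) $ n) / Q ^ n - \<delta> * (\<Sum>m=1..n. t m n)
        = (\<Sum>m=1..n. (s m - \<delta> * real (a m)) * ((fps_X ^ m * ZZ m) $ n / Q ^ n))"
      unfolding t_def sum_divide_distrib sum_distrib_left sum_subtractf[symmetric] by (intro sum.cong) (auto simp: algebra_simps diff_divide_distrib)
    also have "norm \<dots> \<le> (\<Sum>m=1..n. \<epsilon> m * t m n)"
    proof (rule sum_norm_le)
      fix m
      \<comment> \<open>Where \<open>a m = 0\<close> the ratio is the default 0, but then
        \<open>s m = 0\<close> and both sides vanish.\<close>
      have "\<bar>s m - \<delta> * real (a m)\<bar> = \<epsilon> m * real (a m)"
      proof (cases "a m = 0")
        case True
        then show ?thesis using s(1)[of m] s(2)[of m] by simp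
      next
        case False
        then have "s m - \<delta> * real (a m) = (s m / real (a m) - \<delta>) * real (a m)" by (simp add: field_simps)
        then show ?thesis by (simp add: \<epsilon>_def abs_mult)
      qed
      then show "norm ((s m - \<delta> * real (a m)) * ((fps_X ^ m * ZZ m) $ n / Q ^ n)) \<le> \<epsilon> m * t m n"
        using nn[of m n] Q by (simp add: abs_mult t_def)
    qed
    finally show ?thesis .
  qed
  have 1: "(\<lambda>n. (\<Sum>m=1..n. s m * (fps_X ^ m * ZZ m) $ n) / Q ^ n - \<delta> * (\<Sum>m=1..n. t m n)) \<longlonglongrightarrow> 0"
    by (rule Lim_null_comparison[OF always_eventually lim], rule allI, rule bnd)
  have 2: "(\<lambda>n. \<delta> * (\<Sum>m=1..n. t m n)) \<longlonglongrightarrow> \<delta> * \<alpha>"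
    unfolding sum_t by (intro tendsto_mult tendsto_const top_weight_lim)
  show ?thesis using tendsto_add[OF 1 2] by (simp add: mult.commute)
qed

text \<open>The generating series of the Moebius function over divisors whose primes have degrees
  above \<open>m\<close> and at most \<open>N\<close>: the reciprocal of a segment of the Euler
  product.\<close>

definition IZ :: "nat \<Rightarrow> nat \<Rightarrow> real fps" where "IZ m N = (\<Prod>d\<in>{m<..N}. (1 - fps_X ^ d) ^ a d)"

lemma IZ_stable:
  assumes "m \<le> j" "i \<le> j" "j \<le> N"
  shows "IZ m N $ i = IZ m j $ i"
  using assms(3)
proof (induction N rule: dec_induct)
  case (step N)
  have "{m<..Suc N} = insert (Suc N) {m<..N}" using step assms by auto
  then have "IZ m (Suc N) = IZ m N * (1 - fps_X ^ Suc N) ^ a (Suc N)" by (simp add: IZ_def mult.commute)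
  then show ?case using step assms fps_gap_mult_nth[OF fps_gap_power[OF fps_gap_factors(1)[of "Suc N"]], of i "IZ m N" "a (Suc N)"] by simp
qed simp

lemma IZ_ZZ:
  assumes "m \<le> N"
  shows "IZ m N * ZZ N = ZZ m"
proof -
  have eq: "{1..N} = {1..m} \<union> {m<..N}" using assms by auto
  have "ZZ N = ZZ m * (\<Prod>d\<in>{m<..N}. inverse (1 - fps_X ^ d) ^ a d)"
    unfolding ZZ_def eq by (rule prod.union_disjoint) auto
  then have "IZ m N * ZZ N = ZZ m * (\<Prod>d\<in>{m<..N}. (inverse (1 - fps_X ^ d) * (1 - fps_X ^ d)) ^ a d)"
    by (simp add: IZ_def power_mult_distrib prod.distrib mult_ac)
  also have "(\<Prod>d\<in>{m<..N}. (inverse (1 - fps_X ^ d) * (1 - fps_X ^ d :: real fps)) ^ a d) = 1"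
    by (intro prod.neutral ballI) (simp add: geometric_cancel)
  finally show ?thesis by simp
qed

theorem alladi_limit:
  fixes s :: "nat \<Rightarrow> real"
  assumes s: "\<And>m. 0 \<le> s m" "\<And>m. s m \<le> real (a m)" and \<delta>: "(\<lambda>m. s m / real (a m)) \<longlonglongrightarrow> \<delta>"
  shows "(\<lambda>n. \<Sum>j=0..n. (\<Sum>m=1..j. s m * IZ m j $ (j - m)) / Q ^ j) \<longlonglongrightarrow> \<delta>"
proof -
  define G where "G = Abs_fps (\<lambda>j. \<Sum>m=1..j. s m * IZ m j $ (j - m))"
  define H where "H = Abs_fps (\<lambda>n. \<Sum>m=1..n. s m * (fps_X ^ m * ZZ m) $ n)"
  \<comment> \<open>The duality between smallest and largest primes: multiplication by the zeta
    series cancels the factors above \<open>m\<close> and leaves the divisors with primes of degree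
    at most \<open>m\<close>.\<close>
  have GZ: "G * Z = H"
  proof (rule fps_ext)
    fix n
    have G: "G $ j = (\<Sum>m=1..n. s m * (fps_X ^ m * IZ m n) $ j)" if "j \<le> n" for j
    proof -
      have "(\<Sum>m=1..n. s m * (fps_X ^ m * IZ m n) $ j) = (\<Sum>m=1..j. s m * (fps_X ^ m * IZ m n) $ j)"
        using that by (intro sum.mono_neutral_right) (auto simp: fps_X_power_mult_nth)
      also have "\<dots> = (\<Sum>m=1..j. s m * IZ m j $ (j - m))"
        using that by (intro sum.cong) (auto simp: fps_X_power_mult_nth intro!: IZ_stable)
      finally show ?thesis by (simp add: G_def)
    qed
    have "(G * Z) $ n = (\<Sum>j=0..n. (\<Sum>m=1..n. s m * (fps_X ^ m * IZ m n) $ j) * ZZ n $ (n - j))"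
      unfolding fps_mult_nth[of G] by (intro sum.cong) (auto simp: G ZZ_stable)
    also have "\<dots> = (\<Sum>j=0..n. \<Sum>m=1..n. s m * ((fps_X ^ m * IZ m n) $ j * ZZ n $ (n - j)))"
      by (simp add: sum_distrib_right mult.assoc)
    also have "\<dots> = (\<Sum>m=1..n. s m * (fps_X ^ m * IZ m n * ZZ n) $ n)"
      unfolding fps_mult_nth[of "fps_X ^ _ * IZ _ _"] sum_distrib_left by (rule sum.swap)
    also have "\<dots> = H $ n"
      by (simp add: H_def mult.assoc IZ_ZZ)
    finally show "(G * Z) $ n = H $ n" .
  qed
  have Q0: "Q \<noteq> 0" using Q by simp
  have zr: "zr = fps_scale Q Z" by (simp add: zr_def fps_scale_def)
  define g where "g = inverse (1 - fps_X :: real fps)"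
  have g: "(1 - fps_X) * g = 1" using inverse_mult_eq_1[of "1 - fps_X :: real fps"] by (simp add: g_def mult.commute)
  have Lr0: "Lr $ 0 \<noteq> 0" by (simp add: Lr_nth)
  have LI: "Lr * inverse Lr = 1" using inverse_mult_eq_1[OF Lr0] by (simp add: mult.commute)
  have "zr * inverse Lr = zr * inverse Lr * ((1 - fps_X) * g)" by (simp add: g)
  also have "\<dots> = (Lr * inverse Lr) * g" by (simp add: Lr_def mult_ac)
  finally have zg: "zr * inverse Lr = g" by (simp add: LI)
  have "fps_scale Q G * g = fps_scale Q G * zr * inverse Lr" by (simp add: zg mult.assoc)
  also have "\<dots> = fps_scale Q H * inverse Lr" by (simp add: zr GZ flip: fps_scale_mult[OF Q0])
  \<comment> \<open>The factor \<open>g\<close> on the left forms partial sums; on the right stands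
    the convolution whose limit is known.\<close>
  finally have GH: "fps_scale Q G * g = fps_scale Q H * inverse Lr" .
  have "(\<Sum>j=0..n. (\<Sum>m=1..j. s m * IZ m j $ (j - m)) / Q ^ j) = (\<Sum>i=0..n. H $ i / Q ^ i * inverse Lr $ (n - i))" for n
  proof -
    have "(\<Sum>j=0..n. (\<Sum>m=1..j. s m * IZ m j $ (j - m)) / Q ^ j) = (fps_scale Q G * g) $ n"
      using inverse_one_minus_X_power[of 1] by (simp add: fps_mult_nth g_def fps_scale_def G_def)
    then show ?thesis unfolding GH by (simp add: fps_mult_nth fps_scale_def)
  qed
  moreover have "(\<lambda>n. \<Sum>i=0..n. H $ i / Q ^ i * inverse Lr $ (n - i)) \<longlonglongrightarrow> (\<alpha> * \<delta>) * suminf (fps_nth (inverse Lr))"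
    using weighted_top_lim[OF s \<delta>] inverse_Lr_summable by (intro tendsto_convolution) (auto simp: H_def)
  moreover have "(\<alpha> * \<delta>) * suminf (fps_nth (inverse Lr)) = \<delta>" using inverse_Lr_sum \<alpha> by simp
  ultimately show ?thesis by simp
qed

end

subsection \<open>From divisors to Euler products\<close>

lemma prod_one_minus_X_power:
  fixes wt :: "'p \<Rightarrow> nat"
  assumes "finite A"
  shows "(\<Prod>P\<in>A. 1 - fps_X ^ wt P :: real fps) = (\<Sum>T\<in>Pow A. (-1) ^ card T * fps_X ^ (\<Sum>P\<in>T. wt P))"
  using assms
proof (induction A rule: finite_induct)
  case (insert P A)
  have inj: "inj_on (insert P) (Pow A)" using insert by (auto simp: inj_on_def)
  have disj: "Pow A \<inter> insert P ` Pow A = {}" using insert by auto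
  have "(\<Sum>T\<in>insert P ` Pow A. (-1) ^ card T * fps_X ^ (\<Sum>P\<in>T. wt P) :: real fps)
      = (\<Sum>T\<in>Pow A. (- (fps_X ^ wt P)) * ((-1) ^ card T * fps_X ^ (\<Sum>P\<in>T. wt P)))"
    unfolding sum.reindex[OF inj] comp_def
  proof (rule sum.cong[OF refl])
    fix T assume "T \<in> Pow A"
    then have "finite T" "P \<notin> T" using insert by (auto intro: finite_subset)
    then show "(-1) ^ card (insert P T) * fps_X ^ (\<Sum>P\<in>insert P T. wt P)
        = (- (fps_X ^ wt P)) * ((-1) ^ card T * fps_X ^ (\<Sum>P\<in>T. wt P) :: real fps)"
      by (simp add: power_add)
  qed
  also have "\<dots> = (- (fps_X ^ wt P)) * (\<Prod>P\<in>A. 1 - fps_X ^ wt P)" unfolding insert.IH sum_distrib_left ..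
  finally show ?case
    unfolding Pow_insert using insert disj by (subst sum.union_disjoint) (auto simp: insert.IH[symmetric] algebra_simps)
qed simp

lemma prod_one_minus_X_power_nth:
  fixes wt :: "'p \<Rightarrow> nat"
  assumes "finite A"
  shows "(\<Prod>P\<in>A. 1 - fps_X ^ wt P :: real fps) $ n = (\<Sum>T | T \<subseteq> A \<and> (\<Sum>P\<in>T. wt P) = n. (-1) ^ card T)"
proof -
  have "((-1) ^ j * f :: real fps) $ n = (-1) ^ j * f $ n" for j f by (cases "even j") auto
  then have "(\<Prod>P\<in>A. 1 - fps_X ^ wt P :: real fps) $ n = (\<Sum>T\<in>Pow A. if (\<Sum>P\<in>T. wt P) = n then (-1) ^ card T else 0)"
    unfolding prod_one_minus_X_power[OF assms] fps_sum_nth by (intro sum.cong) (auto simp: fps_X_power_nth)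
  also have "\<dots> = (\<Sum>T\<in>{T \<in> Pow A. (\<Sum>P\<in>T. wt P) = n}. (-1) ^ card T)"
    using assms by (intro sum.inter_filter[symmetric]) simp
  also have "{T \<in> Pow A. (\<Sum>P\<in>T. wt P) = n} = {T. T \<subseteq> A \<and> (\<Sum>P\<in>T. wt P) = n}" by auto
  finally show ?thesis .
qed

lemma prod_by_weight:
  fixes wt :: "'p \<Rightarrow> nat" and f :: "nat \<Rightarrow> 'c::comm_monoid_mult"
  assumes "finite A" "finite J" "wt ` A \<subseteq> J"
  shows "(\<Prod>P\<in>A. f (wt P)) = (\<Prod>j\<in>J. f j ^ card {P \<in> A. wt P = j})"
proof -
  have "(\<Prod>P\<in>A. f (wt P)) = (\<Prod>j\<in>J. \<Prod>P\<in>{P \<in> A. wt P = j}. f (wt P))"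
    by (rule prod.group[OF assms, symmetric])
  also have "\<dots> = (\<Prod>j\<in>J. f j ^ card {P \<in> A. wt P = j})" by (intro prod.cong) auto
  finally show ?thesis .
qed

definition sqf :: "'b set \<Rightarrow> ('b \<Rightarrow>\<^sub>0 int)" where "sqf T = Abs_poly_mapping (\<lambda>P. if P \<in> T then 1 else 0)"

lemma mult_at_sqf: "finite T \<Longrightarrow> mult_at (sqf T) P = (if P \<in> T then 1 else 0)"
  unfolding sqf_def by (subst lookup_Abs_poly_mapping) auto

lemma keys_sqf: "finite T \<Longrightarrow> Poly_Mapping.keys (sqf T) = T"
  by (auto simp: in_keys_iff mult_at_sqf split: if_splits)

text \<open>\<open>d\<close> will be the least positive divisor degree of
  \<open>card_Eff_asymptotics\<close>; what is used here is that it divides all degrees.\<close>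

locale global_ff = function_field "constant_field :: 'a::field set" x W for x W +
  fixes q d :: nat
  assumes q: "card (constant_field :: 'a set) = q" and d_pos: "d > 0" and d_dvd: "D \<in> Divs \<Longrightarrow> int d dvd ddeg D"
begin

lemma pd_degree_q: "P \<in> places \<Longrightarrow> pd_degree q P = pdeg P"
  using pd_degree_eq q by simp

lemma divisors_eq: "(divisors :: 'a divisor set) = Divs"
  by (simp add: divisors_def Divs_def prime_divisors_eq_places)

lemma effective_iff: "effective D \<longleftrightarrow> dle 0 D"
  by (simp add: effective_def dle_def)

lemma div_degree_eq: "D \<in> Divs \<Longrightarrow> div_degree q D = ddeg D"
  unfolding div_degree_def ddeg_def by (intro sum.cong) (auto simp: Divs_def pd_degree_q subset_iff)

text \<open>The degree in units of \<open>d\<close>; the division is exact on places by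
  \<open>d_dvd\<close>.\<close>

definition wt :: "'a set \<Rightarrow> nat" where "wt P = pdeg P div d"

lemma pdeg_wt: "P \<in> places \<Longrightarrow> pdeg P = d * wt P"
  using d_dvd[of "Poly_Mapping.single P 1"] by (simp add: Divs_closed ddeg_single wt_def)

lemma wt_pos: "P \<in> places \<Longrightarrow> wt P > 0"
  using pdeg_wt[of P] pdeg_pos[of P] by (auto intro: Nat.gr0I)

lemma finite_wt_le: "finite {P \<in> places. wt P \<le> n}"
proof -
  have "{P \<in> places. wt P \<le> n} \<subseteq> {P \<in> places. pdeg P \<le> d * n}" by (auto simp: pdeg_wt)
  then show ?thesis using finite_places_of_degree_le finite_subset by blast
qed

definition EffIn :: "'a set set \<Rightarrow> nat \<Rightarrow> 'a divisor set"
  where "EffIn A n = {D \<in> Eff (d * n). Poly_Mapping.keys D \<subseteq> A}"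

lemma finite_EffIn: "finite (EffIn A n)"
  unfolding EffIn_def using finite_Eff by simp

text \<open>Either \<open>P\<close> does not occur, or one copy of it can be removed. In terms of
  series this is multiplication by \<open>1 - X ^ wt P\<close>.\<close>

lemma EffIn_insert:
  assumes P: "P \<in> places" "P \<notin> A"
  shows "card (EffIn (insert P A) n) = card (EffIn A n) + (if n < wt P then 0 else card (EffIn (insert P A) (n - wt P)))"
proof -
  let ?s = "Poly_Mapping.single P (1::int)"
  have split: "EffIn (insert P A) n = EffIn A n \<union> {D \<in> EffIn (insert P A) n. mult_at D P \<noteq> 0}"
    using P by (auto simp: EffIn_def in_keys_iff)
  have "EffIn A n \<inter> {D \<in> EffIn (insert P A) n. mult_at D P \<noteq> 0} = {}"
    using P by (auto simp: EffIn_def in_keys_iff)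
  then have "card (EffIn (insert P A) n) = card (EffIn A n) + card {D \<in> EffIn (insert P A) n. mult_at D P \<noteq> 0}"
    using split finite_EffIn by (metis (no_types, lifting) card_Un_disjoint finite_Un)
  moreover have "card {D \<in> EffIn (insert P A) n. mult_at D P \<noteq> 0} = (if n < wt P then 0 else card (EffIn (insert P A) (n - wt P)))"
  proof (cases "n < wt P")
    case True
    have "{D \<in> EffIn (insert P A) n. mult_at D P \<noteq> 0} = {}"
    proof -
      have False if "D \<in> Eff (d * n)" "mult_at D P \<noteq> 0" for D
        using EffD(2)[OF that] True d_pos by (simp add: pdeg_wt[OF P(1)])
      then show ?thesis by (auto simp: EffIn_def)
    qed
    then show ?thesis using True by (metis card.empty)
  next
    case False
    then have deg: "int (d * n) = int (d * (n - wt P)) + int (pdeg P)"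
      by (simp add: pdeg_wt[OF P(1)] algebra_simps flip: of_nat_add of_nat_mult)
    have "bij_betw (\<lambda>D. D + ?s) (EffIn (insert P A) (n - wt P)) {D \<in> EffIn (insert P A) n. mult_at D P \<noteq> 0}"
    proof (rule bij_betw_byWitness[where f' = "\<lambda>D. D - ?s"])
      show "(\<lambda>D. D + ?s) ` EffIn (insert P A) (n - wt P) \<subseteq> {D \<in> EffIn (insert P A) n. mult_at D P \<noteq> 0}"
      proof (rule image_subsetI)
        fix D assume D: "D \<in> EffIn (insert P A) (n - wt P)"
        then have "0 \<le> mult_at D P" by (auto simp: EffIn_def Eff_def dle_def)
        then have "mult_at D P + 1 \<noteq> 0" by linarith
        moreover have "Poly_Mapping.keys (D + ?s) \<subseteq> insert P A"
          using D keys_add[of D ?s] by (auto simp: EffIn_def)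
        ultimately show "D + ?s \<in> {D \<in> EffIn (insert P A) n. mult_at D P \<noteq> 0}"
          using D P(1) deg by (auto simp: EffIn_def Eff_def Divs_closed dle_def lookup_add lookup_single when_def ddeg_add ddeg_single)
      qed
      show "(\<lambda>D. D - ?s) ` {D \<in> EffIn (insert P A) n. mult_at D P \<noteq> 0} \<subseteq> EffIn (insert P A) (n - wt P)"
      proof (rule image_subsetI)
        fix D assume D: "D \<in> {D \<in> EffIn (insert P A) n. mult_at D P \<noteq> 0}"
        then have nn: "\<And>R. mult_at D R \<ge> 0" and ne: "mult_at D P \<noteq> 0" by (auto simp: EffIn_def Eff_def dle_def)
        have "mult_at D P \<ge> 1" using nn[of P] ne by linarith
        then have "dle 0 (D - ?s)" using nn by (auto simp: dle_def lookup_minus lookup_single when_def)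
        moreover have "Poly_Mapping.keys (D - ?s) \<subseteq> insert P A"
          using D keys_diff[of D ?s] by (auto simp: EffIn_def)
        ultimately show "D - ?s \<in> EffIn (insert P A) (n - wt P)"
          using D P(1) deg by (auto simp: EffIn_def Eff_def Divs_closed ddeg_diff ddeg_single)
      qed
    qed auto
    then show ?thesis using False by (simp add: bij_betw_same_card)
  qed
  ultimately show ?thesis by simp
qed

lemma EffIn_gf:
  assumes "finite A" "A \<subseteq> places"
  shows "Abs_fps (\<lambda>n. real (card (EffIn A n))) = (\<Prod>P\<in>A. inverse (1 - fps_X ^ wt P))"
  using assms
proof (induction A rule: finite_induct)
  case empty
  have "EffIn {} n = (if n = 0 then {0} else {})" for n
  proof -
    have "D = 0" if "Poly_Mapping.keys D = {}" for D :: "'a divisor" using that by simp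
    then show ?thesis
      using d_pos by (auto simp: EffIn_def Eff_def Divs_closed dle_def)
  qed
  then show ?case by (auto intro!: fps_ext)
next
  case (insert P A)
  let ?F = "\<lambda>A. Abs_fps (\<lambda>n. real (card (EffIn A n)))"
  have P: "P \<in> places" "P \<notin> A" using insert by auto
  have "?F (insert P A) * (1 - fps_X ^ wt P) = ?F A"
  proof (rule fps_ext)
    fix n
    have "(?F (insert P A) * (1 - fps_X ^ wt P)) $ n
        = real (card (EffIn (insert P A) n)) - (if n < wt P then 0 else real (card (EffIn (insert P A) (n - wt P))))"
      by (simp add: right_diff_distrib fps_X_power_mult_right_nth)
    then show "(?F (insert P A) * (1 - fps_X ^ wt P)) $ n = ?F A $ n"
      using EffIn_insert[OF P, of n] by (simp split: if_splits)
  qed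
  then have "?F A * inverse (1 - fps_X ^ wt P) = ?F (insert P A) * (inverse (1 - fps_X ^ wt P) * (1 - fps_X ^ wt P))"
    by (metis (no_types, lifting) mult.assoc mult.commute)
  then have "?F (insert P A) = ?F A * inverse (1 - fps_X ^ wt P)"
    by (simp only: geometric_cancel[OF wt_pos[OF P(1)]] mult_1_right)
  then show ?case using insert by (simp add: mult.commute)
qed

definition prime_num :: "nat \<Rightarrow> nat" where "prime_num m = card {P \<in> places. wt P = m}"

lemma card_Eff_eq: "real (card (Eff (d * n))) = (\<Prod>m=1..n. inverse (1 - fps_X ^ m :: real fps) ^ prime_num m) $ n"
proof -
  let ?A = "{P \<in> places. wt P \<le> n}"
  have "Eff (d * n) = EffIn ?A n"
  proof -
    have "P \<in> ?A" if "D \<in> Eff (d * n)" "P \<in> Poly_Mapping.keys D" for D P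
      using EffD(1,2)[OF that(1), of P] that(2) d_pos by (auto simp: in_keys_iff pdeg_wt)
    then show ?thesis by (auto simp: EffIn_def)
  qed
  then have "real (card (Eff (d * n))) = (\<Prod>P\<in>?A. inverse (1 - fps_X ^ wt P :: real fps)) $ n"
    using EffIn_gf[OF finite_wt_le[of n]] by (metis (no_types, lifting) fps_nth_Abs_fps mem_Collect_eq subsetI)
  also have "(\<Prod>P\<in>?A. inverse (1 - fps_X ^ wt P :: real fps)) = (\<Prod>m=1..n. inverse (1 - fps_X ^ m) ^ card {P \<in> ?A. wt P = m})"
    using wt_pos finite_wt_le by (intro prod_by_weight) (auto simp: Suc_le_eq)
  also have "\<dots> = (\<Prod>m=1..n. inverse (1 - fps_X ^ m) ^ prime_num m)"
    unfolding prime_num_def by (intro prod.cong refl arg_cong2[of _ _ _ _ "(^)"] arg_cong[of _ _ card]) auto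
  finally show ?thesis .
qed

lemma coprime_prod_nth:
  assumes "m \<le> j"
  shows "(\<Prod>i\<in>{m<..j}. (1 - fps_X ^ i :: real fps) ^ prime_num i) $ n
    = (\<Sum>T | T \<subseteq> {P \<in> places. m < wt P \<and> wt P \<le> j} \<and> (\<Sum>P\<in>T. wt P) = n. (-1) ^ card T)"
proof -
  let ?A = "{P \<in> places. m < wt P \<and> wt P \<le> j}"
  have fin: "finite ?A" using finite_subset[OF _ finite_wt_le[of j], of ?A] by auto
  have "(\<Prod>P\<in>?A. 1 - fps_X ^ wt P :: real fps) = (\<Prod>i\<in>{m<..j}. (1 - fps_X ^ i) ^ card {P \<in> ?A. wt P = i})"
    using fin by (intro prod_by_weight) auto
  also have "\<dots> = (\<Prod>i\<in>{m<..j}. (1 - fps_X ^ i) ^ prime_num i)"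
    unfolding prime_num_def by (intro prod.cong refl arg_cong2[of _ _ _ _ "(^)"] arg_cong[of _ _ card]) auto
  finally show ?thesis using prod_one_minus_X_power_nth[OF fin, of wt n] by simp
qed

text \<open>One direction of the bijection between squarefree distinguishable divisors and pairs of
  a prime and a finite set of primes of larger degree; \<open>pair_of_squarefree\<close> is the
  other.\<close>

lemma sqf_pair:
  assumes P: "P \<in> places" and T: "finite T" "T \<subseteq> places" "\<And>R. R \<in> T \<Longrightarrow> wt P < wt R"
  defines "D \<equiv> sqf (insert P T)"
  shows "D \<in> Divs" "dle 0 D" "Poly_Mapping.keys D = insert P T" "distinguishable q D" "P_min q D = P"
    "div_moebius D = - ((-1) ^ card T)" "ddeg D = int (d * (wt P + (\<Sum>R\<in>T. wt R)))"
    "\<forall>R. mult_at D R \<le> 1"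
proof -
  have fin: "finite (insert P T)" using T by simp
  have m: "mult_at D R = (if R \<in> insert P T then 1 else 0)" for R unfolding D_def by (rule mult_at_sqf[OF fin])
  show keys: "Poly_Mapping.keys D = insert P T" unfolding D_def by (rule keys_sqf[OF fin])
  show D: "D \<in> Divs" unfolding Divs_def using keys P T by simp
  show "dle 0 D" by (auto simp: dle_def m)
  show le1: "\<forall>R. mult_at D R \<le> 1" by (simp add: m)
  have PT: "P \<notin> T" using T(3) by blast
  have deg: "pd_degree q R = d * wt R" if "R \<in> insert P T" for R
    using that P T(2) by (auto simp: pd_degree_q pdeg_wt)
  have min: "min_degree q D = d * wt P"
    unfolding min_degree_def keys
  proof (rule Min_eqI)
    show "finite (pd_degree q ` insert P T)" using fin by simp
    show "d * wt P \<in> pd_degree q ` insert P T" using deg[of P] by (intro image_eqI[of _ _ P]) auto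
    fix y assume "y \<in> pd_degree q ` insert P T"
    then obtain R where "R \<in> insert P T" "y = d * wt R" using deg by auto
    then show "d * wt P \<le> y" using T(3)[of R] by (cases "R = P") auto
  qed
  have uniq: "R = P" if "R \<in> Poly_Mapping.keys D \<and> pd_degree q R = min_degree q D" for R
    using that T(3)[of R] d_pos deg[of R] by (auto simp: keys min)
  have PD: "P \<in> Poly_Mapping.keys D \<and> pd_degree q P = min_degree q D" using deg[of P] by (simp add: keys min)
  have "D \<noteq> 0" using keys by auto
  then show "distinguishable q D" unfolding distinguishable_def using PD uniq by blast
  show "P_min q D = P" unfolding P_min_def using PD uniq by (rule the_equality)
  have "\<not> (\<exists>R. mult_at D R > 1)" using le1 by (auto simp: not_less)
  then show "div_moebius D = - ((-1) ^ card T)" unfolding div_moebius_def keys using PT T(1) by simp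
  have "ddeg D = (\<Sum>R\<in>insert P T. int (d * wt R))"
    unfolding ddeg_def keys using P T(2) by (intro sum.cong) (auto simp: m pdeg_wt)
  also have "\<dots> = int (d * (wt P + (\<Sum>R\<in>T. wt R)))" using PT T(1) by (simp add: sum_distrib_left algebra_simps)
  finally show "ddeg D = int (d * (wt P + (\<Sum>R\<in>T. wt R)))" .
qed

lemma pair_of_squarefree:
  assumes D: "D \<in> Divs" "dle 0 D" "distinguishable q D" "\<forall>R. mult_at D R \<le> 1"
  defines "P \<equiv> P_min q D" and "T \<equiv> Poly_Mapping.keys D - {P_min q D}"
  shows "P \<in> places" "finite T" "T \<subseteq> places" "\<And>R. R \<in> T \<Longrightarrow> wt P < wt R" "sqf (insert P T) = D"
proof -
  let ?Pr = "\<lambda>P. P \<in> Poly_Mapping.keys D \<and> pd_degree q P = min_degree q D"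
  have ex1: "\<exists>!P. ?Pr P" using D(3) by (simp add: distinguishable_def)
  have P: "?Pr P" unfolding P_def P_min_def by (rule theI'[OF ex1])
  have pl: "Poly_Mapping.keys D \<subseteq> places" using D(1) by (simp add: Divs_def)
  show Pp: "P \<in> places" using P pl by auto
  show "finite T" by (simp add: T_def)
  show Tp: "T \<subseteq> places" using pl by (auto simp: T_def)
  show "wt P < wt R" if R: "R \<in> T" for R
  proof -
    have RD: "R \<in> Poly_Mapping.keys D" "R \<noteq> P" using R by (auto simp: T_def P_def)
    have Rp: "R \<in> places" using R Tp by auto
    have "min_degree q D \<le> pd_degree q R" unfolding min_degree_def using RD(1) by (intro Min_le) auto
    moreover have "pd_degree q R \<noteq> min_degree q D" using ex1 P RD by blast
    ultimately have "pd_degree q P < pd_degree q R" using P by simp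
    then show ?thesis using Pp Rp by (simp add: pd_degree_q pdeg_wt)
  qed
  have keys: "insert P T = Poly_Mapping.keys D" using P by (auto simp: T_def P_def)
  show "sqf (insert P T) = D"
  proof (rule poly_mapping_eqI)
    fix R
    have "mult_at D R \<le> 1" "0 \<le> mult_at D R" using D(2,4) by (auto simp: dle_def)
    moreover have "R \<in> Poly_Mapping.keys D \<longleftrightarrow> mult_at D R \<noteq> 0" by (simp add: in_keys_iff)
    ultimately show "mult_at (sqf (insert P T)) R = mult_at D R" unfolding keys by (auto simp: mult_at_sqf)
  qed
qed

definition dist_of_degree :: "'a set set \<Rightarrow> nat \<Rightarrow> 'a divisor set"
  where "dist_of_degree S j = {D \<in> distinguishable_divisors q S. ddeg D = int (d * j)}"

lemma dist_iff: "D \<in> distinguishable_divisors q S \<longleftrightarrow> D \<in> Divs \<and> dle 0 D \<and> distinguishable q D \<and> P_min q D \<in> S"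
  by (simp add: distinguishable_divisors_def divisors_eq effective_iff)

lemma finite_dist_of_degree: "finite (dist_of_degree S j)"
  by (rule finite_subset[OF _ finite_Eff[of "d * j"]]) (auto simp: dist_of_degree_def dist_iff Eff_def)

text \<open>Split off the smallest prime from each squarefree divisor and group by its degree
  \<open>m\<close>. The signed count of the remaining sets is a coefficient of the product over
  degrees above \<open>m\<close>, and the split prime gives the minus sign.\<close>

lemma moebius_sum:
  assumes S: "S \<subseteq> places"
  shows "(\<Sum>D\<in>dist_of_degree S j. real_of_int (div_moebius D))
    = - (\<Sum>m=1..j. real (card {P \<in> S. wt P = m}) * (\<Prod>i\<in>{m<..j}. (1 - fps_X ^ i :: real fps) ^ prime_num i) $ (j - m))"
proof -
  define Sj where "Sj = {P \<in> S. wt P \<le> j}"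
  \<comment> \<open>The truncated subtraction is harmless, since \<open>wt P \<le> j\<close> on
    \<open>Sj\<close>. Primes heavier than \<open>j\<close> cannot occur in a divisor of degree
    \<open>d * j\<close>.\<close>
  define TT where "TT P = {T. T \<subseteq> {R \<in> places. wt P < wt R \<and> wt R \<le> j} \<and> (\<Sum>R\<in>T. wt R) = j - wt P}" for P
  define c where "c m = (\<Prod>i\<in>{m<..j}. (1 - fps_X ^ i :: real fps) ^ prime_num i) $ (j - m)" for m
  have finB: "finite {R \<in> places. m < wt R \<and> wt R \<le> j}" for m
    by (rule finite_subset[OF _ finite_wt_le[of j]]) auto
  have finTT: "finite (TT P)" for P
    by (rule finite_subset[OF _ finite_Pow_iff[THEN iffD2, OF finB[of "wt P"]]]) (auto simp: TT_def)
  have finT: "finite T" if "T \<in> TT P" for T P using that finite_subset[OF _ finB[of "wt P"]] by (auto simp: TT_def)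
  have finSj: "finite Sj" unfolding Sj_def using S by (intro finite_subset[OF _ finite_wt_le[of j]]) auto
  have Spl: "P \<in> places" if "P \<in> Sj" for P using that S by (auto simp: Sj_def)
  let ?X = "{D \<in> dist_of_degree S j. \<forall>R. mult_at D R \<le> 1}"
  have "(\<Sum>D\<in>dist_of_degree S j. real_of_int (div_moebius D)) = (\<Sum>D\<in>?X. real_of_int (div_moebius D))"
  proof (rule sum.mono_neutral_right[OF finite_dist_of_degree], force, rule ballI)
    fix D assume "D \<in> dist_of_degree S j - ?X"
    then obtain R where "mult_at D R > 1" by (auto simp: not_le)
    then have "\<exists>R. mult_at D R > 1" by blast
    then show "real_of_int (div_moebius D) = 0" by (simp add: div_moebius_def)
  qed
  also have "\<dots> = (\<Sum>(P, T)\<in>Sigma Sj TT. - ((-1) ^ card T))"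
  proof (rule sum.reindex_bij_witness[where i = "\<lambda>(P, T). sqf (insert P T)"
        and j = "\<lambda>D. (P_min q D, Poly_Mapping.keys D - {P_min q D})"])
    fix D assume "D \<in> ?X"
    then have D: "D \<in> Divs" "dle 0 D" "distinguishable q D" "\<forall>R. mult_at D R \<le> 1" "P_min q D \<in> S" "ddeg D = int (d * j)"
      by (auto simp: dist_of_degree_def dist_iff)
    let ?P = "P_min q D" and ?T = "Poly_Mapping.keys D - {P_min q D}"
    note pr = pair_of_squarefree[OF D(1-4)]
    note sq = sqf_pair[OF pr(1-4), unfolded pr(5)]
    show "(case (?P, ?T) of (P, T) \<Rightarrow> sqf (insert P T)) = D" using pr(5) by simp
    have sum: "j = wt ?P + (\<Sum>R\<in>?T. wt R)"
      using sq(7) D(6) d_pos by (simp del: of_nat_mult)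
    have "wt R \<le> j" if "R \<in> ?T" for R
      using member_le_sum[OF that, of wt] pr(2) sum by simp
    then show "(?P, ?T) \<in> Sigma Sj TT"
      using D(5) pr(3,4) sum by (auto simp: Sj_def TT_def)
    show "(case (?P, ?T) of (P, T) \<Rightarrow> - ((-1) ^ card T)) = real_of_int (div_moebius D)"
      using sq(6) by simp
  next
    fix y assume "y \<in> Sigma Sj TT"
    then obtain P T where y: "y = (P, T)" "P \<in> Sj" "T \<in> TT P" by auto
    have T: "finite T" "T \<subseteq> places" "\<And>R. R \<in> T \<Longrightarrow> wt P < wt R" "(\<Sum>R\<in>T. wt R) = j - wt P"
      using finT[OF y(3)] y(3) unfolding TT_def by blast+
    note sq = sqf_pair[OF Spl[OF y(2)] T(1-3)]
    have PT: "P \<notin> T" using T(3) by blast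
    show "(P_min q (case y of (P, T) \<Rightarrow> sqf (insert P T)),
        Poly_Mapping.keys (case y of (P, T) \<Rightarrow> sqf (insert P T)) - {P_min q (case y of (P, T) \<Rightarrow> sqf (insert P T))}) = y"
      using sq(3,5) PT y(1) by auto
    have "ddeg (sqf (insert P T)) = int (d * j)" using sq(7) T(4) y(2) by (simp add: Sj_def)
    then show "(case y of (P, T) \<Rightarrow> sqf (insert P T)) \<in> ?X"
      using sq(1,2,4,5,8) y by (simp add: dist_of_degree_def dist_iff Sj_def)
  qed
  also have "\<dots> = - (\<Sum>P\<in>Sj. \<Sum>T\<in>TT P. (-1) ^ card T)"
    using finSj finTT by (subst sum.Sigma[symmetric]) (auto simp: sum_negf)
  also have "(\<Sum>P\<in>Sj. \<Sum>T\<in>TT P. (-1) ^ card T) = (\<Sum>P\<in>Sj. c (wt P))"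
  proof (rule sum.cong[OF refl])
    fix P assume "P \<in> Sj"
    then show "(\<Sum>T\<in>TT P. (-1) ^ card T) = c (wt P)"
      unfolding c_def TT_def by (subst coprime_prod_nth) (auto simp: Sj_def)
  qed
  also have "\<dots> = (\<Sum>m=1..j. \<Sum>P\<in>{P \<in> Sj. wt P = m}. c (wt P))"
    using finSj Spl wt_pos by (intro sum.group[symmetric]) (auto simp: Sj_def Suc_le_eq)
  also have "\<dots> = (\<Sum>m=1..j. real (card {P \<in> S. wt P = m}) * c m)"
  proof (rule sum.cong[OF refl])
    fix m assume "m \<in> {1..j}"
    then have "{P \<in> Sj. wt P = m} = {P \<in> S. wt P = m}" by (auto simp: Sj_def)
    moreover have "(\<Sum>P\<in>{P \<in> S. wt P = m}. c (wt P)) = (\<Sum>P\<in>{P \<in> S. wt P = m}. c m)" by (intro sum.cong) auto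
    ultimately show "(\<Sum>P\<in>{P \<in> Sj. wt P = m}. c (wt P)) = real (card {P \<in> S. wt P = m}) * c m" by simp
  qed
  finally show ?thesis by (simp add: c_def)
qed

text \<open>All degrees are multiples of \<open>d\<close>, so a degree up to \<open>n\<close> is
  \<open>d * j\<close> with \<open>1 \<le> j \<le> n div d\<close>, and the norm is a power of
  \<open>q ^ d\<close>.\<close>

lemma moebius_sum_upto:
  assumes S: "S \<subseteq> places"
  shows "- (\<Sum>D | D \<in> distinguishable_divisors q S \<and> 1 \<le> div_degree q D \<and> div_degree q D \<le> int n.
      real_of_int (div_moebius D) / div_norm q D)
    = (\<Sum>j=0..n div d. (\<Sum>m=1..j. real (card {P \<in> S. wt P = m}) *
        (\<Prod>i\<in>{m<..j}. (1 - fps_X ^ i :: real fps) ^ prime_num i) $ (j - m)) / (real q ^ d) ^ j)"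
proof -
  let ?X = "{D. D \<in> distinguishable_divisors q S \<and> 1 \<le> div_degree q D \<and> div_degree q D \<le> int n}"
  let ?f = "\<lambda>D. real_of_int (div_moebius D) / div_norm q D"
  define g where "g D = nat (ddeg D) div d" for D
  have X: "D \<in> ?X \<longleftrightarrow> D \<in> distinguishable_divisors q S \<and> 1 \<le> ddeg D \<and> ddeg D \<le> int n" for D
    using div_degree_eq[of D] by (auto simp: dist_iff)
  have "?X \<subseteq> (\<Union>m\<le>n. Eff m)"
  proof
    fix D assume "D \<in> ?X"
    then have "D \<in> Divs" "dle 0 D" "1 \<le> ddeg D" "ddeg D \<le> int n" using X[of D] dist_iff[of D S] by blast+
    then have "D \<in> Eff (nat (ddeg D))" "nat (ddeg D) \<le> n" by (auto simp: Eff_def)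
    then show "D \<in> (\<Union>m\<le>n. Eff m)" by blast
  qed
  then have fin: "finite ?X" using finite_Eff finite_subset by (metis (no_types, lifting) finite_UN_I finite_atMost)
  have gd: "ddeg D = int (d * g D)" if "D \<in> Divs" "ddeg D \<ge> 0" for D
  proof -
    have "int d dvd ddeg D" using d_dvd that by blast
    then have "d dvd nat (ddeg D)" using that(2) by (metis int_dvd_int_iff int_nat_eq)
    then show ?thesis using that(2) by (simp add: g_def)
  qed
  have gX: "g D \<in> {1..n div d}" if "D \<in> ?X" for D
  proof -
    have D: "D \<in> Divs" "1 \<le> ddeg D" "ddeg D \<le> int n" using that X[of D] dist_iff[of D S] by blast+
    have e: "ddeg D = int (d * g D)" using gd D by simp
    have "g D \<noteq> 0" using e D(2) by (cases "g D = 0") auto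
    moreover have "d * g D \<le> n" using e D(3) by linarith
    then have "g D \<le> n div d" using d_pos by (simp add: less_eq_div_iff_mult_less_eq mult.commute)
    ultimately show ?thesis by simp
  qed
  have fib: "{D \<in> ?X. g D = j} = dist_of_degree S j" if j: "j \<in> {1..n div d}" for j
  proof (intro equalityI subsetI)
    fix D assume D: "D \<in> {D \<in> ?X. g D = j}"
    then have "D \<in> distinguishable_divisors q S" "1 \<le> ddeg D" "g D = j" using X[of D] by blast+
    then show "D \<in> dist_of_degree S j" using gd[of D] by (auto simp: dist_of_degree_def dist_iff)
  next
    fix D assume "D \<in> dist_of_degree S j"
    then have D: "D \<in> distinguishable_divisors q S" "ddeg D = int (d * j)" by (auto simp: dist_of_degree_def)
    have "d * j \<ge> 1" using j d_pos by (simp add: Suc_le_eq)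
    moreover have "d * j \<le> n" using j by (metis atLeastAtMost_iff div_times_less_eq_dividend mult.commute mult_le_mono2 order.trans)
    ultimately have "1 \<le> ddeg D" "ddeg D \<le> int n" unfolding D(2) by (metis of_nat_1 of_nat_le_iff)+
    moreover have "g D = j" unfolding g_def D(2) nat_int using d_pos by simp
    ultimately show "D \<in> {D \<in> ?X. g D = j}" using D(1) X[of D] by blast
  qed
  have "(\<Sum>D\<in>?X. ?f D) = (\<Sum>j=1..n div d. \<Sum>D\<in>{D \<in> ?X. g D = j}. ?f D)"
    using gX by (intro sum.group[symmetric] fin) auto
  also have "\<dots> = (\<Sum>j=1..n div d. (\<Sum>D\<in>dist_of_degree S j. real_of_int (div_moebius D)) / (real q ^ d) ^ j)"
  proof (rule sum.cong[OF refl])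
    fix j assume j: "j \<in> {1..n div d}"
    have "?f D = real_of_int (div_moebius D) / (real q ^ d) ^ j" if "D \<in> dist_of_degree S j" for D
      using that div_degree_eq[of D] by (auto simp: dist_of_degree_def dist_iff div_norm_def power_mult simp flip: of_nat_mult)
    then show "(\<Sum>D\<in>{D \<in> ?X. g D = j}. ?f D) = (\<Sum>D\<in>dist_of_degree S j. real_of_int (div_moebius D)) / (real q ^ d) ^ j"
      unfolding fib[OF j] sum_divide_distrib by (intro sum.cong) auto
  qed
  finally have "- (\<Sum>D\<in>?X. ?f D) = (\<Sum>j=1..n div d. (\<Sum>m=1..j. real (card {P \<in> S. wt P = m}) *
        (\<Prod>i\<in>{m<..j}. (1 - fps_X ^ i :: real fps) ^ prime_num i) $ (j - m)) / (real q ^ d) ^ j)"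
    unfolding moebius_sum[OF S] by (simp add: sum_negf)
  \<comment> \<open>The term added at \<open>j = 0\<close> is an empty sum.\<close>
  also have "\<dots> = (\<Sum>j=0..n div d. (\<Sum>m=1..j. real (card {P \<in> S. wt P = m}) *
        (\<Prod>i\<in>{m<..j}. (1 - fps_X ^ i :: real fps) ^ prime_num i) $ (j - m)) / (real q ^ d) ^ j)"
    by (simp add: sum.atLeast_Suc_atMost)
  finally show ?thesis .
qed

text \<open>The limit over all degrees is restricted to the subsequence \<open>d * m\<close> of
  degrees at which primes can exist.\<close>

lemma density_limit:
  assumes S: "S \<subseteq> places" and dens: "has_natural_density q S \<delta>"
  shows "(\<lambda>m. real (card {P \<in> S. wt P = m}) / real (prime_num m)) \<longlonglongrightarrow> \<delta>"
proof -
  have count: "prime_count q T (d * m) = card {P \<in> T. wt P = m}" if "T \<subseteq> places" for T m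
  proof -
    have "{P \<in> T. pd_degree q P = d * m} = {P \<in> T. wt P = m}"
      using that d_pos by (auto simp: subset_iff pd_degree_q pdeg_wt)
    then show ?thesis by (simp add: prime_count_def)
  qed
  have "strict_mono (\<lambda>m. d * m)" using d_pos by (simp add: strict_mono_def)
  from LIMSEQ_subseq_LIMSEQ[OF dens[unfolded has_natural_density_def] this]
  have "(\<lambda>m. real (prime_count q S (d * m)) / real (prime_count q places (d * m))) \<longlonglongrightarrow> \<delta>"
    by (simp only: comp_def prime_divisors_eq_places[OF refl])
  then show ?thesis by (simp only: count[OF S] count[OF order.refl] prime_num_def)
qed

end

theorem theorem1p1:
  fixes p q :: nat and S :: "'a::field set set" and \<delta> :: real
  assumes "global_function_field p q TYPE('a)"
    and "S \<subseteq> prime_divisors"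
    and "has_natural_density q S \<delta>"
  shows "(\<lambda>n::nat. - (\<Sum>D | D \<in> distinguishable_divisors q S \<and>
              1 \<le> div_degree q D \<and> div_degree q D \<le> int n.
            real_of_int (div_moebius D) / div_norm q D))
           \<longlonglongrightarrow> \<delta>"
proof -
  obtain x :: 'a and W where ff: "function_field constant_field x W"
    using global_function_field_imp_function_field(1)[OF assms(1)] by blast
  have q: "card (constant_field :: 'a set) = q"
    by (rule global_function_field_imp_function_field(2)[OF assms(1)])
  interpret function_field "constant_field :: 'a set" x W by (rule ff)
  obtain d \<alpha> \<beta> n0 where d: "d > 0" "\<And>D. D \<in> Divs \<Longrightarrow> int d dvd ddeg D" and \<alpha>: "\<alpha> > 0"
    and Eff: "\<And>n. n \<ge> n0 \<Longrightarrow> d dvd n \<Longrightarrow> real (card (Eff n)) = \<alpha> * real q ^ n - \<beta>"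
    using card_Eff_asymptotics unfolding q by blast
  interpret global_ff x W q d by unfold_locales (use q d in auto)
  define e where "e n = \<bar>real (card (Eff (d * n))) - \<alpha> * (real q ^ d) ^ n\<bar>" for n
  \<comment> \<open>The asymptotic count has constant error \<open>\<beta>\<close> from
    \<open>n0\<close> on; the finitely many earlier errors are absorbed in the maximum.\<close>
  define C where "C = Max (insert \<bar>\<beta>\<bar> (e ` {..<n0}))"
  have C: "e n \<le> C" for n
  proof (cases "n < n0")
    case True
    then show ?thesis unfolding C_def by (intro Max_ge) auto
  next
    case False
    have "1 * n \<le> d * n" using d(1) by (intro mult_right_mono) auto
    then have "n0 \<le> d * n" using False by linarith
    then have "e n = \<bar>\<beta>\<bar>" using Eff[of "d * n"] by (simp add: e_def power_mult)
    then show ?thesis unfolding C_def by (intro Max_ge) auto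
  qed
  interpret E: euler_product prime_num "real q ^ d" \<alpha> C
  proof
    show "1 < real q ^ d" using card_k_ge_2 d(1) q by (intro one_less_power) auto
    show "\<alpha> > 0" by (rule \<alpha>)
    show "\<bar>(\<Prod>i=1..n. inverse (1 - fps_X ^ i :: real fps) ^ prime_num i) $ n - \<alpha> * (real q ^ d) ^ n\<bar> \<le> C" for n
      using C[of n] unfolding e_def card_Eff_eq .
  qed
  have S: "S \<subseteq> places" using assms(2) prime_divisors_eq_places by simp
  have fin: "finite {P \<in> places. wt P = m}" for m
    by (rule finite_subset[OF _ finite_wt_le[of m]]) auto
  have "real (card {P \<in> S. wt P = m}) \<le> real (prime_num m)" for m
    unfolding prime_num_def of_nat_le_iff using S by (intro card_mono fin) auto
  then have "(\<lambda>n. \<Sum>j=0..n. (\<Sum>m=1..j. real (card {P \<in> S. wt P = m}) * E.IZ m j $ (j - m)) / (real q ^ d) ^ j) \<longlonglongrightarrow> \<delta>"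
    using density_limit[OF S assms(3)] by (intro E.alladi_limit) auto
  \<comment> \<open>The limit is known along \<open>j\<close>; replacing the bound by
    \<open>n div d\<close>, which tends to infinity with \<open>n\<close>, returns to
    degrees.\<close>
  moreover have "filterlim (\<lambda>n. n div d) sequentially sequentially"
  proof (rule filterlim_at_top[THEN iffD2], rule allI)
    fix N
    show "eventually (\<lambda>n. N \<le> n div d) sequentially"
      using eventually_ge_at_top[of "d * N"]
      by eventually_elim (use d(1) in \<open>simp add: less_eq_div_iff_mult_less_eq mult.commute\<close>)
  qed
  ultimately have "(\<lambda>n. \<Sum>j=0..n div d. (\<Sum>m=1..j. real (card {P \<in> S. wt P = m}) * E.IZ m j $ (j - m)) / (real q ^ d) ^ j) \<longlonglongrightarrow> \<delta>"
    by (rule filterlim_compose)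
  then show ?thesis unfolding moebius_sum_upto[OF S] E.IZ_def .
qed

end
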